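(* Let $S=S_q=\{x\in\mathbb F_q^d: Q(x)=0\}$ with $Q=Q_q$ a non-degenerate quadratic form in $d$ variables over $\mathbb F_q$, with normalized surface measure $d\sigma$ and averaging constants $A(p\to r)$, $1\le p,r\le\infty$. (1) If $d\ge 3$ is odd, then $A(p\to r)\lesssim 1$ if and only if $\left(\frac1p,\frac1r\right)\in\mathbb T$, where $\mathbb T$ is the convex hull of the points $(0,0),(0,1),(1,1)$ and $\left(\frac{d}{d+1},\frac1{d+1}\right)$. (2) Let $d\ge 4$ be even, put $$P_1=\left(\frac{d^2-2d+2}{d(d-1)},\frac1{d-1}\right),\qquad P_2=\left(\frac{d-2}{d-1},\frac{d-2}{d(d-1)}\right),$$ and let $\Omega$ be the convex hull of $(0,0),(0,1),(1,1),P_1,P_2$. Then $A(p\to r)\lesssim 1$ for every $\left(\frac1p,\frac1r\right)\in\Omega\setminus\{P_1,P_2\}$. (3) If $d\ge 4$ is even and $p,r$ are defined by $P_1=\left(\frac1p,\frac1r\right)$, then the restricted strong-type estimate $$\|f\ast d\sigma\|_{L^r(\mathbb F_q^d,dx)}\lesssim\|f\|_{L^{p,1}(\mathbb F_q^d,dx)}$$ holds; and with the dual exponents $p',r'$, so that $P_2=\left(\frac1{r'},\frac1{p'}\right)$, the weak-type estimate $$\|f\ast d\sigma\|_{L^{p',\infty}(\mathbb F_q^d,dx)}\lesssim\|f\|_{L^{r'}(\mathbb F_q^d,dx)}$$ holds, for all $f:\mathbb F_q^d\to\mathbb C$. (4) If $d\ge 4$ is even, $S$ contains a $d/2$-dimensional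 subspace, and $\left(\frac1p,\frac1r\right)\notin\Omega$, then the $L^p$–$L^r$ averaging estimate is impossible, i.e. $A(p\to r)\lesssim 1$ fails.
   Context: Throughout, $q$ is a power of an odd prime and $\mathbb F_q$ is the field with $q$ elements. The space $(\mathbb F_q^d,dx)$ carries the normalized counting measure, $\int f\,dx=q^{-d}\sum_{x\in\mathbb F_q^d}f(x)$, and $L^p(\mathbb F_q^d,dx)$ and the Lorentz spaces $L^{p,1}(\mathbb F_q^d,dx)$, $L^{p,\infty}(\mathbb F_q^d,dx)$ are taken with respect to this probability measure. Exponents $1\le p,r\le\infty$ are identified with points $(1/p,1/r)\in[0,1]^2$, with $1/\infty=0$; $p'$ denotes the dual exponent, $1/p+1/p'=1$. A non-degenerate quadratic form $Q$ can be brought by a non-singular linear substitution to the form $a_1x_1^2+\cdots+a_dx_d^2$ with all $a_j\in\mathbb F_q\setminus\{0\}$; one may equivalently take $S=\{x\in\mathbb F_q^d: a_1x_1^2+\cdots+a_dx_d^2=0\}$. The normalized surface measure $d\sigma$ on $S$ is identified with the function $\sigma(x)=\frac{q^d}{|S|}1_S(x)$ on $(\mathbb F_q^d,dx)$, so that $f\ast d\sigma(y)=q^{-d}\sum_{x\in\mathbb F_q^d}f(y-x)\sigma(x)=\frac1{|S|}\sum_{x\in S}f(y-x)$. $A(p\to r)$ is the smallest constant such that $\|f\ast d\sigma\|_{L^r(\mathbb F_q^d,dx)}\le A(p\to r)\|f\|_{L^p(\mathbb F_q^d,dx)}$ for all $f:\mathbb F_q^d\to\mathbb C$. The notation $X\lesssim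 Y$ means $X\le CY$ with a constant $C$ independent of $q$ and $f$ (and of the choice of the form over $\mathbb F_q$), possibly depending on $d,p,r$. Precisely, the statement is about any family consisting of one non-degenerate form $Q_q$ for each $q$ in an infinite set of odd prime powers, with $d$ fixed: $A(p\to r)\lesssim 1$ means that the constants $A(p\to r)$ for $S_q$ are bounded over the family, and its failure means they are unbounded. In (4) every member $S_q$ of the family contains a $d/2$-dimensional linear subspace of $\mathbb F_q^d$. *)

theory Defs
  imports
    "HOL-Probability.Probability"
    "HOL-Algebra.Algebra"
    "HOL-Number_Theory.Prime_Powers"
begin

section \<open>Coordinate spaces over a finite field\<close>

text \<open>
  A family of forms over fields of different orders is a single object of the statement, so the
  fields cannot be types; they are \<^locale>\<open>field\<close> structures whose carriers lie in a common type.
  Vectors of length \<open>d\<close> are extensional functions on \<open>{..<d}\<close>.  The multiplication and the one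
  of \<open>coord_space\<close> are coordinatewise and only fill the fields of the module record.
\<close>

definition coord_space :: "'a ring \<Rightarrow> nat \<Rightarrow> ('a, nat \<Rightarrow> 'a) module" where
  "coord_space K d =
     \<lparr>carrier = {..<d} \<rightarrow>\<^sub>E carrier K,
      mult = (\<lambda>x y. \<lambda>i\<in>{..<d}. x i \<otimes>\<^bsub>K\<^esub> y i),
      one = (\<lambda>i\<in>{..<d}. \<one>\<^bsub>K\<^esub>),
      ring.zero = (\<lambda>i\<in>{..<d}. \<zero>\<^bsub>K\<^esub>),
      ring.add = (\<lambda>x y. \<lambda>i\<in>{..<d}. x i \<oplus>\<^bsub>K\<^esub> y i),
      smult = (\<lambda>c x. \<lambda>i\<in>{..<d}. c \<otimes>\<^bsub>K\<^esub> x i)\<rparr>"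

lemma coord_space_simps:
  "carrier (coord_space K d) = {..<d} \<rightarrow>\<^sub>E carrier K"
  "\<zero>\<^bsub>coord_space K d\<^esub> = (\<lambda>i\<in>{..<d}. \<zero>\<^bsub>K\<^esub>)"
  "x \<oplus>\<^bsub>coord_space K d\<^esub> y = (\<lambda>i\<in>{..<d}. x i \<oplus>\<^bsub>K\<^esub> y i)"
  "c \<odot>\<^bsub>coord_space K d\<^esub> x = (\<lambda>i\<in>{..<d}. c \<otimes>\<^bsub>K\<^esub> x i)"
  by (simp_all add: coord_space_def)

lemma module_coord_space:
  assumes "cring K"
  shows "module K (coord_space K d)"
proof -
  interpret cring K by (rule assms)
  have mem: "x i \<in> carrier K" if "x \<in> {..<d} \<rightarrow>\<^sub>E carrier K" "i < d" for x :: "nat \<Rightarrow> 'a" and i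
    using that by (auto simp: PiE_iff)
  have ext: "restrict g {..<d} = x"
    if "x \<in> {..<d} \<rightarrow>\<^sub>E carrier K" "\<And>i. i < d \<Longrightarrow> g i = x i" for g x :: "nat \<Rightarrow> 'a"
    using that by (intro extensionalityI[of _ "{..<d}"]) (auto simp: PiE_iff)
  have grp: "abelian_group (coord_space K d)"
  proof (rule abelian_groupI, unfold coord_space_simps)
    fix x assume x: "x \<in> {..<d} \<rightarrow>\<^sub>E carrier K"
    show "\<exists>y\<in>{..<d} \<rightarrow>\<^sub>E carrier K. (\<lambda>i\<in>{..<d}. y i \<oplus>\<^bsub>K\<^esub> x i) = (\<lambda>i\<in>{..<d}. \<zero>\<^bsub>K\<^esub>)"
    proof (intro bexI)
      show "(\<lambda>i\<in>{..<d}. (\<lambda>i\<in>{..<d}. \<ominus>\<^bsub>K\<^esub> x i) i \<oplus>\<^bsub>K\<^esub> x i) = (\<lambda>i\<in>{..<d}. \<zero>\<^bsub>K\<^esub>)"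
        by (intro restrict_ext) (simp add: mem[OF x] l_neg)
      show "(\<lambda>i\<in>{..<d}. \<ominus>\<^bsub>K\<^esub> x i) \<in> {..<d} \<rightarrow>\<^sub>E carrier K"
        by (simp add: mem[OF x])
    qed
  next
    fix x y z
    assume x: "x \<in> {..<d} \<rightarrow>\<^sub>E carrier K" and y: "y \<in> {..<d} \<rightarrow>\<^sub>E carrier K"
      and z: "z \<in> {..<d} \<rightarrow>\<^sub>E carrier K"
    show "(\<lambda>i\<in>{..<d}. (\<lambda>i\<in>{..<d}. x i \<oplus>\<^bsub>K\<^esub> y i) i \<oplus>\<^bsub>K\<^esub> z i) =
        (\<lambda>i\<in>{..<d}. x i \<oplus>\<^bsub>K\<^esub> (\<lambda>i\<in>{..<d}. y i \<oplus>\<^bsub>K\<^esub> z i) i)"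
      by (intro restrict_ext) (simp add: mem[OF x] mem[OF y] mem[OF z] a_assoc)
  next
    fix x y assume x: "x \<in> {..<d} \<rightarrow>\<^sub>E carrier K" and y: "y \<in> {..<d} \<rightarrow>\<^sub>E carrier K"
    show "(\<lambda>i\<in>{..<d}. x i \<oplus>\<^bsub>K\<^esub> y i) = (\<lambda>i\<in>{..<d}. y i \<oplus>\<^bsub>K\<^esub> x i)"
      by (intro restrict_ext) (simp add: mem[OF x] mem[OF y] a_comm)
    show "(\<lambda>i\<in>{..<d}. x i \<oplus>\<^bsub>K\<^esub> y i) \<in> {..<d} \<rightarrow>\<^sub>E carrier K"
      by (simp add: mem[OF x] mem[OF y])
  next
    fix x assume x: "x \<in> {..<d} \<rightarrow>\<^sub>E carrier K"
    show "(\<lambda>i\<in>{..<d}. (\<lambda>i\<in>{..<d}. \<zero>\<^bsub>K\<^esub>) i \<oplus>\<^bsub>K\<^esub> x i) = x"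
      by (rule ext[OF x]) (simp add: mem[OF x])
  qed simp
  show ?thesis
  proof (intro moduleI grp assms, unfold coord_space_simps)
    fix a x assume a: "a \<in> carrier K" and x: "x \<in> {..<d} \<rightarrow>\<^sub>E carrier K"
    show "(\<lambda>i\<in>{..<d}. a \<otimes>\<^bsub>K\<^esub> x i) \<in> {..<d} \<rightarrow>\<^sub>E carrier K"
      by (simp add: a mem[OF x])
  next
    fix a b x
    assume a: "a \<in> carrier K" and b: "b \<in> carrier K" and x: "x \<in> {..<d} \<rightarrow>\<^sub>E carrier K"
    show "(\<lambda>i\<in>{..<d}. (a \<oplus>\<^bsub>K\<^esub> b) \<otimes>\<^bsub>K\<^esub> x i) =
        (\<lambda>i\<in>{..<d}. (\<lambda>i\<in>{..<d}. a \<otimes>\<^bsub>K\<^esub> x i) i \<oplus>\<^bsub>K\<^esub> (\<lambda>i\<in>{..<d}. b \<otimes>\<^bsub>K\<^esub> x i) i)"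
      by (intro restrict_ext) (simp add: a b mem[OF x] l_distr)
    show "(\<lambda>i\<in>{..<d}. (a \<otimes>\<^bsub>K\<^esub> b) \<otimes>\<^bsub>K\<^esub> x i) =
        (\<lambda>i\<in>{..<d}. a \<otimes>\<^bsub>K\<^esub> (\<lambda>i\<in>{..<d}. b \<otimes>\<^bsub>K\<^esub> x i) i)"
      by (intro restrict_ext) (simp add: a b mem[OF x] m_assoc)
  next
    fix a x y
    assume a: "a \<in> carrier K" and x: "x \<in> {..<d} \<rightarrow>\<^sub>E carrier K"
      and y: "y \<in> {..<d} \<rightarrow>\<^sub>E carrier K"
    show "(\<lambda>i\<in>{..<d}. a \<otimes>\<^bsub>K\<^esub> (\<lambda>i\<in>{..<d}. x i \<oplus>\<^bsub>K\<^esub> y i) i) =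
        (\<lambda>i\<in>{..<d}. (\<lambda>i\<in>{..<d}. a \<otimes>\<^bsub>K\<^esub> x i) i \<oplus>\<^bsub>K\<^esub> (\<lambda>i\<in>{..<d}. a \<otimes>\<^bsub>K\<^esub> y i) i)"
      by (intro restrict_ext) (simp add: a mem[OF x] mem[OF y] r_distr)
  next
    fix x assume x: "x \<in> {..<d} \<rightarrow>\<^sub>E carrier K"
    show "(\<lambda>i\<in>{..<d}. \<one>\<^bsub>K\<^esub> \<otimes>\<^bsub>K\<^esub> x i) = x"
      by (rule ext[OF x]) (simp add: mem[OF x])
  qed
qed

definition subspace_of_dim ::
    "'a ring \<Rightarrow> ('a, 'v) module \<Rightarrow> nat \<Rightarrow> 'v set \<Rightarrow> bool" where
  "subspace_of_dim K V k H \<longleftrightarrow>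
     submodule H K V \<and>
     (\<exists>b \<in> {..<k} \<rightarrow> H.
        (\<forall>c \<in> {..<k} \<rightarrow> carrier K.
           (\<Oplus>\<^bsub>V\<^esub>i\<in>{..<k}. c i \<odot>\<^bsub>V\<^esub> b i) = \<zero>\<^bsub>V\<^esub> \<longrightarrow> (\<forall>i<k. c i = \<zero>\<^bsub>K\<^esub>)) \<and>
        (\<forall>h \<in> H. \<exists>c \<in> {..<k} \<rightarrow> carrier K. h = (\<Oplus>\<^bsub>V\<^esub>i\<in>{..<k}. c i \<odot>\<^bsub>V\<^esub> b i)))"


section \<open>Quadratic forms\<close>

definition quadratic_form :: "'a ring \<Rightarrow> nat \<Rightarrow> ((nat \<Rightarrow> 'a) \<Rightarrow> 'a) \<Rightarrow> bool" where
  "quadratic_form K d Q \<longleftrightarrow>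
     (\<exists>c. (\<forall>i<d. \<forall>j<d. c i j \<in> carrier K) \<and>
        (\<forall>x \<in> carrier (coord_space K d).
           Q x = (\<Oplus>\<^bsub>K\<^esub>i\<in>{..<d}. \<Oplus>\<^bsub>K\<^esub>j\<in>{..<d}. c i j \<otimes>\<^bsub>K\<^esub> x i \<otimes>\<^bsub>K\<^esub> x j)))"

definition polar_form ::
    "'a ring \<Rightarrow> nat \<Rightarrow> ((nat \<Rightarrow> 'a) \<Rightarrow> 'a) \<Rightarrow> (nat \<Rightarrow> 'a) \<Rightarrow> (nat \<Rightarrow> 'a) \<Rightarrow> 'a" where
  "polar_form K d Q x y = Q (x \<oplus>\<^bsub>coord_space K d\<^esub> y) \<ominus>\<^bsub>K\<^esub> Q x \<ominus>\<^bsub>K\<^esub> Q y"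

definition nondegenerate_form :: "'a ring \<Rightarrow> nat \<Rightarrow> ((nat \<Rightarrow> 'a) \<Rightarrow> 'a) \<Rightarrow> bool" where
  "nondegenerate_form K d Q \<longleftrightarrow>
     quadratic_form K d Q \<and>
     (\<forall>x \<in> carrier (coord_space K d).
        (\<forall>y \<in> carrier (coord_space K d). polar_form K d Q x y = \<zero>\<^bsub>K\<^esub>) \<longrightarrow>
        x = \<zero>\<^bsub>coord_space K d\<^esub>)"

definition quadric :: "'a ring \<Rightarrow> nat \<Rightarrow> ((nat \<Rightarrow> 'a) \<Rightarrow> 'a) \<Rightarrow> (nat \<Rightarrow> 'a) set" where
  "quadric K d Q = {x \<in> carrier (coord_space K d). Q x = \<zero>\<^bsub>K\<^esub>}"


section \<open>Lebesgue and Lorentz norms\<close>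

text \<open>Exponents \<open>1 \<le> p \<le> \<infinity>\<close> are elements of \<^typ>\<open>ennreal\<close>, and \<open>recip \<infinity> = 0\<close>.\<close>

definition recip :: "ennreal \<Rightarrow> real" where
  "recip p = enn2real (inverse p)"

definition Lp_norm :: "'v measure \<Rightarrow> ennreal \<Rightarrow> ('v \<Rightarrow> complex) \<Rightarrow> real" where
  "Lp_norm M p f =
     (if p = \<infinity> then enn2real (esssup M (\<lambda>x. ennreal (cmod (f x))))
      else (\<integral>x. cmod (f x) powr enn2real p \<partial>M) powr (1 / enn2real p))"

text \<open>The decreasing rearrangement \<open>f*(t) = inf {s \<ge> 0. M {|f| > s} \<le> t}\<close>.\<close>

definition rearrangement :: "'v measure \<Rightarrow> ('v \<Rightarrow> complex) \<Rightarrow> real \<Rightarrow> ennreal" where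
  "rearrangement M f t =
     Inf {s. emeasure M {x \<in> space M. s < ennreal (cmod (f x))} \<le> ennreal t}"

text \<open>The Lorentz functionals of \<open>L^{p,1}\<close> and of weak \<open>L^p\<close>.\<close>

definition Lorentz_1_norm :: "'v measure \<Rightarrow> ennreal \<Rightarrow> ('v \<Rightarrow> complex) \<Rightarrow> ennreal" where
  "Lorentz_1_norm M p f =
     (\<integral>\<^sup>+t\<in>{0<..}. ennreal (t powr recip p) * rearrangement M f t * ennreal (1 / t) \<partial>lborel)"

definition Lorentz_inf_norm :: "'v measure \<Rightarrow> ennreal \<Rightarrow> ('v \<Rightarrow> complex) \<Rightarrow> ennreal" where
  "Lorentz_inf_norm M p f =
     (SUP t\<in>{0<..}. ennreal (t powr recip p) * rearrangement M f t)"


section \<open>Averaging over a quadric\<close>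

definition dx :: "'a ring \<Rightarrow> nat \<Rightarrow> (nat \<Rightarrow> 'a) measure" where
  "dx K d = uniform_count_measure (carrier (coord_space K d))"

definition surface_density ::
    "'a ring \<Rightarrow> nat \<Rightarrow> (nat \<Rightarrow> 'a) set \<Rightarrow> (nat \<Rightarrow> 'a) \<Rightarrow> complex" where
  "surface_density K d S x =
     of_nat (card (carrier (coord_space K d))) / of_nat (card S) * indicator S x"

definition convolution ::
    "'a ring \<Rightarrow> nat \<Rightarrow> ((nat \<Rightarrow> 'a) \<Rightarrow> complex) \<Rightarrow> ((nat \<Rightarrow> 'a) \<Rightarrow> complex) \<Rightarrow>
     (nat \<Rightarrow> 'a) \<Rightarrow> complex" where
  "convolution K d f g y = (\<integral>x. f (y \<ominus>\<^bsub>coord_space K d\<^esub> x) * g x \<partial>dx K d)"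

definition averaging ::
    "'a ring \<Rightarrow> nat \<Rightarrow> ((nat \<Rightarrow> 'a) \<Rightarrow> 'a) \<Rightarrow> ((nat \<Rightarrow> 'a) \<Rightarrow> complex) \<Rightarrow>
     (nat \<Rightarrow> 'a) \<Rightarrow> complex" where
  "averaging K d Q f = convolution K d f (surface_density K d (quadric K d Q))"

lemma averaging_eq:
  assumes "finite (carrier K)" "carrier K \<noteq> {}"
  shows "averaging K d Q f y =
    (\<Sum>x\<in>quadric K d Q. f (y \<ominus>\<^bsub>coord_space K d\<^esub> x)) / of_nat (card (quadric K d Q))"
proof -
  let ?V = "carrier (coord_space K d)" and ?S = "quadric K d Q"
  have fin: "finite ?V" and ne: "?V \<noteq> {}"
    using assms by (auto simp: coord_space_def finite_PiE PiE_eq_empty_iff)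
  have "averaging K d Q f y =
      (\<Sum>x\<in>?V. f (y \<ominus>\<^bsub>coord_space K d\<^esub> x) * surface_density K d ?S x) / of_nat (card ?V)"
    unfolding averaging_def convolution_def dx_def uniform_count_measure_def
    using fin ne by (subst lebesgue_integral_point_measure_finite)
      (auto simp: scaleR_conv_of_real sum_divide_distrib field_simps)
  also have "\<dots> = (\<Sum>x\<in>?V. f (y \<ominus>\<^bsub>coord_space K d\<^esub> x) * indicator ?S x) / of_nat (card ?S)"
    unfolding surface_density_def sum_divide_distrib
    using fin ne by (intro sum.cong) auto
  also have "(\<Sum>x\<in>?V. f (y \<ominus>\<^bsub>coord_space K d\<^esub> x) * indicator ?S x) =
      (\<Sum>x\<in>?S. f (y \<ominus>\<^bsub>coord_space K d\<^esub> x))"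
    using fin by (intro sum.mono_neutral_cong_right) (auto simp: quadric_def)
  finally show ?thesis .
qed

text \<open>
  The smallest admissible constant \<open>A(p \<rightarrow> r)\<close>; over a finite field the set is nonempty and the
  infimum is attained.
\<close>

definition avg_const ::
    "'a ring \<Rightarrow> nat \<Rightarrow> ((nat \<Rightarrow> 'a) \<Rightarrow> 'a) \<Rightarrow> ennreal \<Rightarrow> ennreal \<Rightarrow> real" where
  "avg_const K d Q p r =
     Inf {A. 0 \<le> A \<and>
       (\<forall>f. Lp_norm (dx K d) r (averaging K d Q f) \<le> A * Lp_norm (dx K d) p f)}"


section \<open>Families of forms\<close>

text \<open>One non-degenerate form \<open>Q q\<close> over the field \<open>K q\<close> with \<open>q\<close> elements for each \<open>q \<in> I\<close>.\<close>

definition form_family ::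
    "nat \<Rightarrow> nat set \<Rightarrow> (nat \<Rightarrow> 'a ring) \<Rightarrow> (nat \<Rightarrow> (nat \<Rightarrow> 'a) \<Rightarrow> 'a) \<Rightarrow> bool" where
  "form_family d I K Q \<longleftrightarrow>
     infinite I \<and>
     (\<forall>q\<in>I. primepow q \<and> odd q \<and> field (K q) \<and> order (K q) = q \<and>
        nondegenerate_form (K q) d (Q q))"

text \<open>\<open>A(p \<rightarrow> r) \<lesssim> 1\<close> over the family.\<close>

definition avg_bounded ::
    "nat \<Rightarrow> nat set \<Rightarrow> (nat \<Rightarrow> 'a ring) \<Rightarrow> (nat \<Rightarrow> (nat \<Rightarrow> 'a) \<Rightarrow> 'a) \<Rightarrow>
     ennreal \<Rightarrow> ennreal \<Rightarrow> bool" where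
  "avg_bounded d I K Q p r \<longleftrightarrow> (\<exists>C. \<forall>q\<in>I. avg_const (K q) d (Q q) p r \<le> C)"

definition T_region :: "nat \<Rightarrow> (real \<times> real) set" where
  "T_region d =
     convex hull {(0, 0), (0, 1), (1, 1), (real d / (real d + 1), 1 / (real d + 1))}"

definition P1 :: "nat \<Rightarrow> real \<times> real" where
  "P1 d = (((real d)\<^sup>2 - 2 * real d + 2) / (real d * (real d - 1)), 1 / (real d - 1))"

definition P2 :: "nat \<Rightarrow> real \<times> real" where
  "P2 d = ((real d - 2) / (real d - 1), (real d - 2) / (real d * (real d - 1)))"

definition Omega_region :: "nat \<Rightarrow> (real \<times> real) set" where
  "Omega_region d = convex hull {(0, 0), (0, 1), (1, 1), P1 d, P2 d}"

end

theory Submission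
  imports Defs "HOL-Number_Theory.Cong"
begin

text \<open>
  Fourier analysis with Gauss sums controls the number of points of \<open>S\<close> in the translates of a set
  \<open>E\<close> up to its expected value, in mean square; for even \<open>d\<close> the transform of \<open>S\<close> is larger on \<open>S\<close>
  itself, and a second bound, better for small \<open>E\<close>, uses that the transform of \<open>E\<close> has little mass
  there.  Combined with the trivial sup bound this gives estimates at the vertices of the regions for
  indicator functions.  Instead of Riesz--Thorin and Marcinkiewicz on measurable functions, the bilinear
  form \<open>\<langle>f \<star> d\<sigma>, g\<rangle>\<close> is summed over dyadic level sets of \<open>f\<close> and \<open>g\<close>; off the diagonal, where
  \<open>1/p > 1/r\<close>, this interpolates two restricted estimates into a strong one on the open segment
  between them.  Since the measure is a probability measure, the rest of each region follows by
  monotonicity.  For necessity the estimate is tested on a point, on the quadric and on a subspace of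
  the quadric, for \<open>q \<rightarrow> \<infinity>\<close>.
\<close>

section \<open>Normalised means and norms\<close>

text \<open>The exponents come from balancing powers of q. Let m be the density of E, and phi the
  average of its indicator minus m. Always |phi| \<le> 3 q m. For odd d the mean square of phi is at
  most a constant times q^-(d-1) m; interpolating the two bounds with weight (d-1)/(d+1) cancels all
  powers of q and gives the fourth vertex of \<open>T_region\<close>. Because the mean m has been
  subtracted, one of the two constants decays, and the vertex lies strictly between the two
  estimates, so it is reached in strong form. For even d the general mean square bound is only
  q^-(d-2) m, and the same balance would stop at ((d-1)/d, 1/d), the midpoint of \<open>P1\<close>
  and \<open>P2\<close>. The second bound, of order q^-(d-1) m + q^(2-d/2) m^2, takes over below m =
  q^-(d/2), the density of a d/2-dimensional subspace. The resulting bound m^(d-2+2/d) for the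
  moment of order d-1 is met at m = q^-d and at m = q^-(d/2): a point and such a subspace are
  exactly the sets whose tests cut out \<open>P1\<close>. Since S = -S, averaging is self-adjoint,
  and \<open>P2\<close> is the mirror image of \<open>P1\<close> under (a, b) -> (1-b, 1-a).\<close>

definition mean :: "'v set \<Rightarrow> ('v \<Rightarrow> real) \<Rightarrow> real" where
  "mean V f = (\<Sum>x\<in>V. f x) / real (card V)"

definition dens :: "'v set \<Rightarrow> 'v set \<Rightarrow> real" where
  "dens V E = real (card E) / real (card V)"

text \<open>The norm of \<open>L\<^sup>p\<close> is indexed by \<open>a = 1/p\<close>, so that the point \<open>(1/p, 1/r)\<close> is used directly.\<close>

definition pnorm :: "'v set \<Rightarrow> real \<Rightarrow> ('v \<Rightarrow> real) \<Rightarrow> real" where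
  "pnorm V a f =
     (if a = 0 then Max ((\<lambda>x. \<bar>f x\<bar>) ` V) else mean V (\<lambda>x. \<bar>f x\<bar> powr (1 / a)) powr a)"

lemma mean_nonneg: "(\<And>x. x \<in> V \<Longrightarrow> 0 \<le> f x) \<Longrightarrow> 0 \<le> mean V f"
  unfolding mean_def by (simp add: sum_nonneg)

lemma mean_mono: "(\<And>x. x \<in> V \<Longrightarrow> f x \<le> g x) \<Longrightarrow> mean V f \<le> mean V g"
  unfolding mean_def by (intro divide_right_mono sum_mono) auto

lemma mean_cong: "(\<And>x. x \<in> V \<Longrightarrow> f x = g x) \<Longrightarrow> mean V f = mean V g"
  unfolding mean_def by simp

lemma mean_add: "mean V (\<lambda>x. f x + g x) = mean V f + mean V g"
  unfolding mean_def by (simp add: sum.distrib add_divide_distrib)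

lemma mean_cmult: "mean V (\<lambda>x. c * f x) = c * mean V f"
  unfolding mean_def by (simp add: sum_distrib_left)

lemma mean_const: "finite V \<Longrightarrow> V \<noteq> {} \<Longrightarrow> mean V (\<lambda>x. c) = c"
  unfolding mean_def by simp

lemma mean_indicator:
  assumes "finite V" "E \<subseteq> V"
  shows "mean V (indicator E) = dens V E"
  using assms by (simp add: mean_def dens_def sum.If_cases indicator_def Int_absorb1)

lemma mean_ge_single:
  assumes "finite V" "x \<in> V" "\<And>x. x \<in> V \<Longrightarrow> 0 \<le> f x"
  shows "f x / card V \<le> mean V f"
  using assms unfolding mean_def by (intro divide_right_mono member_le_sum) auto

lemma dens_nonneg: "0 \<le> dens V E"
  by (simp add: dens_def)

lemma dens_le_1: "finite V \<Longrightarrow> E \<subseteq> V \<Longrightarrow> dens V E \<le> 1"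
  by (auto simp: dens_def divide_le_eq_1 card_mono card_gt_0_iff)

lemma dens_pos: "finite V \<Longrightarrow> E \<subseteq> V \<Longrightarrow> E \<noteq> {} \<Longrightarrow> 0 < dens V E"
  by (auto simp: dens_def card_gt_0_iff intro!: divide_pos_pos finite_subset[of E V])

lemma pnorm_nonneg: "finite V \<Longrightarrow> V \<noteq> {} \<Longrightarrow> 0 \<le> pnorm V a f"
  by (auto simp: pnorm_def Max_ge_iff)

lemma pnorm_cong: "(\<And>x. x \<in> V \<Longrightarrow> \<bar>f x\<bar> = \<bar>g x\<bar>) \<Longrightarrow> pnorm V a f = pnorm V a g"
  unfolding pnorm_def by (simp cong: mean_cong image_cong_simp)

lemma pnorm_mono:
  assumes "finite V" "V \<noteq> {}" "\<And>x. x \<in> V \<Longrightarrow> \<bar>f x\<bar> \<le> \<bar>g x\<bar>" "0 \<le> a"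
  shows "pnorm V a f \<le> pnorm V a g"
proof (cases "a = 0")
  case True
  have "\<bar>f x\<bar> \<le> Max ((\<lambda>x. \<bar>g x\<bar>) ` V)" if "x \<in> V" for x
    using assms that by (auto simp: Max_ge_iff)
  then show ?thesis using True assms by (auto simp: pnorm_def)
next
  case False
  then show ?thesis using assms
    by (auto simp: pnorm_def intro!: powr_mono2 mean_mono mean_nonneg)
qed

lemma pnorm_pos:
  assumes "finite V" "x \<in> V" "f x \<noteq> 0"
  shows "0 < pnorm V a f"
proof (cases "a = 0")
  case True
  have "\<bar>f x\<bar> \<le> pnorm V 0 f" using assms by (auto simp: pnorm_def)
  then show ?thesis using True assms by simp
next
  case False
  have "0 < \<bar>f x\<bar> powr (1 / a) / card V"
    using assms by (intro divide_pos_pos) (auto simp: card_gt_0_iff)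
  also have "\<dots> \<le> mean V (\<lambda>x. \<bar>f x\<bar> powr (1 / a))"
    using assms by (intro mean_ge_single) auto
  finally show ?thesis using False by (auto simp: pnorm_def)
qed

lemma pnorm_cmult:
  assumes "finite V" "V \<noteq> {}" "0 \<le> c" "0 \<le> a"
  shows "pnorm V a (\<lambda>x. c * f x) = c * pnorm V a f"
proof (cases "a = 0")
  case True
  have "Max ((\<lambda>x. \<bar>c * f x\<bar>) ` V) = Max ((*) c ` ((\<lambda>x. \<bar>f x\<bar>) ` V))"
    using assms by (simp add: image_image abs_mult)
  also have "\<dots> = c * Max ((\<lambda>x. \<bar>f x\<bar>) ` V)"
    using assms by (intro mono_Max_commute[symmetric]) (auto simp: mono_def mult_left_mono)
  finally show ?thesis using True by (simp add: pnorm_def)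
next
  case False
  have "mean V (\<lambda>x. \<bar>c * f x\<bar> powr (1 / a)) = mean V (\<lambda>x. c powr (1/a) * \<bar>f x\<bar> powr (1 / a))"
    using assms by (intro mean_cong) (simp add: abs_mult powr_mult)
  also have "\<dots> = c powr (1/a) * mean V (\<lambda>x. \<bar>f x\<bar> powr (1 / a))" by (rule mean_cmult)
  finally show ?thesis using False assms
    by (simp add: pnorm_def powr_mult mean_nonneg powr_powr)
qed

lemma pnorm_indicator:
  assumes "finite V" "V \<noteq> {}" "E \<subseteq> V" "0 < a"
  shows "pnorm V a (indicator E) = dens V E powr a"
proof -
  have "mean V (\<lambda>x. \<bar>indicator E x\<bar> powr (1 / a)) = mean V (indicator E :: 'a \<Rightarrow> real)"
    using assms by (intro mean_cong) (auto simp: indicator_def)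
  then show ?thesis using assms by (simp add: pnorm_def mean_indicator)
qed

lemma pnorm_one: "pnorm V 1 f = mean V (\<lambda>x. \<bar>f x\<bar>)"
proof -
  have "0 \<le> mean V (\<lambda>x. \<bar>f x\<bar>)" by (simp add: mean_nonneg)
  then show ?thesis by (simp add: pnorm_def)
qed

lemma pnorm_powr:
  assumes "0 < a"
  shows "pnorm V a f powr (1 / a) = mean V (\<lambda>x. \<bar>f x\<bar> powr (1 / a))"
  using assms by (simp add: pnorm_def powr_powr mean_nonneg)

lemma le_pnorm_0: "finite V \<Longrightarrow> x \<in> V \<Longrightarrow> \<bar>f x\<bar> \<le> pnorm V 0 f"
  by (auto simp: pnorm_def)

section \<open>Hoelder's inequality, its converse, and comparison of norms\<close>

lemma Young_powr:
  fixes x y :: real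
  assumes "0 \<le> x" "0 \<le> y" "0 \<le> a" "0 \<le> b" "a + b = 1"
  shows "x powr a * y powr b \<le> a * x + b * y"
proof (cases "x = 0 \<or> y = 0")
  case True
  then show ?thesis using assms by auto
next
  case False
  then show ?thesis using assms by (intro Youngs_inequality_0) auto
qed

text \<open>Young's inequality for \<open>f / A\<close> and \<open>g / B\<close>, with A and B the
  two norms, is averaged over V; the right side becomes A B (a + b). If one function vanishes on V
  the left side is 0, which leaves A and B positive in the main case.\<close>

lemma Hoelder:
  assumes V: "finite V" "V \<noteq> {}" and a: "0 < a" "0 < b" "a + b = 1"
    and f: "\<And>x. x \<in> V \<Longrightarrow> 0 \<le> f x" and g: "\<And>x. x \<in> V \<Longrightarrow> 0 \<le> g x"
  shows "mean V (\<lambda>x. f x * g x) \<le> pnorm V a f * pnorm V b g"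
proof (cases "(\<exists>x\<in>V. f x \<noteq> 0) \<and> (\<exists>x\<in>V. g x \<noteq> 0)")
  case False
  then have "mean V (\<lambda>x. f x * g x) = mean V (\<lambda>x. 0)" by (intro mean_cong) auto
  then show ?thesis using V by (simp add: mean_const pnorm_nonneg)
next
  case True
  define A where "A = pnorm V a f"
  define B where "B = pnorm V b g"
  have AB: "0 < A" "0 < B" using True V by (auto simp: A_def B_def pnorm_pos)
  have "mean V (\<lambda>x. f x * g x) \<le>
      mean V (\<lambda>x. A * B * (a / A powr (1/a) * \<bar>f x\<bar> powr (1/a) + b / B powr (1/b) * \<bar>g x\<bar> powr (1/b)))"
  proof (rule mean_mono)
    fix x assume x: "x \<in> V"
    have "(f x / A) * (g x / B) = ((f x / A) powr (1/a)) powr a * ((g x / B) powr (1/b)) powr b"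
      using AB a f[OF x] g[OF x] by (simp add: powr_powr)
    also have "\<dots> \<le> a * ((f x / A) powr (1/a)) + b * ((g x / B) powr (1/b))"
      using a by (intro Young_powr) auto
    also have "\<dots> = a / A powr (1/a) * \<bar>f x\<bar> powr (1/a) + b / B powr (1/b) * \<bar>g x\<bar> powr (1/b)"
      using AB f[OF x] g[OF x] by (simp add: powr_divide)
    finally show "f x * g x \<le> A * B * (a / A powr (1/a) * \<bar>f x\<bar> powr (1/a) + b / B powr (1/b) * \<bar>g x\<bar> powr (1/b))"
      using AB by (simp add: field_simps)
  qed
  also have "\<dots> = A * B * (a / A powr (1/a) * mean V (\<lambda>x. \<bar>f x\<bar> powr (1/a)) +
      b / B powr (1/b) * mean V (\<lambda>x. \<bar>g x\<bar> powr (1/b)))"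
    by (simp only: mean_cmult mean_add)
  also have "\<dots> = A * B"
    using AB a by (simp flip: pnorm_powr add: A_def B_def)
  finally show ?thesis by (simp add: A_def B_def)
qed

text \<open>Hoelder against the constant 1, whose norm is 1 because V has total mass 1. As the index
  is 1/p, norms decrease in \<open>a\<close>; the case \<open>a' = 0\<close> compares with the
  maximum pointwise.\<close>

lemma pnorm_antimono:
  assumes V: "finite V" "V \<noteq> {}" and a: "0 \<le> a'" "a' \<le> a"
  shows "pnorm V a f \<le> pnorm V a' f"
proof (cases "a = 0 \<or> a = a'")
  case True
  then show ?thesis using a by auto
next
  case False
  then have a0: "0 < a" "a' < a" using a by auto
  show ?thesis
  proof (cases "a' = 0")
    case True
    have "mean V (\<lambda>x. \<bar>f x\<bar> powr (1/a)) \<le> mean V (\<lambda>x. pnorm V 0 f powr (1/a))"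
      using V a0 by (intro mean_mono powr_mono2 le_pnorm_0) auto
    also have "\<dots> = pnorm V 0 f powr (1/a)" using V by (simp add: mean_const)
    finally have "mean V (\<lambda>x. \<bar>f x\<bar> powr (1/a)) powr a \<le> (pnorm V 0 f powr (1/a)) powr a"
      using a0 by (intro powr_mono2) (auto intro!: mean_nonneg)
    then show ?thesis using a0 V True pnorm_nonneg[OF V, of 0 f]
      by (simp add: pnorm_def[of V a] powr_powr)
  next
    case False
    with a have a': "0 < a'" by auto
    define h where "h = (\<lambda>x. \<bar>f x\<bar> powr (1/a))"
    have "mean V (\<lambda>x. h x * 1) \<le> pnorm V (a'/a) h * pnorm V (1 - a'/a) (\<lambda>x. 1)"
      using a0 a' V by (intro Hoelder) (auto simp: h_def)
    also have "pnorm V (1 - a'/a) (\<lambda>x. 1) = 1"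
      using a0 a' V by (simp add: pnorm_def mean_const)
    finally have "mean V h \<le> pnorm V (a'/a) h" by simp
    also have "\<dots> = mean V (\<lambda>x. \<bar>f x\<bar> powr (1/a')) powr (a'/a)"
      using a0 a' by (simp add: pnorm_def h_def powr_powr)
    finally have "mean V h powr a \<le> (mean V (\<lambda>x. \<bar>f x\<bar> powr (1/a')) powr (a'/a)) powr a"
      using a0 by (intro powr_mono2) (auto intro!: mean_nonneg simp: h_def)
    then show ?thesis using a0 a' by (simp add: powr_powr pnorm_def h_def)
  qed
qed

text \<open>The test function \<open>h\<close> to the power 1/b - 1 is extremal: both sides become
  powers of one mean M, and \<open>M powr (1 - b)\<close> cancels. This lets bounds for an operator
  be read off from bounds for its bilinear form.\<close>

lemma pnorm_dual:
  assumes V: "finite V" "V \<noteq> {}" and b: "0 < b" "b < 1"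
    and h: "\<And>x. x \<in> V \<Longrightarrow> 0 \<le> h x" and C: "0 \<le> C"
    and test: "\<And>g. (\<And>x. x \<in> V \<Longrightarrow> 0 \<le> g x) \<Longrightarrow> mean V (\<lambda>x. h x * g x) \<le> C * pnorm V (1 - b) g"
  shows "pnorm V b h \<le> C"
proof (cases "\<exists>x\<in>V. h x \<noteq> 0")
  case False
  then have "pnorm V b h = pnorm V b (\<lambda>x. 0)" by (intro pnorm_cong) auto
  also have "\<dots> = 0" using b V by (simp add: pnorm_def mean_const)
  finally show ?thesis using C by simp
next
  case True
  define M where "M = mean V (\<lambda>x. \<bar>h x\<bar> powr (1/b))"
  have pn: "pnorm V b h = M powr b" using b by (simp add: pnorm_def M_def)
  have "0 < pnorm V b h" using True V by (auto intro: pnorm_pos)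
  then have Mn: "M \<noteq> 0" using pn b by auto
  have "M \<ge> 0" by (simp add: M_def mean_nonneg)
  with Mn have M: "M > 0" by simp
  define g where "g = (\<lambda>x. h x powr (1/b - 1))"
  have "M = mean V (\<lambda>x. h x * g x)"
    unfolding M_def g_def
  proof (rule mean_cong)
    fix x assume x: "x \<in> V"
    show "\<bar>h x\<bar> powr (1 / b) = h x * h x powr (1 / b - 1)"
      using h[OF x] b by (simp add: powr_mult_base)
  qed
  also have "\<dots> \<le> C * pnorm V (1 - b) g" by (rule test) (simp add: g_def)
  also have "pnorm V (1 - b) g = M powr (1 - b)"
  proof -
    have "mean V (\<lambda>x. \<bar>g x\<bar> powr (1 / (1 - b))) = M"
      unfolding M_def g_def
    proof (rule mean_cong)
      fix x assume x: "x \<in> V"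
      have "(1 / b - 1) * (1 / (1 - b)) = 1 / b" using b by (simp add: field_simps)
      then show "\<bar>h x powr (1 / b - 1)\<bar> powr (1 / (1 - b)) = \<bar>h x\<bar> powr (1 / b)"
        using h[OF x] by (simp add: powr_powr)
    qed
    then show ?thesis using b by (simp add: pnorm_def)
  qed
  finally have "M \<le> C * M powr (1 - b)" .
  moreover have "M = M powr b * M powr (1 - b)" using M by (simp flip: powr_add)
  ultimately have "M powr b * M powr (1 - b) \<le> C * M powr (1 - b)" by simp
  then have "M powr b \<le> C" using M by (subst (asm) mult_le_cancel_right) auto
  then show ?thesis using pn by simp
qed

section \<open>Bilinear interpolation on dyadic level sets\<close>

text \<open>The sum is cut at t and the left tail is reflected by \<open>uminus\<close>. On each
  tail the terms are dominated by distinct terms of the geometric series in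
  \<open>exp (- c)\<close>, so the bound involves neither A nor t.\<close>

lemma sum_exp_dist_le:
  fixes c t :: real
  assumes "0 < c" "finite A"
  shows "(\<Sum>k\<in>A. exp (- c * \<bar>of_int k - t\<bar>)) \<le> 2 / (1 - exp (- c))"
proof -
  have half: "(\<Sum>k\<in>B. exp (- c * \<bar>of_int k - s\<bar>)) \<le> 1 / (1 - exp (- c))"
    if B: "finite B" "\<And>k. k \<in> B \<Longrightarrow> s \<le> of_int k" for B and s :: real
  proof -
    let ?h = "\<lambda>k. nat (k - \<lceil>s\<rceil>)"
    have ge: "\<lceil>s\<rceil> \<le> k" if "k \<in> B" for k using B(2)[OF that] by (simp add: ceiling_le_iff)
    have "(\<Sum>k\<in>B. exp (- c * \<bar>of_int k - s\<bar>)) \<le> (\<Sum>k\<in>B. exp (- c) ^ ?h k)"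
    proof (rule sum_mono)
      fix k assume k: "k \<in> B"
      have "real (?h k) \<le> of_int k - s" using ge[OF k] by (simp add: le_of_int_ceiling)
      then have "- c * \<bar>of_int k - s\<bar> \<le> real (?h k) * (- c)"
        using B(2)[OF k] assms(1) by (simp add: mult.commute)
      then show "exp (- c * \<bar>of_int k - s\<bar>) \<le> exp (- c) ^ ?h k"
        by (simp flip: exp_of_nat_mult)
    qed
    also have "\<dots> = (\<Sum>n\<in>?h ` B. exp (- c) ^ n)"
      using ge by (subst sum.reindex) (auto simp: inj_on_def eq_nat_nat_iff dest!: ge)
    also have "\<dots> \<le> suminf (\<lambda>n. exp (- c) ^ n)"
      using assms B by (intro sum_le_suminf summable_geometric) auto
    also have "\<dots> = 1 / (1 - exp (- c))" using assms by (intro suminf_geometric) auto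
    finally show ?thesis .
  qed
  let ?P = "{k\<in>A. t \<le> of_int k}" and ?N = "{k\<in>A. \<not> t \<le> of_int k}"
  have "(\<Sum>k\<in>A. exp (- c * \<bar>of_int k - t\<bar>)) =
      (\<Sum>k\<in>?P. exp (- c * \<bar>of_int k - t\<bar>)) + (\<Sum>k\<in>?N. exp (- c * \<bar>of_int k - t\<bar>))"
    using assms(2) by (subst sum.union_disjoint[symmetric]) (auto intro!: sum.cong)
  also have "(\<Sum>k\<in>?N. exp (- c * \<bar>of_int k - t\<bar>)) =
      (\<Sum>k\<in>uminus ` ?N. exp (- c * \<bar>of_int k - (- t)\<bar>))"
    by (subst sum.reindex) (auto intro!: sum.cong simp: abs_minus_commute)
  finally show ?thesis
    using half[of ?P t] half[of "uminus ` ?N" "- t"] assms(2) by fastforce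
qed

lemma sum_exp_affine_le:
  fixes c l t :: real
  assumes "0 < c" "l \<noteq> 0" "finite A"
  shows "(\<Sum>k\<in>A. exp (- c * \<bar>t - l * of_int k\<bar>)) \<le> 2 / (1 - exp (- (c * \<bar>l\<bar>)))"
proof -
  have "c * \<bar>t - l * of_int k\<bar> = c * \<bar>l\<bar> * \<bar>of_int k - t / l\<bar>" for k
  proof -
    have "t - l * of_int k = - l * (of_int k - t / l)" using assms(2) by (simp add: field_simps)
    then show ?thesis by (simp add: abs_mult)
  qed
  then show ?thesis
    using sum_exp_dist_le[of "c * \<bar>l\<bar>" A "t / l"] assms by (simp add: mult.assoc)
qed

text \<open>
  \<open>U0\<close> and \<open>U1\<close> are the logarithms of the two bounds for one pair of dyadic levels.  The weight
  \<open>\<theta> \<plusminus> \<delta>\<close> in their geometric mean is chosen by the sign of the level part \<open>D\<close>, which does not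
  depend on the mass of the levels; the loss is absorbed by \<open>a + b > 1\<close>.
\<close>

lemma level_pair_bound:
  fixes u v w a b D \<kappa> \<mu> \<theta> \<delta> M t U0 U1 :: real
  assumes "u \<le> 0" "v \<le> 0" "0 < a" "0 < b"
    and U: "(1 - \<theta>) * U0 + \<theta> * U1 = u + v + w" "U1 - U0 = D + \<kappa> * u + \<mu> * v"
    and \<delta>: "0 < \<delta>" "\<delta> \<le> \<theta>" "\<delta> \<le> 1 - \<theta>"
    and M: "\<bar>\<kappa>\<bar> \<le> M" "\<bar>\<mu>\<bar> \<le> M" "\<delta> * M \<le> 1" "1 \<le> (1 - \<delta> * M) * (a + b)"
    and t: "t \<le> exp U0" "t \<le> exp U1"
  shows "t \<le> exp w * (exp (u / a) + exp (v / b)) * exp (- \<delta> * \<bar>D\<bar>)"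
proof -
  define e where "e = (if D \<ge> 0 then - \<delta> else \<delta>)"
  have e: "\<bar>e\<bar> = \<delta>" "e * D = - \<delta> * \<bar>D\<bar>" "0 \<le> \<theta> + e" "\<theta> + e \<le> 1"
    using \<delta> by (auto simp: e_def)
  \<comment> \<open>Moving the weight from \<theta> to \<theta> + e adds
    \<open>e * (U1 - U0)\<close>. Its level part is the gain -\<delta> |D|; its mass part costs at
    most \<delta> M (-u) + \<delta> M (-v).\<close>
  have *: "e * (c * x) \<le> - \<delta> * M * x" if "\<bar>c\<bar> \<le> M" "x \<le> 0" for c x
  proof -
    have "e * (c * x) \<le> \<bar>e * c\<bar> * \<bar>x\<bar>" by (metis abs_ge_self abs_mult mult.assoc)
    also have "\<dots> \<le> \<delta> * M * \<bar>x\<bar>"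
      using that \<delta> e by (intro mult_right_mono) (auto simp: abs_mult)
    finally show ?thesis using that by simp
  qed
  have "(1 - (\<theta> + e)) * U0 + (\<theta> + e) * U1 = u + v + w + e * (U1 - U0)"
    using U(1) by (simp add: algebra_simps)
  also have "\<dots> = u + v + w - \<delta> * \<bar>D\<bar> + e * (\<kappa> * u) + e * (\<mu> * v)"
    using e by (simp add: U(2) algebra_simps)
  also have "\<dots> \<le> w - \<delta> * \<bar>D\<bar> + (1 - \<delta> * M) * (u + v)"
    using *[of \<kappa> u] *[of \<mu> v] assms by (simp add: algebra_simps)
  \<comment> \<open>u \<le> a m and v \<le> b m for m = \<open>?m\<close>, and m \<le> 0, so a
    factor (1 - \<delta> M)(a + b) \<ge> 1 in front of m only lowers the bound.\<close>
  also have "\<dots> \<le> w - \<delta> * \<bar>D\<bar> + max (u / a) (v / b)"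
  proof -
    let ?m = "max (u / a) (v / b)"
    have m: "u / a \<le> ?m" "v / b \<le> ?m" "?m \<le> 0" using assms by (auto simp: divide_le_0_iff)
    have "u \<le> a * ?m" "v \<le> b * ?m"
      using mult_left_mono[OF m(1), of a] mult_left_mono[OF m(2), of b] assms by simp_all
    then have "(1 - \<delta> * M) * (u + v) \<le> (1 - \<delta> * M) * ((a + b) * ?m)"
      using M by (intro mult_left_mono) (auto simp: algebra_simps)
    also have "\<dots> \<le> ?m"
      using mult_right_mono_neg[OF M(4) m(3)] by (simp add: mult.assoc)
    finally show ?thesis by simp
  qed
  finally have le: "(1 - (\<theta> + e)) * U0 + (\<theta> + e) * U1 \<le> w - \<delta> * \<bar>D\<bar> + max (u / a) (v / b)" .
  \<comment> \<open>t lies below the exponential of the smaller of U0 and U1, and every convex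
    combination of the two is at least that minimum.\<close>
  have "min U0 U1 = (1 - (\<theta> + e)) * min U0 U1 + (\<theta> + e) * min U0 U1" by (simp add: algebra_simps)
  also have "\<dots> \<le> (1 - (\<theta> + e)) * U0 + (\<theta> + e) * U1"
    using e by (intro add_mono mult_left_mono) auto
  finally have "t \<le> exp (w - \<delta> * \<bar>D\<bar> + max (u / a) (v / b))"
    using le t by (smt (verit) exp_le_cancel_iff)
  also have "\<dots> = exp w * exp (max (u / a) (v / b)) * exp (- \<delta> * \<bar>D\<bar>)"
    by (simp flip: exp_add add: algebra_simps)
  also have "\<dots> \<le> exp w * (exp (u / a) + exp (v / b)) * exp (- \<delta> * \<bar>D\<bar>)"
    by (intro mult_right_mono mult_left_mono) (auto simp: max_def)
  finally show ?thesis .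
qed

section \<open>Dyadic level sets and the summation over pairs of levels\<close>

definition dyadic :: "'v set \<Rightarrow> ('v \<Rightarrow> real) \<Rightarrow> int \<Rightarrow> 'v set" where
  "dyadic V f j = {x \<in> V. 0 < f x \<and> \<lfloor>log 2 (f x)\<rfloor> = j}"

definition levels :: "'v set \<Rightarrow> ('v \<Rightarrow> real) \<Rightarrow> int set" where
  "levels V f = (\<lambda>x. \<lfloor>log 2 (f x)\<rfloor>) ` {x \<in> V. 0 < f x}"

lemma finite_levels: "finite V \<Longrightarrow> finite (levels V f)"
  by (simp add: levels_def)

lemma dyadic_subset: "dyadic V f j \<subseteq> V"
  by (auto simp: dyadic_def)

lemma dyadic_nonempty: "j \<in> levels V f \<Longrightarrow> dyadic V f j \<noteq> {}"
  by (auto simp: dyadic_def levels_def)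

lemma dyadic_bounds:
  assumes "x \<in> dyadic V f j"
  shows "2 powr of_int j \<le> f x" "f x \<le> 2 * 2 powr of_int j"
proof -
  have x: "0 < f x" "\<lfloor>log 2 (f x)\<rfloor> = j" using assms by (auto simp: dyadic_def)
  then have "of_int j \<le> log 2 (f x)" "log 2 (f x) \<le> of_int j + 1" by linarith+
  then have "2 powr of_int j \<le> 2 powr log 2 (f x)" "2 powr log 2 (f x) \<le> 2 powr (of_int j + 1)"
    by (simp_all only: powr_le_cancel_iff)
  then show "2 powr of_int j \<le> f x" "f x \<le> 2 * 2 powr of_int j"
    using x by (simp_all add: powr_add)
qed

lemma sum_dyadic:
  assumes "finite V"
  shows "(\<Sum>j\<in>levels V f. \<Sum>x\<in>dyadic V f j. h x) = (\<Sum>x\<in>{x\<in>V. 0 < f x}. h x)"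
proof -
  have "dyadic V f j = {x \<in> {x \<in> V. 0 < f x}. \<lfloor>log 2 (f x)\<rfloor> = j}" for j
    by (auto simp: dyadic_def)
  then show ?thesis
    using assms by (simp add: levels_def sum.image_gen[of "{x\<in>V. 0 < f x}" h "\<lambda>x. \<lfloor>log 2 (f x)\<rfloor>"])
qed

text \<open>On a level set f is at least the lower end of its dyadic range. The summands are the
  masses of the levels in the norm with index \<open>a\<close>: for normalised f each is at most 1
  and so is their sum, and the interpolation retains nothing else of f.\<close>

lemma sum_dyadic_dens_le:
  assumes "finite V" "0 < a" "\<And>x. x \<in> V \<Longrightarrow> 0 \<le> f x"
  shows "(\<Sum>j\<in>levels V f. (2 powr of_int j) powr (1 / a) * dens V (dyadic V f j))
    \<le> mean V (\<lambda>x. f x powr (1 / a))"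
proof -
  have "(\<Sum>j\<in>levels V f. (2 powr of_int j) powr (1 / a) * real (card (dyadic V f j)))
      \<le> (\<Sum>j\<in>levels V f. \<Sum>x\<in>dyadic V f j. f x powr (1 / a))"
  proof (rule sum_mono)
    fix j
    have "(\<Sum>x\<in>dyadic V f j. (2 powr of_int j) powr (1 / a)) \<le> (\<Sum>x\<in>dyadic V f j. f x powr (1 / a))"
      using assms by (intro sum_mono powr_mono2 dyadic_bounds) auto
    then show "(2 powr of_int j) powr (1 / a) * real (card (dyadic V f j)) \<le> (\<Sum>x\<in>dyadic V f j. f x powr (1 / a))"
      by (simp add: mult.commute)
  qed
  also have "\<dots> = (\<Sum>x\<in>{x\<in>V. 0 < f x}. f x powr (1 / a))" using assms by (simp add: sum_dyadic)
  also have "\<dots> \<le> (\<Sum>x\<in>V. f x powr (1 / a))" using assms by (intro sum_mono2) auto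
  finally have "(\<Sum>j\<in>levels V f. (2 powr of_int j) powr (1 / a) * real (card (dyadic V f j))) / card V
      \<le> (\<Sum>x\<in>V. f x powr (1 / a)) / card V" by (rule divide_right_mono) simp
  then show ?thesis by (simp add: mean_def dens_def sum_divide_distrib)
qed

text \<open>
  The summation of Marcinkiewicz interpolation for a functional of two sets.  No relation between
  \<open>A0\<close> and \<open>A1\<close> is needed, which allows one of them to decay in \<open>q\<close>.
\<close>

lemma dyadic_interpolation:
  fixes a0 a1 b0 b1 \<theta> :: real
  defines "a \<equiv> (1 - \<theta>) * a0 + \<theta> * a1" and "b \<equiv> (1 - \<theta>) * b0 + \<theta> * b1"
  assumes \<theta>: "0 < \<theta>" "\<theta> < 1" and ab: "0 < a" "0 < b" "1 < a + b" and ne: "a0 \<noteq> a1" "b0 \<noteq> b1"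
  obtains C where "0 \<le> C"
    and "\<And>(V::'v set) f g \<Psi> A0 A1. finite V \<Longrightarrow> V \<noteq> {} \<Longrightarrow>
      (\<And>x. x \<in> V \<Longrightarrow> 0 \<le> f x) \<Longrightarrow> (\<And>x. x \<in> V \<Longrightarrow> 0 \<le> g x) \<Longrightarrow>
      mean V (\<lambda>x. f x powr (1 / a)) \<le> 1 \<Longrightarrow> mean V (\<lambda>x. g x powr (1 / b)) \<le> 1 \<Longrightarrow>
      0 < A0 \<Longrightarrow> 0 < A1 \<Longrightarrow>
      (\<And>E F. E \<subseteq> V \<Longrightarrow> F \<subseteq> V \<Longrightarrow> \<Psi> E F \<le> A0 * (dens V E powr a0 * dens V F powr b0)) \<Longrightarrow>
      (\<And>E F. E \<subseteq> V \<Longrightarrow> F \<subseteq> V \<Longrightarrow> \<Psi> E F \<le> A1 * (dens V E powr a1 * dens V F powr b1)) \<Longrightarrow>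
      (\<Sum>j\<in>levels V f. \<Sum>k\<in>levels V g.
         2 powr of_int j * 2 powr of_int k * \<Psi> (dyadic V f j) (dyadic V g k))
        \<le> C * (A0 powr (1 - \<theta>) * A1 powr \<theta>)"
proof -
  \<comment> \<open>U1 - U0 is affine in the logarithms of the two densities; expressed through the
    logarithmic masses u and v its slopes are \<kappa> and \<mu>. They are nonzero because the two
    endpoints differ in both coordinates.\<close>
  define \<kappa> where "\<kappa> = (a1 - a0) / a"
  define \<mu> where "\<mu> = (b1 - b0) / b"
  define M where "M = max \<bar>\<kappa>\<bar> \<bar>\<mu>\<bar>"
  have nz: "\<kappa> \<noteq> 0" "\<mu> \<noteq> 0" using ab ne by (auto simp: \<kappa>_def \<mu>_def)
  then have M: "0 < M" by (auto simp: M_def)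
  \<comment> \<open>The last entry of the minimum is the largest \<delta> with (1 - \<delta> M)(a +
    b) \<ge> 1. It is positive because a + b > 1, the off-diagonal condition.\<close>
  define \<delta> where "\<delta> = min (min \<theta> (1 - \<theta>)) ((1 - 1 / (a + b)) / M)"
  have "0 < (1 - 1 / (a + b)) / M" using M ab by simp
  then have \<delta>: "0 < \<delta>" "\<delta> \<le> \<theta>" "\<delta> \<le> 1 - \<theta>" using \<theta> by (auto simp: \<delta>_def)
  have "\<delta> \<le> (1 - 1 / (a + b)) / M" by (simp add: \<delta>_def)
  then have "\<delta> * M \<le> 1 - 1 / (a + b)" using M by (simp add: pos_le_divide_eq)
  then have "1 / (a + b) \<le> 1 - \<delta> * M" by simp
  then have \<delta>M: "1 \<le> (1 - \<delta> * M) * (a + b)" "\<delta> * M \<le> 1"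
    using ab \<open>\<delta> * M \<le> 1 - 1 / (a + b)\<close> by (simp_all add: pos_divide_le_eq) (smt (verit) divide_nonneg_nonneg)
  define S where "S = (\<lambda>l::real. 2 / (1 - exp (- (\<delta> * \<bar>l\<bar>))))"
  have S: "0 \<le> S l" for l using \<delta> by (simp add: S_def)
  show thesis
  proof (rule that[of "S (\<mu> * ln 2) + S (\<kappa> * ln 2)"])
    show "0 \<le> S (\<mu> * ln 2) + S (\<kappa> * ln 2)" using S by (simp add: add_nonneg_nonneg)
    fix V :: "'v set" and f g :: "'v \<Rightarrow> real" and \<Psi> A0 A1
    assume V: "finite V" "V \<noteq> {}"
      and fg: "\<And>x. x \<in> V \<Longrightarrow> 0 \<le> f x" "\<And>x. x \<in> V \<Longrightarrow> 0 \<le> g x"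
      and f1: "mean V (\<lambda>x. f x powr (1 / a)) \<le> 1" and g1: "mean V (\<lambda>x. g x powr (1 / b)) \<le> 1"
      and A: "0 < A0" "0 < A1"
      and \<Psi>: "\<And>E F. E \<subseteq> V \<Longrightarrow> F \<subseteq> V \<Longrightarrow> \<Psi> E F \<le> A0 * (dens V E powr a0 * dens V F powr b0)"
        "\<And>E F. E \<subseteq> V \<Longrightarrow> F \<subseteq> V \<Longrightarrow> \<Psi> E F \<le> A1 * (dens V E powr a1 * dens V F powr b1)"
    define B where "B = A0 powr (1 - \<theta>) * A1 powr \<theta>"
    define xm where "xm = (\<lambda>j::int. (2 powr of_int j) powr (1 / a) * dens V (dyadic V f j))"
    define ym where "ym = (\<lambda>k::int. (2 powr of_int k) powr (1 / b) * dens V (dyadic V g k))"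
    \<comment> \<open>What remains of U1 - U0 at u = v = 0. It depends on the levels only and is
      small only near one line in the (j, k) plane; away from that line one of the two estimates
      wins geometrically.\<close>
    define D where "D = (\<lambda>j k::int. ln A1 - ln A0 - \<kappa> * ln 2 * of_int j - \<mu> * ln 2 * of_int k)"
    have XY0: "0 \<le> xm j" "0 \<le> ym j" for j by (simp_all add: xm_def ym_def dens_nonneg)
    have sX: "sum xm (levels V f) \<le> 1" and sY: "sum ym (levels V g) \<le> 1"
      using sum_dyadic_dens_le[OF V(1) ab(1), of f] sum_dyadic_dens_le[OF V(1) ab(2), of g] fg f1 g1
      by (auto simp: xm_def ym_def)
    have lnB: "ln B = (1 - \<theta>) * ln A0 + \<theta> * ln A1" and B: "0 < B"
      using A by (simp_all add: B_def ln_mult ln_powr)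
    have pair: "2 powr of_int j * 2 powr of_int k * \<Psi> (dyadic V f j) (dyadic V g k)
        \<le> B * (xm j + ym k) * exp (- \<delta> * \<bar>D j k\<bar>)"
      if jk: "j \<in> levels V f" "k \<in> levels V g" for j k
    proof -
      let ?E = "dyadic V f j" and ?F = "dyadic V g k"
      have dE: "0 < dens V ?E" and dF: "0 < dens V ?F"
        using jk V by (auto intro!: dens_pos dyadic_subset dyadic_nonempty)
      define u where "u = of_int j * ln 2 + a * ln (dens V ?E)"
      define v where "v = of_int k * ln 2 + b * ln (dens V ?F)"
      have eu: "exp (u / a) = xm j" and ev: "exp (v / b) = ym k"
        using ab dE dF by (simp_all add: u_def v_def xm_def ym_def powr_powr powr_def add_divide_distrib exp_add)
      have "xm j \<le> 1" "ym k \<le> 1"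
        using member_le_sum[OF jk(1), of xm] member_le_sum[OF jk(2), of ym] sX sY XY0 V finite_levels
        by (smt (verit))+
      then have uv: "u \<le> 0" "v \<le> 0"
        using ab by (simp_all add: eu[symmetric] ev[symmetric] divide_le_0_iff)
      define U0 where "U0 = of_int j * ln 2 + of_int k * ln 2 + ln A0 + a0 * ln (dens V ?E) + b0 * ln (dens V ?F)"
      define U1 where "U1 = of_int j * ln 2 + of_int k * ln 2 + ln A1 + a1 * ln (dens V ?E) + b1 * ln (dens V ?F)"
      have eU0: "exp U0 = 2 powr of_int j * 2 powr of_int k * (A0 * (dens V ?E powr a0 * dens V ?F powr b0))"
        and eU1: "exp U1 = 2 powr of_int j * 2 powr of_int k * (A1 * (dens V ?E powr a1 * dens V ?F powr b1))"
        using A dE dF by (simp_all add: U0_def U1_def exp_add powr_def)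
      have lE: "ln (dens V ?E) = (u - of_int j * ln 2) / a" and lF: "ln (dens V ?F) = (v - of_int k * ln 2) / b"
        using ab by (simp_all add: u_def v_def)
      have "(1 - \<theta>) * U0 + \<theta> * U1 = of_int j * ln 2 + of_int k * ln 2 + ln B
          + a * ln (dens V ?E) + b * ln (dens V ?F)"
        by (simp add: U0_def U1_def lnB a_def b_def algebra_simps)
      then have comb: "(1 - \<theta>) * U0 + \<theta> * U1 = u + v + ln B"
        by (simp add: u_def v_def)
      have "U1 - U0 = ln A1 - ln A0 + (a1 - a0) * ln (dens V ?E) + (b1 - b0) * ln (dens V ?F)"
        by (simp add: U0_def U1_def algebra_simps)
      also have "\<dots> = D j k + \<kappa> * u + \<mu> * v"
        using ab by (simp add: D_def lE lF \<kappa>_def \<mu>_def field_simps)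
      finally have diff: "U1 - U0 = D j k + \<kappa> * u + \<mu> * v" .
      have "2 powr of_int j * 2 powr of_int k * \<Psi> ?E ?F \<le> exp (ln B) * (exp (u / a) + exp (v / b)) * exp (- \<delta> * \<bar>D j k\<bar>)"
      proof (rule level_pair_bound[OF uv ab(1,2) comb diff \<delta> _ _ \<delta>M(2,1)])
        show "\<bar>\<kappa>\<bar> \<le> M" "\<bar>\<mu>\<bar> \<le> M" by (auto simp: M_def)
        show "2 powr of_int j * 2 powr of_int k * \<Psi> ?E ?F \<le> exp U0"
          "2 powr of_int j * 2 powr of_int k * \<Psi> ?E ?F \<le> exp U1"
          unfolding eU0 eU1
          by (intro mult_left_mono \<Psi> dyadic_subset; simp)+
      qed
      then show ?thesis using B by (simp add: eu ev)
    qed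
    \<comment> \<open>For fixed j the values \<open>D j k\<close> form an arithmetic progression of
      step |\<mu>| ln 2, and for fixed k one of step |\<kappa>| ln 2. Row and column sums of the
      decay factor are therefore bounded, wherever A0 and A1 shift the progression.\<close>
    have r1: "(\<Sum>k\<in>levels V g. exp (- \<delta> * \<bar>D j k\<bar>)) \<le> S (\<mu> * ln 2)" for j
      using sum_exp_affine_le[of \<delta> "\<mu> * ln 2" "levels V g" "ln A1 - ln A0 - \<kappa> * ln 2 * of_int j"]
        \<delta> nz V by (simp add: D_def S_def finite_levels)
    have r2: "(\<Sum>j\<in>levels V f. exp (- \<delta> * \<bar>D j k\<bar>)) \<le> S (\<kappa> * ln 2)" for k
      using sum_exp_affine_le[of \<delta> "\<kappa> * ln 2" "levels V f" "ln A1 - ln A0 - \<mu> * ln 2 * of_int k"]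
        \<delta> nz V by (simp add: D_def S_def finite_levels algebra_simps)
    have "(\<Sum>j\<in>levels V f. \<Sum>k\<in>levels V g.
       2 powr of_int j * 2 powr of_int k * \<Psi> (dyadic V f j) (dyadic V g k))
      \<le> (\<Sum>j\<in>levels V f. \<Sum>k\<in>levels V g. B * (xm j + ym k) * exp (- \<delta> * \<bar>D j k\<bar>))"
      by (intro sum_mono pair)
    \<comment> \<open>As in Schur's test: the masses \<open>xm\<close> are summed against row sums
      of the decay factor, the masses \<open>ym\<close> against its column sums.\<close>
    also have "\<dots> = B * ((\<Sum>j\<in>levels V f. xm j * (\<Sum>k\<in>levels V g. exp (- \<delta> * \<bar>D j k\<bar>))) +
        (\<Sum>j\<in>levels V f. \<Sum>k\<in>levels V g. ym k * exp (- \<delta> * \<bar>D j k\<bar>)))"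
      by (simp add: sum_distrib_left sum.distrib algebra_simps)
    also have "(\<Sum>j\<in>levels V f. \<Sum>k\<in>levels V g. ym k * exp (- \<delta> * \<bar>D j k\<bar>)) =
        (\<Sum>k\<in>levels V g. ym k * (\<Sum>j\<in>levels V f. exp (- \<delta> * \<bar>D j k\<bar>)))"
      by (subst sum.swap) (simp add: sum_distrib_left)
    also have "B * ((\<Sum>j\<in>levels V f. xm j * (\<Sum>k\<in>levels V g. exp (- \<delta> * \<bar>D j k\<bar>))) +
        (\<Sum>k\<in>levels V g. ym k * (\<Sum>j\<in>levels V f. exp (- \<delta> * \<bar>D j k\<bar>))))
      \<le> B * ((\<Sum>j\<in>levels V f. xm j * S (\<mu> * ln 2)) + (\<Sum>k\<in>levels V g. ym k * S (\<kappa> * ln 2)))"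
      using B by (intro mult_left_mono add_mono sum_mono r1 r2 XY0) auto
    also have "\<dots> = B * (sum xm (levels V f) * S (\<mu> * ln 2) + sum ym (levels V g) * S (\<kappa> * ln 2))"
      by (simp add: sum_distrib_right)
    also have "\<dots> \<le> B * (1 * S (\<mu> * ln 2) + 1 * S (\<kappa> * ln 2))"
      using B by (intro mult_left_mono add_mono mult_right_mono sX sY S) auto
    finally show "(\<Sum>j\<in>levels V f. \<Sum>k\<in>levels V g.
       2 powr of_int j * 2 powr of_int k * \<Psi> (dyadic V f j) (dyadic V g k))
      \<le> (S (\<mu> * ln 2) + S (\<kappa> * ln 2)) * (A0 powr (1 - \<theta>) * A1 powr \<theta>)"
      by (simp add: B_def mult.commute)
  qed
qed

section \<open>The bilinear form of a kernel and its reduction to indicator functions\<close>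

definition kop :: "'v set \<Rightarrow> ('v \<Rightarrow> 'v \<Rightarrow> real) \<Rightarrow> ('v \<Rightarrow> real) \<Rightarrow> 'v \<Rightarrow> real" where
  "kop V w f y = (\<Sum>x\<in>V. w x y * f x)"

definition pairing :: "'v set \<Rightarrow> ('v \<Rightarrow> 'v \<Rightarrow> real) \<Rightarrow> ('v \<Rightarrow> real) \<Rightarrow> ('v \<Rightarrow> real) \<Rightarrow> real" where
  "pairing V w f g = mean V (\<lambda>y. kop V w f y * g y)"

lemma kop_add: "kop V w (\<lambda>x. f x + g x) y = kop V w f y + kop V w g y"
  by (simp add: kop_def algebra_simps sum.distrib)

lemma kop_cmult: "kop V w (\<lambda>x. c * f x) y = c * kop V w f y"
  by (simp add: kop_def sum_distrib_left mult.left_commute)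

lemma kop_nonneg:
  "(\<And>x. x \<in> V \<Longrightarrow> 0 \<le> w x y) \<Longrightarrow> (\<And>x. x \<in> V \<Longrightarrow> 0 \<le> f x) \<Longrightarrow> 0 \<le> kop V w f y"
  by (simp add: kop_def sum_nonneg)

lemma pairing_eq: "pairing V w f g = (\<Sum>x\<in>V. \<Sum>y\<in>V. w x y * (f x * g y)) / card V"
  unfolding pairing_def mean_def kop_def sum_distrib_right
  by (subst sum.swap) (simp add: mult.assoc)

lemma pairing_cong:
  "(\<And>x. x \<in> V \<Longrightarrow> f x = f' x) \<Longrightarrow> (\<And>x. x \<in> V \<Longrightarrow> g x = g' x) \<Longrightarrow>
    pairing V w f g = pairing V w f' g'"
  by (simp add: pairing_eq)

lemma pairing_cmult: "pairing V w (\<lambda>x. c * f x) (\<lambda>x. d * g x) = c * d * pairing V w f g"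
  by (simp add: pairing_eq sum_distrib_left mult.assoc mult.left_commute)

lemma pairing_commute:
  assumes "\<And>x y. x \<in> V \<Longrightarrow> y \<in> V \<Longrightarrow> w x y = w y x"
  shows "pairing V w f g = pairing V w g f"
  unfolding pairing_eq by (subst sum.swap) (simp add: assms mult.commute)

lemma sum_over_subset:
  fixes h :: "'v \<Rightarrow> real"
  assumes "finite V" "E \<subseteq> V"
  shows "(\<Sum>x\<in>V. indicator E x * h x) = sum h E"
  using assms by (intro sum.mono_neutral_cong_right) auto

lemma pairing_indicator:
  assumes "finite V" "E \<subseteq> V" "F \<subseteq> V"
  shows "pairing V w (indicator E) (indicator F) = (\<Sum>x\<in>E. \<Sum>y\<in>F. w x y) / card V"
proof -
  have "(\<Sum>x\<in>V. \<Sum>y\<in>V. w x y * (indicator E x * indicator F y)) =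
      (\<Sum>x\<in>V. indicator E x * (\<Sum>y\<in>V. indicator F y * w x y))"
    by (simp add: sum_distrib_left mult_ac)
  also have "\<dots> = (\<Sum>x\<in>E. \<Sum>y\<in>F. w x y)"
    by (simp only: sum_over_subset[OF assms(1,3)] sum_over_subset[OF assms(1,2)])
  finally show ?thesis by (simp only: pairing_eq)
qed

text \<open>On a level set a function is at most twice the lower end of its range; the two factors 2
  make the 4. Zeros of f or g contribute nothing, and \<open>w\<close> being nonnegative allows the
  replacement term by term.\<close>

lemma pairing_le_dyadic:
  assumes V: "finite V" and w: "\<And>x y. x \<in> V \<Longrightarrow> y \<in> V \<Longrightarrow> 0 \<le> w x y"
    and f: "\<And>x. x \<in> V \<Longrightarrow> 0 \<le> f x" and g: "\<And>x. x \<in> V \<Longrightarrow> 0 \<le> g x"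
  shows "pairing V w f g \<le> 4 * (\<Sum>j\<in>levels V f. \<Sum>k\<in>levels V g. 2 powr of_int j * 2 powr of_int k *
      pairing V w (indicator (dyadic V f j)) (indicator (dyadic V g k)))"
proof -
  have split: "(\<Sum>x\<in>V. h x * f x) = (\<Sum>j\<in>levels V f. \<Sum>x\<in>dyadic V f j. h x * f x)"
    if "finite V" "\<And>x. x \<in> V \<Longrightarrow> 0 \<le> f x" for h f :: "'a \<Rightarrow> real"
    unfolding sum_dyadic[OF that(1)] using that
    by (intro sum.mono_neutral_right) (auto simp: order.order_iff_strict)
  have "(\<Sum>x\<in>V. \<Sum>y\<in>V. w x y * (f x * g y)) = (\<Sum>x\<in>V. (\<Sum>y\<in>V. w x y * g y) * f x)"
    by (simp add: sum_distrib_left mult_ac)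
  also have "\<dots> = (\<Sum>j\<in>levels V f. \<Sum>x\<in>dyadic V f j. \<Sum>k\<in>levels V g. \<Sum>y\<in>dyadic V g k. w x y * g y * f x)"
    by (subst split[OF V f], assumption, subst split[OF V g], assumption) (simp add: sum_distrib_right)
  also have "\<dots> \<le> (\<Sum>j\<in>levels V f. \<Sum>x\<in>dyadic V f j. \<Sum>k\<in>levels V g. \<Sum>y\<in>dyadic V g k.
      4 * (2 powr of_int j * 2 powr of_int k * w x y))"
  proof (intro sum_mono)
    fix j x k y assume xy: "x \<in> dyadic V f j" "y \<in> dyadic V g k"
    then have V: "x \<in> V" "y \<in> V" by (auto simp: dyadic_def)
    have "g y * f x \<le> (2 * 2 powr of_int k) * (2 * 2 powr of_int j)"
      using dyadic_bounds[OF xy(1)] dyadic_bounds[OF xy(2)] f[OF V(1)] by (intro mult_mono) auto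
    then have "w x y * (g y * f x) \<le> w x y * ((2 * 2 powr of_int k) * (2 * 2 powr of_int j))"
      using w[OF V] by (rule mult_left_mono)
    then show "w x y * g y * f x \<le> 4 * (2 powr of_int j * 2 powr of_int k * w x y)"
      by (simp add: algebra_simps)
  qed
  also have "\<dots> = (\<Sum>j\<in>levels V f. \<Sum>k\<in>levels V g. \<Sum>x\<in>dyadic V f j. \<Sum>y\<in>dyadic V g k.
      4 * (2 powr of_int j * 2 powr of_int k * w x y))"
    by (intro sum.cong refl) (rule sum.swap)
  also have "\<dots> = 4 * (\<Sum>j\<in>levels V f. \<Sum>k\<in>levels V g. 2 powr of_int j * 2 powr of_int k *
      (\<Sum>x\<in>dyadic V f j. \<Sum>y\<in>dyadic V g k. w x y))"
    by (simp add: sum_distrib_left)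
  also have "\<dots> = real (card V) * (4 * (\<Sum>j\<in>levels V f. \<Sum>k\<in>levels V g. 2 powr of_int j * 2 powr of_int k *
      pairing V w (indicator (dyadic V f j)) (indicator (dyadic V g k))))"
    using V by (cases "V = {}") (simp_all add: pairing_indicator dyadic_subset levels_def flip: sum_divide_distrib)
  finally show ?thesis
    using V unfolding pairing_eq[of V w f g]
    by (cases "V = {}") (simp_all add: divide_le_eq card_gt_0_iff mult.commute levels_def)
qed

lemma pairing_eq_0_if_pnorm_eq_0:
  assumes "finite V" "V \<noteq> {}" "pnorm V a f = 0 \<or> pnorm V b g = 0"
  shows "pairing V w f g = 0"
proof -
  have "(\<forall>x\<in>V. f x = 0) \<or> (\<forall>x\<in>V. g x = 0)"
    using assms pnorm_pos[of V _ f a] pnorm_pos[of V _ g b] by (metis less_irrefl)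
  then show ?thesis by (auto simp: pairing_eq)
qed

lemma mean_le_1_if_pnorm:
  assumes "finite V" "V \<noteq> {}" "0 < a" "a \<le> 1" "\<And>x. x \<in> V \<Longrightarrow> 0 \<le> f x"
    and "mean V (\<lambda>x. f x powr (1 / a)) \<le> 1"
  shows "mean V f \<le> 1"
proof -
  have "mean V f = pnorm V 1 f" using assms by (simp add: pnorm_one cong: mean_cong)
  also have "\<dots> \<le> pnorm V a f" using assms by (intro pnorm_antimono) auto
  also have "\<dots> = mean V (\<lambda>x. f x powr (1 / a)) powr a" using assms by (simp add: pnorm_def cong: mean_cong)
  also have "\<dots> \<le> 1 powr a" using assms by (intro powr_mono2) (auto intro: mean_nonneg)
  finally show ?thesis by simp
qed

text \<open>The term with \<open>c\<close> is the expected value of the pairing, as if the kernel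
  averaged over all of V. It is kept apart because only the deviation from it obeys bounds whose
  constant A may decay in q.\<close>

definition set_bound :: "'v set \<Rightarrow> ('v \<Rightarrow> 'v \<Rightarrow> real) \<Rightarrow> real \<Rightarrow> real \<Rightarrow> real \<Rightarrow> real \<Rightarrow> bool" where
  "set_bound V w c A a b \<longleftrightarrow> (\<forall>E F. E \<subseteq> V \<longrightarrow> F \<subseteq> V \<longrightarrow>
     pairing V w (indicator E) (indicator F) \<le>
       c * (dens V E * dens V F) + A * (dens V E powr a * dens V F powr b))"

lemma set_boundD:
  "set_bound V w c A a b \<Longrightarrow> E \<subseteq> V \<Longrightarrow> F \<subseteq> V \<Longrightarrow> pairing V w (indicator E) (indicator F) \<le>
     c * (dens V E * dens V F) + A * (dens V E powr a * dens V F powr b)"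
  by (simp add: set_bound_def)

text \<open>The expected part is bilinear in densities and sums to at most \<open>c\<close> times
  the product of the means of f and g; only the deviation passes through
  \<open>dyadic_interpolation\<close>. Homogeneity removes the normalisation of f and g at the
  end.\<close>

lemma restricted_interpolation:
  fixes a0 a1 b0 b1 \<theta> :: real
  defines "a \<equiv> (1 - \<theta>) * a0 + \<theta> * a1" and "b \<equiv> (1 - \<theta>) * b0 + \<theta> * b1"
  assumes \<theta>: "0 < \<theta>" "\<theta> < 1" and ab: "0 < a" "0 < b" "a \<le> 1" "b \<le> 1" "1 < a + b"
    and ne: "a0 \<noteq> a1" "b0 \<noteq> b1"
  obtains C where "0 \<le> C"
    and "\<And>(V::'v set) w A0 A1 c f g. finite V \<Longrightarrow> V \<noteq> {} \<Longrightarrow>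
      (\<And>x y. x \<in> V \<Longrightarrow> y \<in> V \<Longrightarrow> 0 \<le> w x y) \<Longrightarrow> 0 < A0 \<Longrightarrow> 0 < A1 \<Longrightarrow> 0 \<le> c \<Longrightarrow>
      set_bound V w c A0 a0 b0 \<Longrightarrow> set_bound V w c A1 a1 b1 \<Longrightarrow>
      (\<And>x. x \<in> V \<Longrightarrow> 0 \<le> f x) \<Longrightarrow> (\<And>x. x \<in> V \<Longrightarrow> 0 \<le> g x) \<Longrightarrow>
      pairing V w f g \<le> C * (c + A0 powr (1 - \<theta>) * A1 powr \<theta>) * (pnorm V a f * pnorm V b g)"
proof -
  note sums = dyadic_interpolation[OF \<theta>, of a0 a1 b0 b1, where 'v='v, folded a_def b_def, OF ab(1,2,5) ne]
  show thesis
  proof (rule sums)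
    fix C
    assume C0: "0 \<le> C" and C: "\<And>(V::'v set) f g \<Psi> A0 A1. finite V \<Longrightarrow> V \<noteq> {} \<Longrightarrow>
      (\<And>x. x \<in> V \<Longrightarrow> 0 \<le> f x) \<Longrightarrow> (\<And>x. x \<in> V \<Longrightarrow> 0 \<le> g x) \<Longrightarrow>
      mean V (\<lambda>x. f x powr (1 / a)) \<le> 1 \<Longrightarrow> mean V (\<lambda>x. g x powr (1 / b)) \<le> 1 \<Longrightarrow>
      0 < A0 \<Longrightarrow> 0 < A1 \<Longrightarrow>
      (\<And>E F. E \<subseteq> V \<Longrightarrow> F \<subseteq> V \<Longrightarrow> \<Psi> E F \<le> A0 * (dens V E powr a0 * dens V F powr b0)) \<Longrightarrow>
      (\<And>E F. E \<subseteq> V \<Longrightarrow> F \<subseteq> V \<Longrightarrow> \<Psi> E F \<le> A1 * (dens V E powr a1 * dens V F powr b1)) \<Longrightarrow>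
      (\<Sum>j\<in>levels V f. \<Sum>k\<in>levels V g.
         2 powr of_int j * 2 powr of_int k * \<Psi> (dyadic V f j) (dyadic V g k))
        \<le> C * (A0 powr (1 - \<theta>) * A1 powr \<theta>)"
  show thesis
  proof (rule that[of "4 * (C + 1)"])
    show "0 \<le> 4 * (C + 1)" using C0 by simp
    fix V :: "'v set" and w A0 A1 c and f g :: "'v \<Rightarrow> real"
    assume V: "finite V" "V \<noteq> {}" and w: "\<And>x y. x \<in> V \<Longrightarrow> y \<in> V \<Longrightarrow> 0 \<le> w x y"
      and A: "0 < A0" "0 < A1" "(0::real) \<le> c"
      and bd: "set_bound V w c A0 a0 b0" "set_bound V w c A1 a1 b1"
      and fg: "\<And>x. x \<in> V \<Longrightarrow> 0 \<le> f x" "\<And>x. x \<in> V \<Longrightarrow> 0 \<le> g x"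
    define B where "B = A0 powr (1 - \<theta>) * A1 powr \<theta>"
    have B: "0 \<le> B" by (simp add: B_def)
    have unit: "pairing V w f g \<le> 4 * (C + 1) * (c + B)"
      if fg: "\<forall>x\<in>V. 0 \<le> f x \<and> 0 \<le> g x"
        and f1: "mean V (\<lambda>x. f x powr (1 / a)) \<le> 1" and g1: "mean V (\<lambda>x. g x powr (1 / b)) \<le> 1" for f g
    proof -
      \<comment> \<open>\<Psi> may be negative; \<open>dyadic_interpolation\<close> asks only for
        upper bounds of it.\<close>
      define \<Psi> where "\<Psi> = (\<lambda>E F. pairing V w (indicator E) (indicator F) - c * (dens V E * dens V F))"
      let ?s = "\<lambda>j. (2::real) powr of_int j"
      have "pairing V w f g \<le> 4 * (\<Sum>j\<in>levels V f. \<Sum>k\<in>levels V g. ?s j * ?s k *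
          pairing V w (indicator (dyadic V f j)) (indicator (dyadic V g k)))"
        using V w fg by (intro pairing_le_dyadic) auto
      also have "(\<Sum>j\<in>levels V f. \<Sum>k\<in>levels V g. ?s j * ?s k *
          pairing V w (indicator (dyadic V f j)) (indicator (dyadic V g k))) =
          (\<Sum>j\<in>levels V f. \<Sum>k\<in>levels V g. ?s j * ?s k * \<Psi> (dyadic V f j) (dyadic V g k)) +
          c * ((\<Sum>j\<in>levels V f. ?s j * dens V (dyadic V f j)) * (\<Sum>k\<in>levels V g. ?s k * dens V (dyadic V g k)))"
        unfolding sum_product by (simp add: \<Psi>_def sum_distrib_left sum_subtractf algebra_simps)
      also have "\<dots> \<le> C * B + c * (1 * 1)"
      proof (intro add_mono mult_left_mono mult_mono)
        show "(\<Sum>j\<in>levels V f. \<Sum>k\<in>levels V g. ?s j * ?s k * \<Psi> (dyadic V f j) (dyadic V g k)) \<le> C * B"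
          unfolding B_def
        proof (rule C)
          show "\<Psi> E F \<le> A0 * (dens V E powr a0 * dens V F powr b0)" if "E \<subseteq> V" "F \<subseteq> V" for E F
            using set_boundD[OF bd(1) that] by (simp add: \<Psi>_def)
          show "\<Psi> E F \<le> A1 * (dens V E powr a1 * dens V F powr b1)" if "E \<subseteq> V" "F \<subseteq> V" for E F
            using set_boundD[OF bd(2) that] by (simp add: \<Psi>_def)
        qed (use V fg f1 g1 A in simp_all)
        \<comment> \<open>The level inequality for index 1, followed by the comparison of the mean
          with the norm, which is at most 1 by normalisation.\<close>
        have "(\<Sum>j\<in>levels V h. ?s j * dens V (dyadic V h j)) \<le> mean V h" if "\<forall>x\<in>V. 0 \<le> h x" for h
          using sum_dyadic_dens_le[OF V(1), of 1 h] that by (simp cong: mean_cong)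
        moreover have "mean V f \<le> 1" "mean V g \<le> 1"
          using mean_le_1_if_pnorm[OF V ab(1,3) _ f1] mean_le_1_if_pnorm[OF V ab(2,4) _ g1] fg by auto
        ultimately show "(\<Sum>j\<in>levels V f. ?s j * dens V (dyadic V f j)) \<le> 1"
          "(\<Sum>j\<in>levels V g. ?s j * dens V (dyadic V g j)) \<le> 1"
          using fg by fastforce+
        show "0 \<le> (\<Sum>j\<in>levels V g. ?s j * dens V (dyadic V g j))"
          by (intro sum_nonneg mult_nonneg_nonneg dens_nonneg) auto
      qed (use A in auto)
      also have "\<dots> \<le> (C + 1) * (c + B)" using A B C0 by (simp add: algebra_simps)
      finally show ?thesis by (simp only: mult.assoc)
    qed
    show "pairing V w f g \<le> 4 * (C + 1) * (c + A0 powr (1 - \<theta>) * A1 powr \<theta>) * (pnorm V a f * pnorm V b g)"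
    proof (cases "pnorm V a f = 0 \<or> pnorm V b g = 0")
      case True
      then show ?thesis using pairing_eq_0_if_pnorm_eq_0[OF V, of a f b g] by auto
    next
      case False
      then have pos: "0 < pnorm V a f" "0 < pnorm V b g"
        using pnorm_nonneg[OF V, of a f] pnorm_nonneg[OF V, of b g] by auto
      have one: "mean V (\<lambda>x. (1 / pnorm V e h * h x) powr (1 / e)) = 1"
        if "0 < pnorm V e h" "0 < e" "\<forall>x\<in>V. 0 \<le> h x" for e h
      proof -
        have "mean V (\<lambda>x. (1 / pnorm V e h * h x) powr (1 / e)) =
            mean V (\<lambda>x. (1 / pnorm V e h) powr (1 / e) * \<bar>h x\<bar> powr (1 / e))"
          using that by (intro mean_cong) (simp add: powr_divide)
        also have "\<dots> = 1" using that by (simp only: mean_cmult flip: pnorm_powr) (simp add: powr_divide)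
        finally show ?thesis .
      qed
      \<comment> \<open>The case of unit norms is applied to f and g divided by their norms.\<close>
      have "1 / pnorm V a f * (1 / pnorm V b g) * pairing V w f g \<le> 4 * (C + 1) * (c + B)"
        unfolding pairing_cmult[symmetric]
        by (rule unit) (use fg pos ab one[OF pos(1)] one[OF pos(2)] in \<open>simp_all\<close>)
      then show ?thesis using pos by (simp add: B_def divide_le_eq)
    qed
  qed
qed
qed

section \<open>Estimates uniform over a family of Markov kernels\<close>

text \<open>A member of W is the space over one field with its averaging kernel. Constants in
  \<open>strong\<close> and \<open>restricted\<close> are chosen before the member, which is the
  uniformity in q that is to be proved.\<close>

locale markov_family =
  fixes W :: "('v set \<times> ('v \<Rightarrow> 'v \<Rightarrow> real)) set"
  assumes fin: "(V, w) \<in> W \<Longrightarrow> finite V" and ne: "(V, w) \<in> W \<Longrightarrow> V \<noteq> {}"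
    and nonneg: "(V, w) \<in> W \<Longrightarrow> x \<in> V \<Longrightarrow> y \<in> V \<Longrightarrow> 0 \<le> w x y"
    and sym: "(V, w) \<in> W \<Longrightarrow> x \<in> V \<Longrightarrow> y \<in> V \<Longrightarrow> w x y = w y x"
    and stoch: "(V, w) \<in> W \<Longrightarrow> y \<in> V \<Longrightarrow> (\<Sum>x\<in>V. w x y) = 1"
begin

definition strong :: "real \<Rightarrow> real \<Rightarrow> bool" where
  "strong a b \<longleftrightarrow> (\<exists>C\<ge>0. \<forall>V w f. (V, w) \<in> W \<longrightarrow> (\<forall>x\<in>V. 0 \<le> f x) \<longrightarrow>
     pnorm V b (kop V w f) \<le> C * pnorm V a f)"

text \<open>Restricted weak type in bilinear form: \<open>1 - b\<close> is the index dual to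
  \<open>b\<close>. The constant is taken positive since its logarithm enters the
  interpolation.\<close>

definition restricted :: "real \<Rightarrow> real \<Rightarrow> bool" where
  "restricted a b \<longleftrightarrow> (\<exists>C>0. \<forall>V w E F. (V, w) \<in> W \<longrightarrow> E \<subseteq> V \<longrightarrow> F \<subseteq> V \<longrightarrow>
     pairing V w (indicator E) (indicator F) \<le> C * (dens V E powr a * dens V F powr (1 - b)))"

lemma strongI:
  assumes "0 \<le> C" "\<And>V w f. (V, w) \<in> W \<Longrightarrow> \<forall>x\<in>V. 0 \<le> f x \<Longrightarrow> pnorm V b (kop V w f) \<le> C * pnorm V a f"
  shows "strong a b"
  using assms unfolding strong_def by blast

lemma strongE:
  assumes "strong a b"
  obtains C where "0 \<le> C"
    "\<And>V w f. (V, w) \<in> W \<Longrightarrow> \<forall>x\<in>V. 0 \<le> f x \<Longrightarrow> pnorm V b (kop V w f) \<le> C * pnorm V a f"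
  using assms unfolding strong_def by blast

lemma restrictedI:
  assumes "0 < C" "\<And>V w E F. (V, w) \<in> W \<Longrightarrow> E \<subseteq> V \<Longrightarrow> F \<subseteq> V \<Longrightarrow>
     pairing V w (indicator E) (indicator F) \<le> C * (dens V E powr a * dens V F powr (1 - b))"
  shows "restricted a b"
  using assms unfolding restricted_def by blast

lemma restrictedE:
  assumes "restricted a b"
  obtains C where "0 < C" "\<And>V w E F. (V, w) \<in> W \<Longrightarrow> E \<subseteq> V \<Longrightarrow> F \<subseteq> V \<Longrightarrow>
     pairing V w (indicator E) (indicator F) \<le> C * (dens V E powr a * dens V F powr (1 - b))"
  using assms unfolding restricted_def by blast

lemma strong_mono:
  assumes "strong a b" "0 \<le> a'" "a' \<le> a" "0 \<le> b" "b \<le> b'"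
  shows "strong a' b'"
proof -
  obtain C where C: "C \<ge> 0" "\<And>V w f. (V, w) \<in> W \<Longrightarrow> \<forall>x\<in>V. 0 \<le> f x \<Longrightarrow> pnorm V b (kop V w f) \<le> C * pnorm V a f"
    by (rule strongE[OF assms(1)]) (rule that)
  have "pnorm V b' (kop V w f) \<le> C * pnorm V a' f" if "(V, w) \<in> W" "\<forall>x\<in>V. 0 \<le> f x" for V w f
  proof -
    have "pnorm V b' (kop V w f) \<le> pnorm V b (kop V w f)"
      using assms fin[OF that(1)] ne[OF that(1)] by (intro pnorm_antimono) auto
    also have "\<dots> \<le> C * pnorm V a f" by (rule C(2)[OF that])
    also have "\<dots> \<le> C * pnorm V a' f"
      using assms C(1) fin[OF that(1)] ne[OF that(1)] by (intro mult_left_mono pnorm_antimono) auto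
    finally show ?thesis .
  qed
  then show ?thesis by (rule strongI[OF C(1)])
qed

lemma kop_le_Max:
  assumes "(V, w) \<in> W" "y \<in> V" "\<And>x. x \<in> V \<Longrightarrow> f x \<le> M"
  shows "kop V w f y \<le> M"
proof -
  have "kop V w f y \<le> (\<Sum>x\<in>V. w x y * M)"
    unfolding kop_def using assms nonneg by (intro sum_mono mult_left_mono) auto
  also have "\<dots> = M" using stoch[OF assms(1,2)] by (simp flip: sum_distrib_right)
  finally show ?thesis .
qed

lemma mean_kop:
  assumes "(V, w) \<in> W"
  shows "mean V (kop V w f) = mean V f"
proof -
  have "(\<Sum>y\<in>V. w x y) = 1" if "x \<in> V" for x
  proof -
    have "(\<Sum>y\<in>V. w x y) = (\<Sum>y\<in>V. w y x)" by (rule sum.cong[OF refl sym[OF assms that]])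
    then show ?thesis by (simp only: stoch[OF assms that])
  qed
  then have "(\<Sum>y\<in>V. kop V w f y) = (\<Sum>x\<in>V. f x)"
    unfolding kop_def by (subst sum.swap) (simp add: sum_distrib_right[symmetric])
  then show ?thesis by (simp add: mean_def)
qed

lemma kop_ge_0: "(V, w) \<in> W \<Longrightarrow> \<forall>x\<in>V. 0 \<le> f x \<Longrightarrow> y \<in> V \<Longrightarrow> 0 \<le> kop V w f y"
  using nonneg by (intro kop_nonneg) auto

lemma strong_0_0: "strong 0 0"
proof -
  have "pnorm V 0 (kop V w f) \<le> 1 * pnorm V 0 f" if "(V, w) \<in> W" "\<forall>x\<in>V. 0 \<le> f x" for V w f
  proof -
    have "\<bar>kop V w f y\<bar> \<le> pnorm V 0 f" if "y \<in> V" for y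
    proof -
      have "f x \<le> pnorm V 0 f" if "x \<in> V" for x
        using le_pnorm_0[OF fin[OF \<open>(V, w) \<in> W\<close>] that, of f] by simp
      then show ?thesis
        using kop_le_Max[OF \<open>(V, w) \<in> W\<close> that] kop_ge_0[OF \<open>(V, w) \<in> W\<close> _ that] \<open>\<forall>x\<in>V. 0 \<le> f x\<close> by simp
    qed
    then show ?thesis using fin[OF that(1)] ne[OF that(1)] by (simp add: pnorm_def[of V 0 "kop V w f"])
  qed
  then show ?thesis by (rule strongI[OF zero_le_one])
qed

lemma strong_1_1: "strong 1 1"
proof -
  have "pnorm V 1 (kop V w f) \<le> 1 * pnorm V 1 f" if "(V, w) \<in> W" "\<forall>x\<in>V. 0 \<le> f x" for V w f
  proof -
    have "mean V (\<lambda>y. \<bar>kop V w f y\<bar>) = mean V (kop V w f)"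
      using kop_ge_0[OF that] by (intro mean_cong) simp
    also have "\<dots> = mean V (\<lambda>x. \<bar>f x\<bar>)"
      unfolding mean_kop[OF that(1)] using that(2) by (intro mean_cong) simp
    finally show ?thesis by (simp add: pnorm_one)
  qed
  then show ?thesis by (rule strongI[OF zero_le_one])
qed

lemma restricted_0_0: "restricted 0 0"
proof -
  have "pairing V w (indicator E) (indicator F) \<le> 1 * (dens V E powr 0 * dens V F powr (1 - 0))"
    if W: "(V, w) \<in> W" and EF: "E \<subseteq> V" "F \<subseteq> V" for V w E F
  proof (cases "E = {}")
    case True
    then show ?thesis by (simp add: pairing_eq)
  next
    case False
    have "pairing V w (indicator E) (indicator F) \<le> mean V (\<lambda>y. 1 * indicator F y)"
      unfolding pairing_def by (intro mean_mono mult_right_mono kop_le_Max[OF W]) (auto simp: indicator_def)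
    then show ?thesis
      using False EF dens_pos[OF fin[OF W] EF(1)] dens_nonneg[of V F] fin[OF W] by (simp add: mean_indicator)
  qed
  then show ?thesis by (rule restrictedI[OF zero_less_one])
qed

text \<open>A symmetric kernel allows E and F to be exchanged, which reflects the point (a, b) in
  the line a + b = 1. It carries \<open>P1\<close> to \<open>P2\<close> and (0, 0) to (1,
  1).\<close>

lemma restricted_dual:
  assumes "restricted a b"
  shows "restricted (1 - b) (1 - a)"
proof -
  obtain C where C: "C > 0" "\<And>V w E F. (V, w) \<in> W \<Longrightarrow> E \<subseteq> V \<Longrightarrow> F \<subseteq> V \<Longrightarrow>
     pairing V w (indicator E) (indicator F) \<le> C * (dens V E powr a * dens V F powr (1 - b))"
    by (rule restrictedE[OF assms]) (rule that)
  have "pairing V w (indicator E) (indicator F) \<le> C * (dens V E powr (1 - b) * dens V F powr (1 - (1 - a)))"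
    if W: "(V, w) \<in> W" and EF: "E \<subseteq> V" "F \<subseteq> V" for V w E F
    using C(2)[OF W EF(2,1)] pairing_commute[of V w "indicator E" "indicator F", OF sym[OF W]]
    by (simp add: mult.commute)
  then show ?thesis by (rule restrictedI[OF C(1)])
qed

lemma restricted_1_1: "restricted 1 1"
  using restricted_dual[OF restricted_0_0] by simp

lemma strong_if_pairing:
  assumes b: "0 < b" "b < 1" and C: "0 \<le> C"
    and *: "\<And>V w f g. (V, w) \<in> W \<Longrightarrow> (\<forall>x\<in>V. 0 \<le> f x \<and> 0 \<le> g x) \<Longrightarrow>
      pairing V w f g \<le> C * (pnorm V a f * pnorm V (1 - b) g)"
  shows "strong a b"
proof -
  have "pnorm V b (kop V w f) \<le> C * pnorm V a f" if W: "(V, w) \<in> W" and f: "\<forall>x\<in>V. 0 \<le> f x" for V w f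
  proof (rule pnorm_dual[OF fin[OF W] ne[OF W] b])
    show "0 \<le> kop V w f x" if "x \<in> V" for x using kop_ge_0[OF W f that] .
    show "0 \<le> C * pnorm V a f" using C pnorm_nonneg[OF fin[OF W] ne[OF W]] by simp
    show "mean V (\<lambda>x. kop V w f x * g x) \<le> C * pnorm V a f * pnorm V (1 - b) g"
      if "\<And>x. x \<in> V \<Longrightarrow> 0 \<le> g x" for g
      using *[OF W, of f g] that f by (simp add: pairing_def mult.assoc)
  qed
  then show ?thesis by (rule strongI[OF C])
qed

text \<open>Hoelder with g an indicator. This returns a strong estimate to a form from which
  interpolation can continue; \<open>C + 1\<close> replaces C to make the constant positive.\<close>

lemma strong_imp_restricted:
  assumes "strong a b" "0 < a" "0 < b" "b < 1"
  shows "restricted a b"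
proof -
  obtain C where C: "C \<ge> 0" "\<And>V w f. (V, w) \<in> W \<Longrightarrow> \<forall>x\<in>V. 0 \<le> f x \<Longrightarrow> pnorm V b (kop V w f) \<le> C * pnorm V a f"
    by (rule strongE[OF assms(1)]) (rule that)
  have "pairing V w (indicator E) (indicator F) \<le> (C + 1) * (dens V E powr a * dens V F powr (1 - b))"
    if W: "(V, w) \<in> W" and EF: "E \<subseteq> V" "F \<subseteq> V" for V w E F
  proof -
    note V = fin[OF W] ne[OF W]
    have "pairing V w (indicator E) (indicator F) \<le>
        pnorm V b (kop V w (indicator E)) * pnorm V (1 - b) (indicator F)"
      unfolding pairing_def using assms V kop_ge_0[OF W] by (intro Hoelder) auto
    also have "\<dots> \<le> C * pnorm V a (indicator E) * pnorm V (1 - b) (indicator F)"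
      using C(2)[OF W] V by (intro mult_right_mono pnorm_nonneg) auto
    also have "\<dots> = C * (dens V E powr a * dens V F powr (1 - b))"
      using V EF assms by (simp add: pnorm_indicator)
    also have "\<dots> \<le> (C + 1) * (dens V E powr a * dens V F powr (1 - b))"
      by (intro mult_right_mono) auto
    finally show ?thesis .
  qed
  then show ?thesis using C(1) by (intro restrictedI[of "C + 1"]) simp_all
qed

text \<open>Restricted estimates are set bounds with c = 0. In dual indices the hypothesis b < a
  reads 1 < a + (1 - b), the room that the dyadic summation consumes.\<close>

lemma strong_between:
  fixes a0 a1 b0 b1 \<theta> :: real
  defines "a \<equiv> (1 - \<theta>) * a0 + \<theta> * a1" and "b \<equiv> (1 - \<theta>) * b0 + \<theta> * b1"
  assumes r: "restricted a0 b0" "restricted a1 b1" and neq: "a0 \<noteq> a1" "b0 \<noteq> b1"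
    and \<theta>: "0 < \<theta>" "\<theta> < 1" and ab: "0 < b" "b < a" "a \<le> 1"
  shows "strong a b"
proof -
  have b': "(1 - \<theta>) * (1 - b0) + \<theta> * (1 - b1) = 1 - b" by (simp add: b_def algebra_simps)
  have a0: "0 < a" and b1': "0 < 1 - b" and neq': "1 - b0 \<noteq> 1 - b1" using ab neq by auto
  have ab1: "a \<le> 1" "1 - b \<le> 1" "1 < a + (1 - b)" using ab by auto
  obtain C0 where C0: "C0 > 0" "\<And>V w E F. (V, w) \<in> W \<Longrightarrow> E \<subseteq> V \<Longrightarrow> F \<subseteq> V \<Longrightarrow>
     pairing V w (indicator E) (indicator F) \<le> C0 * (dens V E powr a0 * dens V F powr (1 - b0))"
    by (rule restrictedE[OF r(1)]) (rule that)
  obtain C1 where C1: "C1 > 0" "\<And>V w E F. (V, w) \<in> W \<Longrightarrow> E \<subseteq> V \<Longrightarrow> F \<subseteq> V \<Longrightarrow>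
     pairing V w (indicator E) (indicator F) \<le> C1 * (dens V E powr a1 * dens V F powr (1 - b1))"
    by (rule restrictedE[OF r(2)]) (rule that)
  have sb: "set_bound V w 0 C0 a0 (1 - b0)" "set_bound V w 0 C1 a1 (1 - b1)" if "(V, w) \<in> W" for V w
    using C0(2)[OF that] C1(2)[OF that] by (simp_all add: set_bound_def)
  note int = restricted_interpolation[OF \<theta>, of a0 a1 "1 - b0" "1 - b1", where 'v='v,
        unfolded b', folded a_def, OF a0 b1' ab1 neq(1) neq']
  show ?thesis
  proof (rule int)
    fix C :: real
    assume C: "0 \<le> C" and *: "\<And>(V::'v set) w A0 A1 c f g. finite V \<Longrightarrow> V \<noteq> {} \<Longrightarrow>
      (\<And>x y. x \<in> V \<Longrightarrow> y \<in> V \<Longrightarrow> 0 \<le> w x y) \<Longrightarrow> 0 < A0 \<Longrightarrow> 0 < A1 \<Longrightarrow> 0 \<le> c \<Longrightarrow>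
      set_bound V w c A0 a0 (1 - b0) \<Longrightarrow> set_bound V w c A1 a1 (1 - b1) \<Longrightarrow>
      (\<And>x. x \<in> V \<Longrightarrow> 0 \<le> f x) \<Longrightarrow> (\<And>x. x \<in> V \<Longrightarrow> 0 \<le> g x) \<Longrightarrow>
      pairing V w f g \<le> C * (c + A0 powr (1 - \<theta>) * A1 powr \<theta>) * (pnorm V a f * pnorm V (1 - b) g)"
    show "strong a b"
    proof (rule strong_if_pairing[where C = "C * (0 + C0 powr (1 - \<theta>) * C1 powr \<theta>)"])
      show "0 < b" by (rule ab(1))
      show "b < 1" using ab(2,3) by (rule less_le_trans)
      show "0 \<le> C * (0 + C0 powr (1 - \<theta>) * C1 powr \<theta>)" using C by simp
      fix V w and f g :: "'v \<Rightarrow> real" assume W: "(V, w) \<in> W" and fg: "\<forall>x\<in>V. 0 \<le> f x \<and> 0 \<le> g x"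
      show "pairing V w f g \<le> C * (0 + C0 powr (1 - \<theta>) * C1 powr \<theta>) * (pnorm V a f * pnorm V (1 - b) g)"
      proof (rule *)
        show "finite V" "V \<noteq> {}" using fin[OF W] ne[OF W] .
        show "0 \<le> w x y" if "x \<in> V" "y \<in> V" for x y using nonneg[OF W that] .
        show "0 < C0" "0 < C1" using C0(1) C1(1) .
        show "set_bound V w 0 C0 a0 (1 - b0)" "set_bound V w 0 C1 a1 (1 - b1)" using sb[OF W] .
        show "0 \<le> f x" "0 \<le> g x" if "x \<in> V" for x using fg that by blast+
      qed (rule order_refl)
    qed
  qed
qed

end

section \<open>Additive characters of a finite field\<close>

locale finite_field = field R for R (structure) +
  assumes finite_carrier: "finite (carrier R)"
begin

abbreviation nmult :: "nat \<Rightarrow> 'a \<Rightarrow> 'a" where "nmult n x \<equiv> add_pow R n x"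

definition characteristic :: nat where "characteristic = add.ord \<one>"

lemma nat_mult_one_eq_0_iff: "nmult n \<one> = \<zero> \<longleftrightarrow> characteristic dvd n"
  by (simp add: characteristic_def add.pow_eq_id)

text \<open>The additive order of 1 divides the order of the field and hence is positive; if it
  factors as m k, then \<open>nmult m \<one>\<close> and \<open>nmult k \<one>\<close> have product
  0, so one of them is 0.\<close>

lemma prime_characteristic: "Factorial_Ring.prime characteristic"
proof -
  let ?p = characteristic
  have "nmult (card (carrier R)) \<one> = \<zero>" by (intro add.power_order_eq_one finite_carrier one_closed)
  then have "?p dvd card (carrier R)" by (simp add: nat_mult_one_eq_0_iff)
  moreover have "card (carrier R) > 0" using finite_carrier one_closed by (auto simp: card_gt_0_iff)
  ultimately have pos: "?p > 0" by (auto intro: Nat.gr0I)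
  have "?p \<noteq> 1" using nat_mult_one_eq_0_iff[of 1] by auto
  moreover have "m = 1 \<or> m = ?p" if dv: "m dvd ?p" for m
  proof -
    obtain k where k: "?p = m * k" using dv by blast
    have "(nmult m \<one>) \<otimes> (nmult k \<one>) = nmult (m * k) \<one>"
      by (simp add: add_pow_ldistr add_pow_rdistr add.nat_pow_pow mult.commute)
    also have "\<dots> = \<zero>" by (simp add: nat_mult_one_eq_0_iff flip: k)
    finally have "?p dvd m \<or> ?p dvd k" by (simp add: integral_iff nat_mult_one_eq_0_iff)
    then show ?thesis using k pos dv by (auto dest: dvd_antisym)
  qed
  ultimately show ?thesis using pos by (auto simp: prime_nat_iff)
qed

lemma characteristic_mult: "x \<in> carrier R \<Longrightarrow> nmult characteristic x = \<zero>"
  using add_pow_ldistr[of \<one> x characteristic] nat_mult_one_eq_0_iff[of characteristic] by simp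

lemma nat_mult_inverse:
  assumes "\<not> characteristic dvd k"
  obtains m where "\<And>x. x \<in> carrier R \<Longrightarrow> nmult (k * m) x = x"
proof -
  let ?p = characteristic
  have "coprime k ?p" using assms prime_characteristic by (metis coprime_commute prime_imp_coprime)
  then obtain m where m: "[k * m = 1] (mod ?p)" using cong_solve_coprime_nat by auto
  have "(k * m) mod ?p = 1" using m prime_gt_1_nat[OF prime_characteristic] by (simp add: cong_def)
  then have km: "k * m = ?p * ((k * m) div ?p) + 1" by (metis mult_div_mod_eq)
  have "nmult (k * m) x = x" if x: "x \<in> carrier R" for x
  proof -
    have "nmult (k * m) x = nmult (?p * ((k * m) div ?p)) x \<oplus> nmult 1 x"
      using x by (subst km) (simp add: add.nat_pow_mult)
    also have "nmult (?p * ((k * m) div ?p)) x = \<zero>"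
      using x by (simp add: characteristic_mult flip: add.nat_pow_pow)
    finally show ?thesis using x by simp
  qed
  then show ?thesis by (rule that)
qed

text \<open>
  An additive subgroup \<open>H\<close> that is maximal subject to \<open>\<one> \<notin> H\<close> is a complement of the prime
  field, and the character is \<open>h \<oplus> k \<one> \<mapsto> \<omega> ^ k\<close>.
\<close>

lemma exists_additive_character:
  obtains \<psi> :: "'a \<Rightarrow> complex" where
    "\<And>x. x \<in> carrier R \<Longrightarrow> cmod (\<psi> x) = 1"
    "\<And>x y. x \<in> carrier R \<Longrightarrow> y \<in> carrier R \<Longrightarrow> \<psi> (x \<oplus> y) = \<psi> x * \<psi> y"
    "\<exists>x\<in>carrier R. \<psi> x \<noteq> 1"
proof -
  let ?p = characteristic
  \<comment> \<open>Closure under addition is enough for a subgroup here: \<open>\<ominus> h\<close>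
    is the multiple of h by the characteristic minus 1.\<close>
  define cl where "cl = (\<lambda>H. H \<subseteq> carrier R \<and> \<zero> \<in> H \<and> (\<forall>x\<in>H. \<forall>y\<in>H. x \<oplus> y \<in> H))"
  define F where "F = {H. cl H \<and> \<one> \<notin> H}"
  have "F \<subseteq> Pow (carrier R)" by (auto simp: F_def cl_def)
  then have "finite F" using finite_carrier finite_subset by blast
  moreover have "{\<zero>} \<in> F" by (auto simp: F_def cl_def)
  ultimately obtain H where H: "H \<in> F" and max: "\<And>H'. H' \<in> F \<Longrightarrow> H \<subseteq> H' \<Longrightarrow> H = H'"
    using finite_has_maximal[of F] by (metis empty_iff)
  have Hsub: "x \<in> carrier R" if "x \<in> H" for x using H that by (auto simp: F_def cl_def)
  have H0: "\<zero> \<in> H" and Hadd: "x \<in> H \<Longrightarrow> y \<in> H \<Longrightarrow> x \<oplus> y \<in> H" and H1: "\<one> \<notin> H" for x y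
    using H by (auto simp: F_def cl_def)
  have Hmult: "nmult n h \<in> H" if "h \<in> H" for h and n :: nat
    by (induction n) (use that H0 in \<open>auto simp: Hadd\<close>)
  have Hneg: "\<ominus> h \<in> H" if "h \<in> H" for h
  proof -
    have "h \<oplus> nmult (?p - 1) h = nmult (Suc (?p - 1)) h"
      using Hsub[OF that] by (simp add: a_comm)
    also have "\<dots> = \<zero>"
      using prime_gt_0_nat[OF prime_characteristic] Hsub[OF that] by (simp add: characteristic_mult del: add.nat_pow_Suc)
    finally have "\<ominus> h = nmult (?p - 1) h"
      using Hsub[OF that] by (metis add.nat_pow_closed add.inv_comm minus_equality)
    then show ?thesis using Hmult[OF that] by simp
  qed
  have dvd: "?p dvd k" if "nmult k \<one> \<in> H" for k :: nat
  proof (rule ccontr)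
    assume "\<not> ?p dvd k"
    then obtain m where "\<And>x. x \<in> carrier R \<Longrightarrow> nmult (k * m) x = x" by (rule nat_mult_inverse) blast
    then have "nmult m (nmult k \<one>) = \<one>" by (simp add: add.nat_pow_pow)
    then show False using Hmult[OF that, of m] H1 by simp
  qed
  have span: "\<exists>h\<in>H. \<exists>k::nat. x = h \<oplus> nmult k \<one>" if x: "x \<in> carrier R" for x
  proof (cases "x \<in> H")
    case True
    then show ?thesis using x by (intro bexI[of _ x] exI[of _ 0]) auto
  next
    case False
    \<comment> \<open>Adjoining x to H gives a larger closed set, so by maximality it contains 1.
      Then 1 = h + k x with k prime to the characteristic (else 1 would lie in H), and multiplying
      by an inverse of k solves for x.\<close>
    define H' where "H' = {h \<oplus> nmult k x | h k. h \<in> H \<and> k \<in> (UNIV :: nat set)}"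
    have in_H': "h \<oplus> nmult k x \<in> H'" if "h \<in> H" for h and k :: nat using that by (auto simp: H'_def)
    have "H \<subseteq> H'" using in_H'[of _ 0] Hsub by force
    moreover have "x \<in> H'" using in_H'[OF H0, of 1] x by simp
    moreover have "cl H'"
    proof -
      have "y \<oplus> z \<in> H'" if yz: "y \<in> H'" "z \<in> H'" for y z
      proof -
        obtain h k h' k' where "h \<in> H" "h' \<in> H" "y = h \<oplus> nmult k x" "z = h' \<oplus> nmult k' x"
          using yz by (auto simp: H'_def)
        moreover have "h \<oplus> nmult k x \<oplus> (h' \<oplus> nmult k' x) = (h \<oplus> h') \<oplus> nmult (k + k') x"
          using calculation Hsub x by (simp add: a_ac flip: add.nat_pow_mult)
        ultimately show ?thesis using in_H' Hadd by simp
      qed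
      moreover have "H' \<subseteq> carrier R" using Hsub x by (auto simp: H'_def)
      ultimately show ?thesis using \<open>H \<subseteq> H'\<close> H0 by (auto simp: cl_def)
    qed
    ultimately have "\<one> \<in> H'" using max[of H'] False by (auto simp: F_def)
    then obtain h k where hk: "h \<in> H" "\<one> = h \<oplus> nmult k x" by (auto simp: H'_def)
    have "\<not> ?p dvd k"
    proof
      assume "?p dvd k"
      then obtain t where "k = ?p * t" by blast
      then have "nmult k x = \<zero>" using x by (simp add: characteristic_mult flip: add.nat_pow_pow)
      then show False using hk H1 Hsub by simp
    qed
    then obtain m where m: "\<And>x. x \<in> carrier R \<Longrightarrow> nmult (k * m) x = x" by (rule nat_mult_inverse) blast
    have "nmult m \<one> = nmult m h \<oplus> nmult m (nmult k x)"
      using hk Hsub x by (metis add.nat_pow_closed add.nat_pow_distrib)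
    also have "nmult m (nmult k x) = x" using x m by (simp add: add.nat_pow_pow)
    finally have "\<ominus> (nmult m h) \<oplus> nmult m \<one> = x"
      using Hsub[OF Hmult[OF hk(1)]] x by (simp add: r_neg1)
    then show ?thesis using Hneg[OF Hmult[OF hk(1)]] by blast
  qed
  define \<omega> where "\<omega> = cis (2 * pi / ?p)"
  have p1: "?p > 1" using prime_gt_1_nat[OF prime_characteristic] .
  have "\<omega> ^ ?p = cis (?p * (2 * pi / ?p))" unfolding \<omega>_def by (rule Complex.DeMoivre)
  also have "?p * (2 * pi / ?p) = 2 * pi" using p1 by simp
  finally have \<omega>p: "\<omega> ^ ?p = 1" by simp
  have \<omega>1: "\<omega> \<noteq> 1"
  proof
    assume "\<omega> = 1"
    then have "Re \<omega> = 1" by simp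
    then have "cos (2 * pi / ?p) = 1" by (simp add: \<omega>_def)
    then obtain n :: int where n: "2 * pi / ?p = of_int n * 2 * pi" using cos_one_2pi_int by auto
    then have "real_of_int (n * int ?p) = 1" using p1 by (simp add: field_simps)
    then have "n * int ?p = 1" by linarith
    then show False using p1 by (simp add: zmult_eq_1_iff)
  qed
  \<comment> \<open>The exponent k in a representation h + k 1 is determined modulo the
    characteristic, because a multiple of 1 lies in H only when the characteristic divides the
    multiplier. Hence \<open>\<omega> ^ k\<close> is well defined.\<close>
  have uniq: "\<omega> ^ k = \<omega> ^ k'" if hh: "h \<in> H" "h' \<in> H" and eq: "h \<oplus> nmult k \<one> = h' \<oplus> nmult k' \<one>" for h h' and k k' :: nat
  proof -
    have le: "\<omega> ^ k = \<omega> ^ k'" if hh: "h \<in> H" "h' \<in> H" and eq: "h \<oplus> nmult k \<one> = h' \<oplus> nmult k' \<one>" and kk: "k' \<le> k" for h h' and k k' :: nat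
    proof -
      have "nmult k \<one> = nmult (k - k') \<one> \<oplus> nmult k' \<one>" using kk by (simp add: add.nat_pow_mult)
      then have "(h \<oplus> nmult (k - k') \<one>) \<oplus> nmult k' \<one> = h' \<oplus> nmult k' \<one>"
        using eq Hsub[OF hh(1)] by (simp add: a_assoc)
      then have "h \<oplus> nmult (k - k') \<one> = h'" using Hsub hh by simp
      then have "nmult (k - k') \<one> = \<ominus> h \<oplus> h'" using Hsub[OF hh(1)] by (auto simp: r_neg1)
      then have "?p dvd k - k'" using Hadd[OF Hneg[OF hh(1)] hh(2)] by (intro dvd) simp
      then obtain t where "k - k' = ?p * t" by blast
      then have "k = k' + ?p * t" using kk by simp
      then show ?thesis using \<omega>p by (simp add: power_add power_mult)
    qed
    show ?thesis using le[OF hh eq] le[OF hh(2,1) eq[symmetric]] by (cases "k' \<le> k") auto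
  qed
  define \<psi> where "\<psi> = (\<lambda>x. \<omega> ^ (SOME k::nat. \<exists>h\<in>H. x = h \<oplus> nmult k \<one>))"
  have \<psi>: "\<psi> (h \<oplus> nmult k \<one>) = \<omega> ^ k" if "h \<in> H" for h and k :: nat
  proof -
    have "\<exists>k'::nat. \<exists>h'\<in>H. h \<oplus> nmult k \<one> = h' \<oplus> nmult k' \<one>" using that by blast
    from someI_ex[OF this] show ?thesis
      unfolding \<psi>_def by (elim bexE) (rule uniq[OF _ that], assumption, rule sym)
  qed
  show thesis
  proof (rule that[of \<psi>])
    show "cmod (\<psi> x) = 1" for x by (simp add: \<psi>_def \<omega>_def norm_power)
    fix x y assume xy: "x \<in> carrier R" "y \<in> carrier R"
    obtain h k where h: "h \<in> H" "x = h \<oplus> nmult k \<one>" using span[OF xy(1)] by blast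
    obtain h' k' where h': "h' \<in> H" "y = h' \<oplus> nmult k' \<one>" using span[OF xy(2)] by blast
    have "x \<oplus> y = (h \<oplus> h') \<oplus> nmult (k + k') \<one>"
      using h h' Hsub by (simp add: a_ac flip: add.nat_pow_mult)
    then show "\<psi> (x \<oplus> y) = \<psi> x * \<psi> y" using \<psi> h h' Hadd by (simp add: power_add)
  next
    have "\<psi> (\<zero> \<oplus> nmult 1 \<one>) \<noteq> 1" using \<omega>1 by (subst \<psi>[OF H0]) simp
    then show "\<exists>x\<in>carrier R. \<psi> x \<noteq> 1" by (intro bexI[of _ "\<zero> \<oplus> nmult 1 \<one>"]) auto
  qed
qed

end

section \<open>Gauss sums\<close>

lemma (in abelian_group) bij_betw_translate:
  "y \<in> carrier G \<Longrightarrow> bij_betw (\<lambda>x. x \<oplus> y) (carrier G) (carrier G)"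
  by (rule bij_betw_byWitness[where f' = "\<lambda>x. x \<ominus> y"]) (auto simp: minus_eq a_assoc l_neg r_neg)

lemma (in abelian_group) bij_betw_reflect:
  "y \<in> carrier G \<Longrightarrow> bij_betw (\<lambda>x. y \<ominus> x) (carrier G) (carrier G)"
  by (rule bij_betw_byWitness[where f' = "\<lambda>x. y \<ominus> x"]) (auto simp: minus_eq minus_add a_assoc[symmetric] r_neg)

lemma (in abelian_group) sum_translate:
  "y \<in> carrier G \<Longrightarrow> (\<Sum>x\<in>carrier G. f (x \<oplus> y)) = (\<Sum>x\<in>carrier G. f x)"
  using sum.reindex_bij_betw[OF bij_betw_translate] .

text \<open>Translation by y leaves the sum unchanged but multiplies it by \<open>e y\<close>, which
  differs from 1.\<close>

lemma (in abelian_group) sum_character_eq_0: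
  fixes e :: "'a \<Rightarrow> complex"
  assumes "\<And>x y. x \<in> carrier G \<Longrightarrow> y \<in> carrier G \<Longrightarrow> e (x \<oplus> y) = e x * e y"
    and "y \<in> carrier G" "e y \<noteq> 1"
  shows "(\<Sum>x\<in>carrier G. e x) = 0"
proof -
  have "(\<Sum>x\<in>carrier G. e x) = (\<Sum>x\<in>carrier G. e (x \<oplus> y))"
    by (rule sum_translate[OF assms(2), symmetric])
  also have "\<dots> = (\<Sum>x\<in>carrier G. e x) * e y"
    unfolding sum_distrib_right by (rule sum.cong[OF refl assms(1)[OF _ assms(2)]])
  finally show ?thesis using assms(3) by simp
qed

locale character_field = finite_field +
  fixes \<psi> :: "'a \<Rightarrow> complex"
  assumes norm_psi: "x \<in> carrier R \<Longrightarrow> cmod (\<psi> x) = 1"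
    and psi_add: "x \<in> carrier R \<Longrightarrow> y \<in> carrier R \<Longrightarrow> \<psi> (x \<oplus> y) = \<psi> x * \<psi> y"
    and psi_nontrivial: "\<exists>x\<in>carrier R. \<psi> x \<noteq> 1"
    and two_neq_0: "\<one> \<oplus> \<one> \<noteq> \<zero>"
begin

abbreviation Kx :: "'a set" where "Kx \<equiv> carrier R - {\<zero>}"

abbreviation q :: nat where "q \<equiv> card (carrier R)"

lemma q_gt_1: "1 < q"
  using card_mono[OF finite_carrier, of "{\<zero>, \<one>}"] by simp

lemma finite_Kx: "finite Kx" using finite_carrier by simp

lemma psi_zero [simp]: "\<psi> \<zero> = 1"
proof -
  have "\<psi> \<zero> \<noteq> 0" using norm_psi[of \<zero>] by auto
  moreover have "\<psi> \<zero> = \<psi> \<zero> * \<psi> \<zero>" using psi_add[of \<zero> \<zero>] by simp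
  ultimately show ?thesis by simp
qed

lemma psi_mult_cnj: "x \<in> carrier R \<Longrightarrow> \<psi> x * cnj (\<psi> x) = 1"
  using complex_norm_square[of "\<psi> x"] by (simp add: norm_psi)

lemma psi_neg:
  assumes "x \<in> carrier R"
  shows "\<psi> (\<ominus> x) = cnj (\<psi> x)"
proof -
  have "\<psi> (\<ominus> x) * \<psi> x = 1" using psi_add[of "\<ominus> x" x] assms by (simp add: l_neg)
  moreover have "cnj (\<psi> x) * \<psi> x = 1"
    using psi_mult_cnj[OF assms] by (simp add: mult.commute)
  moreover have "\<psi> x \<noteq> 0" using norm_psi[OF assms] by auto
  ultimately show ?thesis by (metis mult_right_cancel)
qed

lemma sum_psi:
  assumes b: "b \<in> carrier R"
  shows "(\<Sum>s\<in>carrier R. \<psi> (s \<otimes> b)) = (if b = \<zero> then of_nat q else 0)"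
proof (cases "b = \<zero>")
  case False
  obtain x where x: "x \<in> carrier R" "\<psi> x \<noteq> 1" using psi_nontrivial by blast
  have "(x \<otimes> inv b) \<otimes> b = x" using x b False by (simp add: m_assoc field_Units)
  then show ?thesis
    using False x b by (subst sum_character_eq_0[of "\<lambda>s. \<psi> (s \<otimes> b)" "x \<otimes> inv b"])
      (auto simp: l_distr psi_add field_Units)
qed simp

lemma sum_psi_Kx:
  assumes b: "b \<in> carrier R"
  shows "(\<Sum>s\<in>Kx. \<psi> (s \<otimes> b)) = (if b = \<zero> then of_nat q else 0) - 1"
  using sum_psi[OF b] b finite_carrier by (simp add: sum.remove[of "carrier R" \<zero>] algebra_simps)

lemma double_neq_0: "x \<in> carrier R \<Longrightarrow> x \<oplus> x = \<zero> \<longleftrightarrow> x = \<zero>"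
proof
  assume x: "x \<in> carrier R" and "x \<oplus> x = \<zero>"
  then have "(\<one> \<oplus> \<one>) \<otimes> x = \<zero>" by (simp add: l_distr)
  then show "x = \<zero>" using x two_neq_0 by (simp add: integral_iff)
qed simp

definition gauss_sum :: "'a \<Rightarrow> complex" where
  "gauss_sum c = (\<Sum>a\<in>carrier R. \<psi> (c \<otimes> (a \<otimes> a)))"

text \<open>In the double sum the substitution a -> a + b turns the difference of squares into c a^2
  + 2 c a b. The sum over b then vanishes unless a = 0, because 2 is nonzero.\<close>

lemma norm_gauss_sum:
  assumes c: "c \<in> carrier R" "c \<noteq> \<zero>"
  shows "gauss_sum c * cnj (gauss_sum c) = of_nat q"
proof -
  have "gauss_sum c * cnj (gauss_sum c) =
      (\<Sum>b\<in>carrier R. \<Sum>a\<in>carrier R. \<psi> (c \<otimes> (a \<otimes> a)) * cnj (\<psi> (c \<otimes> (b \<otimes> b))))"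
    by (simp add: gauss_sum_def sum_product) (rule sum.swap)
  also have "\<dots> = (\<Sum>b\<in>carrier R. \<Sum>a\<in>carrier R. \<psi> (c \<otimes> ((a \<oplus> b) \<otimes> (a \<oplus> b))) * cnj (\<psi> (c \<otimes> (b \<otimes> b))))"

    by (intro sum.cong refl sum_translate[symmetric, of _ "\<lambda>a. \<psi> (c \<otimes> (a \<otimes> a)) * cnj (\<psi> (c \<otimes> (b \<otimes> b)))" for b])
  also have "\<dots> = (\<Sum>b\<in>carrier R. \<Sum>a\<in>carrier R. \<psi> (c \<otimes> (a \<otimes> a)) * \<psi> (b \<otimes> (c \<otimes> (a \<oplus> a))))"
  proof (intro sum.cong refl)
    fix a b assume ab: "a \<in> carrier R" "b \<in> carrier R"
    have "c \<otimes> ((a \<oplus> b) \<otimes> (a \<oplus> b)) = c \<otimes> (a \<otimes> a) \<oplus> b \<otimes> (c \<otimes> (a \<oplus> a)) \<oplus> c \<otimes> (b \<otimes> b)"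
      using ab c(1) by algebra
    then have "\<psi> (c \<otimes> ((a \<oplus> b) \<otimes> (a \<oplus> b))) = \<psi> (c \<otimes> (a \<otimes> a)) * \<psi> (b \<otimes> (c \<otimes> (a \<oplus> a))) * \<psi> (c \<otimes> (b \<otimes> b))"
      using ab c by (simp add: psi_add)
    moreover have "\<psi> (c \<otimes> (b \<otimes> b)) * cnj (\<psi> (c \<otimes> (b \<otimes> b))) = 1"
      using ab c by (intro psi_mult_cnj) simp
    ultimately show "\<psi> (c \<otimes> ((a \<oplus> b) \<otimes> (a \<oplus> b))) * cnj (\<psi> (c \<otimes> (b \<otimes> b))) =
        \<psi> (c \<otimes> (a \<otimes> a)) * \<psi> (b \<otimes> (c \<otimes> (a \<oplus> a)))" by simp
  qed
  also have "\<dots> = (\<Sum>a\<in>carrier R. \<psi> (c \<otimes> (a \<otimes> a)) * (\<Sum>b\<in>carrier R. \<psi> (b \<otimes> (c \<otimes> (a \<oplus> a)))))"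
    by (subst sum.swap) (simp add: sum_distrib_left)
  also have "\<dots> = (\<Sum>a\<in>carrier R. if a = \<zero> then of_nat q else 0)"
  proof (rule sum.cong[OF refl])
    fix a assume a: "a \<in> carrier R"
    have "c \<otimes> (a \<oplus> a) = \<zero> \<longleftrightarrow> a = \<zero>" using a c by (simp add: integral_iff double_neq_0)
    then show "\<psi> (c \<otimes> (a \<otimes> a)) * (\<Sum>b\<in>carrier R. \<psi> (b \<otimes> (c \<otimes> (a \<oplus> a)))) = (if a = \<zero> then of_nat q else 0)"
      using a c by (subst sum_psi) auto
  qed
  also have "\<dots> = of_nat q" using finite_carrier by simp
  finally show ?thesis .
qed

section \<open>Squares, the quadratic character, and twisted sums\<close>

definition Sq :: "'a set" where "Sq = (\<lambda>a. a \<otimes> a) ` Kx"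

text \<open>The quadratic character on \<open>Kx\<close>, over which all sums with
  \<open>eta\<close> run; at zero this definition gives -1 where the usual convention is 0.\<close>

definition eta :: "'a \<Rightarrow> complex" where "eta s = (if s \<in> Sq then 1 else - 1)"

lemma Sq_subset: "Sq \<subseteq> Kx"
  by (auto simp: Sq_def integral_iff)

text \<open>Every nonzero square has exactly two roots, a and -a, which differ since 2 is
  nonzero.\<close>

lemma sum_over_squares:
  fixes F :: "'a \<Rightarrow> complex"
  shows "(\<Sum>a\<in>Kx. F (a \<otimes> a)) = 2 * (\<Sum>s\<in>Sq. F s)"
proof -
  have "(\<Sum>a\<in>Kx. F (a \<otimes> a)) = (\<Sum>s\<in>Sq. \<Sum>a\<in>{a\<in>Kx. a \<otimes> a = s}. F (a \<otimes> a))"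
    unfolding Sq_def by (rule sum.image_gen[OF finite_Kx])
  also have "\<dots> = (\<Sum>s\<in>Sq. 2 * F s)"
  proof (rule sum.cong[OF refl])
    fix s assume "s \<in> Sq"
    then obtain a where a: "a \<in> carrier R" "a \<noteq> \<zero>" "s = a \<otimes> a" by (auto simp: Sq_def)
    have "b = a \<or> b = \<ominus> a" if b: "b \<in> carrier R" "b \<otimes> b = a \<otimes> a" for b
    proof -
      have "(b \<oplus> a) \<otimes> (b \<ominus> a) = b \<otimes> b \<ominus> a \<otimes> a" using a(1) b(1) by algebra
      also have "\<dots> = \<zero>" using a(1) b by (simp add: minus_eq r_neg)
      finally have "b \<oplus> a = \<zero> \<or> b \<ominus> a = \<zero>" using a(1) b(1) by (simp add: integral_iff)
      then show ?thesis using a(1) b(1) by (metis minus_equality r_right_minus_eq)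
    qed
    then have "{b\<in>Kx. b \<otimes> b = s} \<subseteq> {a, \<ominus> a}" unfolding a(3) by blast
    moreover have mm: "\<ominus> a \<otimes> \<ominus> a = a \<otimes> a" using a(1) by algebra
    have "a \<in> Kx" "\<ominus> a \<in> Kx" using a(1,2) by simp_all
    then have "{a, \<ominus> a} \<subseteq> {b\<in>Kx. b \<otimes> b = s}" unfolding a(3) using mm by simp
    ultimately have "{b\<in>Kx. b \<otimes> b = s} = {a, \<ominus> a}" by (rule subset_antisym)
    moreover have "a \<noteq> \<ominus> a" using a(2) double_neq_0[OF a(1)] r_neg[OF a(1)] by force
    ultimately show "(\<Sum>b\<in>{b\<in>Kx. b \<otimes> b = s}. F (b \<otimes> b)) = 2 * F s"
      by (simp add: mm flip: a(3))
  qed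
  finally show ?thesis by (simp add: sum_distrib_left)
qed

lemma card_Sq: "2 * card Sq = q - 1"
proof -
  have "of_nat (card Kx) = (2 * of_nat (card Sq) :: complex)" using sum_over_squares[of "\<lambda>_. 1"] by simp
  then have "card Kx = 2 * card Sq" by (metis of_nat_eq_iff of_nat_mult of_nat_numeral)
  then show ?thesis using finite_carrier by simp
qed

text \<open>On \<open>Kx\<close> the function eta + 1 is twice the indicator of \<open>Sq\<close>,
  and twice a sum over squares is a sum over roots.\<close>

lemma sum_eta_mult:
  "(\<Sum>s\<in>Kx. eta s * F s) = (\<Sum>a\<in>Kx. F (a \<otimes> a)) - (\<Sum>s\<in>Kx. F s)"
proof -
  have "(\<Sum>s\<in>Kx. eta s * F s) = (\<Sum>s\<in>Kx. (if s \<in> Sq then 2 * F s else 0) - F s)"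
    by (intro sum.cong) (auto simp: eta_def)
  also have "\<dots> = (\<Sum>s\<in>Sq. 2 * F s) - (\<Sum>s\<in>Kx. F s)"
    using finite_Kx Sq_subset by (simp add: sum_subtractf sum.If_cases Int_absorb1)
  finally show ?thesis by (simp add: sum_over_squares sum_distrib_left)
qed

lemma sum_eta_psi:
  assumes b: "b \<in> carrier R"
  shows "(\<Sum>s\<in>Kx. eta s * \<psi> (b \<otimes> s)) = (if b = \<zero> then 0 else gauss_sum b)"
proof (cases "b = \<zero>")
  case True
  then show ?thesis using sum_eta_mult[of "\<lambda>_. 1"] by simp
next
  case False
  have "(\<Sum>s\<in>Kx. \<psi> (b \<otimes> s)) = (\<Sum>s\<in>Kx. \<psi> (s \<otimes> b))"
    using b by (intro sum.cong refl) (simp add: m_comm)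
  moreover have "gauss_sum b = 1 + (\<Sum>a\<in>Kx. \<psi> (b \<otimes> (a \<otimes> a)))"
    unfolding gauss_sum_def using b finite_carrier by (simp add: sum.remove[of "carrier R" \<zero>])
  ultimately show ?thesis using False b by (simp add: sum_eta_mult sum_psi_Kx)
qed

lemma inv_Kx: "s \<in> Kx \<Longrightarrow> inv s \<in> Kx"
  by (metis Units_inv_Units field_Units)

text \<open>For s = t^2 substitute a -> a t. For a nonsquare s, the sets \<open>Sq\<close> and s
  \<open>Sq\<close> are disjoint and by counting exhaust \<open>Kx\<close>, so the two Gauss sums
  add up to 2 + 2 (-1) = 0, the nontrivial character summing to -1 over \<open>Kx\<close>.\<close>

lemma gauss_sum_scale:
  assumes c: "c \<in> carrier R" "c \<noteq> \<zero>" and s: "s \<in> Kx"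
  shows "gauss_sum (s \<otimes> c) = eta s * gauss_sum c"
proof (cases "s \<in> Sq")
  case True
  then obtain t where t: "t \<in> Kx" "s = t \<otimes> t" by (auto simp: Sq_def)
  have bij: "bij_betw (\<lambda>a. a \<otimes> t) (carrier R) (carrier R)"
    using t by (intro bij_betw_byWitness[where f' = "\<lambda>a. a \<otimes> inv t"]) (auto simp: m_assoc field_Units)
  have "gauss_sum c = (\<Sum>a\<in>carrier R. \<psi> (c \<otimes> ((a \<otimes> t) \<otimes> (a \<otimes> t))))"
    unfolding gauss_sum_def by (rule sum.reindex_bij_betw[OF bij, symmetric])
  also have "\<dots> = gauss_sum (s \<otimes> c)"
    unfolding gauss_sum_def using t c by (intro sum.cong refl) (simp add: m_ac)
  finally show ?thesis using True by (simp add: eta_def)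
next
  case False
  have fin: "finite Sq" using finite_Kx Sq_subset finite_subset by blast
  have inj: "inj_on (\<lambda>t. s \<otimes> t) Sq"
  proof (rule inj_onI)
    fix x y assume "x \<in> Sq" "y \<in> Sq" and eq: "s \<otimes> x = s \<otimes> y"
    then have "x \<in> carrier R" "y \<in> carrier R" using Sq_subset by auto
    then show "x = y" using eq s m_lcancel[of s x y] by simp
  qed
  have sub: "(\<lambda>t. s \<otimes> t) ` Sq \<subseteq> Kx" using s Sq_subset by (auto simp: integral_iff)
  have disj: "Sq \<inter> (\<lambda>t. s \<otimes> t) ` Sq = {}"
  proof (rule ccontr)
    assume "Sq \<inter> (\<lambda>t. s \<otimes> t) ` Sq \<noteq> {}"
    then obtain a b where ab: "a \<in> Kx" "b \<in> Kx" "b \<otimes> b = s \<otimes> (a \<otimes> a)" by (auto simp: Sq_def)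
    define a' where "a' = inv a"
    have a': "a' \<in> Kx" "a \<otimes> a' = \<one>" using inv_Kx[OF ab(1)] ab(1) by (simp_all add: a'_def field_Units)
    have car: "a \<in> carrier R" "b \<in> carrier R" "a' \<in> carrier R" "s \<in> carrier R" using ab a' s by auto
    have "(b \<otimes> a') \<otimes> (b \<otimes> a') = (b \<otimes> b) \<otimes> (a' \<otimes> a')" using car by algebra
    also have "\<dots> = s \<otimes> ((a \<otimes> a') \<otimes> (a \<otimes> a'))" unfolding ab(3) using car by algebra
    also have "\<dots> = s" using car by (simp add: a')
    finally have "s = (b \<otimes> a') \<otimes> (b \<otimes> a')" by simp
    moreover have "b \<otimes> a' \<in> Kx" using ab(2) a'(1) by (simp add: integral_iff)
    ultimately show False using False by (auto simp: Sq_def)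
  qed
  have "card (Sq \<union> (\<lambda>t. s \<otimes> t) ` Sq) = 2 * card Sq"
    using fin disj inj by (simp add: card_Un_disjoint card_image)
  also have "\<dots> = card Kx" using card_Sq finite_carrier by simp
  finally have un: "Sq \<union> (\<lambda>t. s \<otimes> t) ` Sq = Kx"
    using finite_Kx Sq_subset sub by (intro card_subset_eq) auto
  have g: "gauss_sum b = 1 + 2 * (\<Sum>t\<in>Sq. \<psi> (b \<otimes> t))" if "b \<in> carrier R" for b
  proof -
    have "gauss_sum b = 1 + (\<Sum>a\<in>Kx. \<psi> (b \<otimes> (a \<otimes> a)))"
      unfolding gauss_sum_def using that finite_carrier by (simp add: sum.remove[of "carrier R" \<zero>])
    then show ?thesis by (simp add: sum_over_squares[of "\<lambda>s. \<psi> (b \<otimes> s)"])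
  qed
  have "(\<Sum>t\<in>Sq. \<psi> (c \<otimes> t)) + (\<Sum>t\<in>Sq. \<psi> (s \<otimes> c \<otimes> t)) = (\<Sum>t\<in>Sq. \<psi> (c \<otimes> t)) + (\<Sum>t\<in>(\<lambda>t. s \<otimes> t) ` Sq. \<psi> (c \<otimes> t))"
  proof -
    have "\<psi> (s \<otimes> c \<otimes> t) = \<psi> (c \<otimes> (s \<otimes> t))" if "t \<in> Sq" for t
      using that s c Sq_subset by (auto simp: m_ac)
    then show ?thesis by (simp add: sum.reindex[OF inj])
  qed
  also have "\<dots> = (\<Sum>t\<in>Kx. \<psi> (c \<otimes> t))"
    using fin disj by (simp flip: un add: sum.union_disjoint)
  also have "\<dots> = (\<Sum>t\<in>Kx. \<psi> (t \<otimes> c))" using c by (intro sum.cong refl) (simp add: m_comm)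
  also have "\<dots> = - 1" using c by (simp add: sum_psi_Kx)
  finally have "(\<Sum>t\<in>Sq. \<psi> (s \<otimes> c \<otimes> t)) = - 1 - (\<Sum>t\<in>Sq. \<psi> (c \<otimes> t))"
    by (simp add: algebra_simps)
  then show ?thesis using False c s by (simp add: g eta_def)
qed

lemma eta_inv:
  assumes "s \<in> Kx"
  shows "eta (inv s) = eta s"
proof -
  have "inv s \<in> Sq" if s: "s \<in> Kx" "s \<in> Sq" for s
  proof -
    obtain a where a: "a \<in> Kx" "s = a \<otimes> a" using s by (auto simp: Sq_def)
    define a' where "a' = inv a"
    have a': "a' \<in> Kx" "a \<otimes> a' = \<one>" using inv_Kx[OF a(1)] a(1) by (simp_all add: a'_def field_Units)
    have car: "a \<in> carrier R" "a' \<in> carrier R" using a(1) a'(1) by simp_all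
    have "s \<otimes> (a' \<otimes> a') = (a \<otimes> a') \<otimes> (a \<otimes> a')" unfolding a(2) using car by algebra
    then have "inv s = a' \<otimes> a'" using a a' s(1) by (intro comm_inv_char) simp_all
    then show ?thesis using a'(1) by (auto simp: Sq_def)
  qed
  from this[OF assms] this[OF inv_Kx[OF assms]] assms show ?thesis
    by (auto simp: eta_def field_Units Units_inv_inv)
qed

lemma bij_betw_inv_Kx: "bij_betw (\<lambda>s. inv s) Kx Kx"
  by (rule bij_betw_byWitness[where f' = "\<lambda>s. inv s"]) (use inv_Kx in \<open>auto simp: field_Units Units_inv_inv\<close>)

lemma sum_psi_inv:
  assumes b: "b \<in> carrier R"
  shows "(\<Sum>s\<in>Kx. \<psi> (\<ominus> (inv s \<otimes> b))) = (if b = \<zero> then of_nat q else 0) - 1"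
proof -
  have "(\<Sum>s\<in>Kx. \<psi> (\<ominus> (inv s \<otimes> b))) = (\<Sum>s\<in>Kx. \<psi> (\<ominus> (s \<otimes> b)))"
    by (rule sum.reindex_bij_betw[OF bij_betw_inv_Kx])
  also have "\<dots> = (\<Sum>s\<in>Kx. \<psi> (s \<otimes> \<ominus> b))" using b by (intro sum.cong refl) (simp add: r_minus)
  finally show ?thesis using b by (simp add: sum_psi_Kx)
qed

text \<open>Inverting s turns the sum into a Gauss sum of modulus sqrt q, or into 0 when b = 0.
  Compared with the untwisted sum, which equals q - 1 at b = 0, this is the gain of odd over even
  dimension.\<close>

lemma sum_eta_psi_inv:
  assumes b: "b \<in> carrier R"
  shows "cmod (\<Sum>s\<in>Kx. \<psi> (\<ominus> (inv s \<otimes> b)) * eta s) \<le> sqrt (real q)"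
    and "b = \<zero> \<Longrightarrow> (\<Sum>s\<in>Kx. \<psi> (\<ominus> (inv s \<otimes> b)) * eta s) = 0"
proof -
  have "(\<Sum>s\<in>Kx. \<psi> (\<ominus> (inv s \<otimes> b)) * eta s) = (\<Sum>s\<in>Kx. eta (inv s) * \<psi> (\<ominus> (inv s \<otimes> b)))"
    by (intro sum.cong refl) (simp add: eta_inv)
  also have "\<dots> = (\<Sum>s\<in>Kx. eta s * \<psi> (\<ominus> (s \<otimes> b)))"
    by (rule sum.reindex_bij_betw[OF bij_betw_inv_Kx, of "\<lambda>s. eta s * \<psi> (\<ominus> (s \<otimes> b))"])
  also have "\<dots> = (\<Sum>s\<in>Kx. eta s * \<psi> (\<ominus> b \<otimes> s))"
  proof (rule sum.cong[OF refl])
    fix s assume "s \<in> Kx"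
    then have "s \<in> carrier R" by simp
    then have "\<ominus> (s \<otimes> b) = \<ominus> b \<otimes> s" using b by algebra
    then show "eta s * \<psi> (\<ominus> (s \<otimes> b)) = eta s * \<psi> (\<ominus> b \<otimes> s)" by simp
  qed
  also have "\<dots> = (if \<ominus> b = \<zero> then 0 else gauss_sum (\<ominus> b))" using b by (simp add: sum_eta_psi)
  finally have eq: "(\<Sum>s\<in>Kx. \<psi> (\<ominus> (inv s \<otimes> b)) * eta s) = (if \<ominus> b = \<zero> then 0 else gauss_sum (\<ominus> b))" .
  then show "b = \<zero> \<Longrightarrow> (\<Sum>s\<in>Kx. \<psi> (\<ominus> (inv s \<otimes> b)) * eta s) = 0" by simp
  have "cmod (gauss_sum (\<ominus> b)) = sqrt q" if "\<ominus> b \<noteq> \<zero>"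
  proof -
    have "complex_of_real ((cmod (gauss_sum (\<ominus> b)))\<^sup>2) = of_real (real q)"
      using norm_gauss_sum[OF _ that] b by (simp only: complex_norm_square) simp
    then have "(cmod (gauss_sum (\<ominus> b)))\<^sup>2 = real q" by (simp only: of_real_eq_iff)
    then show ?thesis by (simp add: real_sqrt_unique)
  qed
  then show "cmod (\<Sum>s\<in>Kx. \<psi> (\<ominus> (inv s \<otimes> b)) * eta s) \<le> sqrt (real q)" by (simp add: eq)
qed

end

section \<open>Exponential sums of quadratic forms\<close>

locale quadratic_space = R?: character_field R \<psi> + module R M
  for R (structure) and \<psi> and M (structure) +
  fixes Q :: "'c \<Rightarrow> 'a"
  assumes finite_space: "finite (carrier M)"
    and Q_closed [simp]: "x \<in> carrier M \<Longrightarrow> Q x \<in> carrier R"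
    and Q_smult: "a \<in> carrier R \<Longrightarrow> x \<in> carrier M \<Longrightarrow> Q (a \<odot>\<^bsub>M\<^esub> x) = a \<otimes>\<^bsub>R\<^esub> a \<otimes>\<^bsub>R\<^esub> Q x"
  fixes B :: "'c \<Rightarrow> 'c \<Rightarrow> 'a"
  assumes B_closed [simp]: "x \<in> carrier M \<Longrightarrow> y \<in> carrier M \<Longrightarrow> B x y \<in> carrier R"
    and Q_add: "x \<in> carrier M \<Longrightarrow> y \<in> carrier M \<Longrightarrow> Q (x \<oplus>\<^bsub>M\<^esub> y) = Q x \<oplus>\<^bsub>R\<^esub> Q y \<oplus>\<^bsub>R\<^esub> B x y"
    and B_commute: "x \<in> carrier M \<Longrightarrow> y \<in> carrier M \<Longrightarrow> B x y = B y x"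
    and B_add: "x \<in> carrier M \<Longrightarrow> x' \<in> carrier M \<Longrightarrow> y \<in> carrier M \<Longrightarrow> B (x \<oplus>\<^bsub>M\<^esub> x') y = B x y \<oplus>\<^bsub>R\<^esub> B x' y"
    and B_smult: "a \<in> carrier R \<Longrightarrow> x \<in> carrier M \<Longrightarrow> y \<in> carrier M \<Longrightarrow> B (a \<odot>\<^bsub>M\<^esub> x) y = a \<otimes>\<^bsub>R\<^esub> B x y"
    and B_nondegenerate: "x \<in> carrier M \<Longrightarrow> (\<And>y. y \<in> carrier M \<Longrightarrow> B x y = \<zero>\<^bsub>R\<^esub>) \<Longrightarrow> x = \<zero>\<^bsub>M\<^esub>"
begin

lemma B_zero [simp]: "y \<in> carrier M \<Longrightarrow> B \<zero>\<^bsub>M\<^esub> y = \<zero>\<^bsub>R\<^esub>"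
  using B_smult[of "\<zero>\<^bsub>R\<^esub>" "\<zero>\<^bsub>M\<^esub>" y] by simp

lemma B_zero_right [simp]: "y \<in> carrier M \<Longrightarrow> B y \<zero>\<^bsub>M\<^esub> = \<zero>\<^bsub>R\<^esub>"
  using B_commute[of y "\<zero>\<^bsub>M\<^esub>"] by simp

lemma Q_zero [simp]: "Q \<zero>\<^bsub>M\<^esub> = \<zero>\<^bsub>R\<^esub>"
  using Q_smult[of "\<zero>\<^bsub>R\<^esub>" "\<zero>\<^bsub>M\<^esub>"] by simp

lemma neg_eq_smult: "x \<in> carrier M \<Longrightarrow> \<ominus>\<^bsub>M\<^esub> x = (\<ominus>\<^bsub>R\<^esub> \<one>\<^bsub>R\<^esub>) \<odot>\<^bsub>M\<^esub> x"
  by (simp add: smult_l_minus)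

lemma B_neg: "x \<in> carrier M \<Longrightarrow> y \<in> carrier M \<Longrightarrow> B (\<ominus>\<^bsub>M\<^esub> x) y = \<ominus>\<^bsub>R\<^esub> B x y"
  by (simp add: neg_eq_smult B_smult R.l_minus)

lemma B_self:
  assumes x: "x \<in> carrier M"
  shows "B x x = Q x \<oplus>\<^bsub>R\<^esub> Q x"
proof -
  let ?t = "\<one>\<^bsub>R\<^esub> \<oplus>\<^bsub>R\<^esub> \<one>\<^bsub>R\<^esub>"
  have "?t \<odot>\<^bsub>M\<^esub> x = x \<oplus>\<^bsub>M\<^esub> x" using x by (simp add: smult_l_distr)
  then have "?t \<otimes>\<^bsub>R\<^esub> ?t \<otimes>\<^bsub>R\<^esub> Q x = Q x \<oplus>\<^bsub>R\<^esub> Q x \<oplus>\<^bsub>R\<^esub> B x x"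
    using Q_smult[of ?t x] Q_add[of x x] x by simp
  moreover have "?t \<otimes>\<^bsub>R\<^esub> ?t \<otimes>\<^bsub>R\<^esub> Q x = Q x \<oplus>\<^bsub>R\<^esub> Q x \<oplus>\<^bsub>R\<^esub> (Q x \<oplus>\<^bsub>R\<^esub> Q x)"
    using x by (simp add: R.l_distr R.a_assoc)
  ultimately show ?thesis using x by simp
qed

definition closed :: "'c set \<Rightarrow> bool" where
  "closed W \<longleftrightarrow> W \<subseteq> carrier M \<and> \<zero>\<^bsub>M\<^esub> \<in> W \<and> (\<forall>x\<in>W. \<forall>y\<in>W. x \<oplus>\<^bsub>M\<^esub> y \<in> W) \<and>
     (\<forall>a\<in>carrier R. \<forall>x\<in>W. a \<odot>\<^bsub>M\<^esub> x \<in> W)"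

definition form_sum :: "'c set \<Rightarrow> 'a \<Rightarrow> complex" where
  "form_sum W s = (\<Sum>x\<in>W. \<psi> (s \<otimes>\<^bsub>R\<^esub> Q x))"

text \<open>Splitting off an anisotropic line multiplies the exponential sum by a one-dimensional Gauss sum.\<close>

lemma form_sum_scale:
  assumes "closed W" "\<And>x. x \<in> W \<Longrightarrow> (\<And>y. y \<in> W \<Longrightarrow> B x y = \<zero>\<^bsub>R\<^esub>) \<Longrightarrow> x = \<zero>\<^bsub>M\<^esub>" "card W = q ^ n"
  shows "form_sum W \<one>\<^bsub>R\<^esub> * cnj (form_sum W \<one>\<^bsub>R\<^esub>) = of_nat (q ^ n) \<and>
    (\<forall>s\<in>Kx. form_sum W s = eta s ^ n * form_sum W \<one>\<^bsub>R\<^esub>)"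
  using assms
proof (induction n arbitrary: W)
  case 0
  have "\<zero>\<^bsub>M\<^esub> \<in> W" using 0(1) by (simp add: closed_def)
  moreover obtain x where "W = {x}" using 0(3) by (auto simp: card_1_singleton_iff)
  ultimately have "W = {\<zero>\<^bsub>M\<^esub>}" by simp
  then show ?case by (auto simp: form_sum_def)
next
  case (Suc n)
  note W = Suc.prems(1)
  have sub: "x \<in> carrier M" if "x \<in> W" for x using W that by (auto simp: closed_def)
  have W0: "\<zero>\<^bsub>M\<^esub> \<in> W" and Wadd: "x \<in> W \<Longrightarrow> y \<in> W \<Longrightarrow> x \<oplus>\<^bsub>M\<^esub> y \<in> W"
    and Wsm: "a \<in> carrier R \<Longrightarrow> x \<in> W \<Longrightarrow> a \<odot>\<^bsub>M\<^esub> x \<in> W" for x y a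
    using W by (auto simp: closed_def)
  \<comment> \<open>If Q vanished on W, so would B by polarisation, and nondegeneracy would force W
    = {0}, against its cardinality.\<close>
  have "\<exists>z\<in>W. Q z \<noteq> \<zero>\<^bsub>R\<^esub>"
  proof (rule ccontr)
    assume "\<not> ?thesis"
    then have z: "Q z = \<zero>\<^bsub>R\<^esub>" if "z \<in> W" for z using that by blast
    have "B x y = \<zero>\<^bsub>R\<^esub>" if xy: "x \<in> W" "y \<in> W" for x y
      using Q_add[OF sub[OF xy(1)] sub[OF xy(2)]] z[OF Wadd[OF xy]] z[OF xy(1)] z[OF xy(2)] sub[OF xy(1)] sub[OF xy(2)] by simp
    then have "W \<subseteq> {\<zero>\<^bsub>M\<^esub>}" using Suc.prems(2) by blast
    then have "card W \<le> 1" using card_mono[of "{\<zero>\<^bsub>M\<^esub>}" W] by simp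
    moreover have "q ^ Suc n > 1" using q_gt_1 by (intro one_less_power) auto
    ultimately show False using Suc.prems(3) by simp
  qed
  then obtain z where z: "z \<in> W" "Q z \<noteq> \<zero>\<^bsub>R\<^esub>" by blast
  note zM = sub[OF z(1)]
  \<comment> \<open>The orthogonal complement of z in W. Since B z z = 2 Q z is nonzero, W is the
    orthogonal direct sum of the line of z and W'.\<close>
  define W' where "W' = {x \<in> W. B x z = \<zero>\<^bsub>R\<^esub>}"
  have sub': "x \<in> W" "B x z = \<zero>\<^bsub>R\<^esub>" "x \<in> carrier M" if "x \<in> W'" for x using that sub by (auto simp: W'_def)
  have Bzz: "B z z \<in> Kx" using z zM double_neq_0[of "Q z"] by (simp add: B_self)
  then have Bunit: "inv\<^bsub>R\<^esub> (B z z) \<in> carrier R" "inv\<^bsub>R\<^esub> (B z z) \<otimes>\<^bsub>R\<^esub> B z z = \<one>\<^bsub>R\<^esub>"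
    by (simp_all add: field_Units)
  have Bcomb: "B (a \<odot>\<^bsub>M\<^esub> z \<oplus>\<^bsub>M\<^esub> w) z = a \<otimes>\<^bsub>R\<^esub> B z z" if "a \<in> carrier R" "w \<in> W'" for a w
    using that zM sub'[OF that(2)] by (simp add: B_add B_smult)
  have closed': "closed W'"
    unfolding closed_def
  proof (intro conjI ballI)
    show "W' \<subseteq> carrier M" using sub by (auto simp: W'_def)
    show "\<zero>\<^bsub>M\<^esub> \<in> W'" using W0 zM by (simp add: W'_def)
    show "x \<oplus>\<^bsub>M\<^esub> y \<in> W'" if "x \<in> W'" "y \<in> W'" for x y
      using sub'[OF that(1)] sub'[OF that(2)] zM by (simp add: W'_def Wadd B_add)
    show "a \<odot>\<^bsub>M\<^esub> x \<in> W'" if "a \<in> carrier R" "x \<in> W'" for a x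
      using sub'[OF that(2)] that(1) zM by (simp add: W'_def Wsm B_smult)
  qed
  let ?h = "\<lambda>(a, w). a \<odot>\<^bsub>M\<^esub> z \<oplus>\<^bsub>M\<^esub> w"
  have split: "\<exists>a\<in>carrier R. \<exists>w\<in>W'. x = a \<odot>\<^bsub>M\<^esub> z \<oplus>\<^bsub>M\<^esub> w" if x: "x \<in> W" for x
  proof -
    \<comment> \<open>The coefficient of the orthogonal projection of x to the line of z.\<close>
    define a where "a = B x z \<otimes>\<^bsub>R\<^esub> inv\<^bsub>R\<^esub> (B z z)"
    have a: "a \<in> carrier R" using sub[OF x] zM Bunit by (simp add: a_def)
    have aB: "a \<otimes>\<^bsub>R\<^esub> B z z = B x z" using sub[OF x] zM Bunit by (simp add: a_def R.m_assoc)
    define w where "w = (\<ominus>\<^bsub>R\<^esub> a) \<odot>\<^bsub>M\<^esub> z \<oplus>\<^bsub>M\<^esub> x"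
    have "w \<in> W" using a x z by (simp add: w_def Wadd Wsm)
    moreover have "B w z = \<zero>\<^bsub>R\<^esub>"
      using a sub[OF x] zM by (simp add: w_def B_add B_smult R.l_minus aB R.l_neg)
    ultimately have "w \<in> W'" by (simp add: W'_def)
    moreover have "x = a \<odot>\<^bsub>M\<^esub> z \<oplus>\<^bsub>M\<^esub> w"
      using a sub[OF x] zM by (simp add: w_def smult_l_minus M.r_neg2)
    ultimately show ?thesis using a by blast
  qed
  have bij: "bij_betw ?h (carrier R \<times> W') W"
  proof (rule bij_betw_imageI)
    show "inj_on ?h (carrier R \<times> W')"
    proof (rule inj_onI, clarify)
      fix a w a' w' assume a: "a \<in> carrier R" "a' \<in> carrier R" and w: "w \<in> W'" "w' \<in> W'"
        and eq: "a \<odot>\<^bsub>M\<^esub> z \<oplus>\<^bsub>M\<^esub> w = a' \<odot>\<^bsub>M\<^esub> z \<oplus>\<^bsub>M\<^esub> w'"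
      have "a \<otimes>\<^bsub>R\<^esub> B z z = a' \<otimes>\<^bsub>R\<^esub> B z z" using Bcomb[OF a(1) w(1)] Bcomb[OF a(2) w(2)] eq by simp
      then have "a = a'" using a Bzz by (simp add: R.m_rcancel)
      then show "a = a' \<and> w = w'" using eq a zM sub'[OF w(1)] sub'[OF w(2)] by simp
    qed
    show "?h ` (carrier R \<times> W') = W"
    proof
      show "?h ` (carrier R \<times> W') \<subseteq> W" using z sub' by (auto simp: Wadd Wsm)
      show "W \<subseteq> ?h ` (carrier R \<times> W')" using split by force
    qed
  qed
  have "card W = q * card W'" using bij_betw_same_card[OF bij] by (simp add: card_cartesian_product)
  then have card': "card W' = q ^ n" using Suc.prems(3) q_gt_1 by simp
  \<comment> \<open>A vector of W' orthogonal to W' is also orthogonal to z by the definition of W',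
    hence to all of W.\<close>
  have nd': "x = \<zero>\<^bsub>M\<^esub>" if x: "x \<in> W'" and 0: "\<And>y. y \<in> W' \<Longrightarrow> B x y = \<zero>\<^bsub>R\<^esub>" for x
  proof (rule Suc.prems(2))
    show "x \<in> W" using sub'[OF x] by simp
    fix y assume "y \<in> W"
    then obtain a w where aw: "a \<in> carrier R" "w \<in> W'" "y = a \<odot>\<^bsub>M\<^esub> z \<oplus>\<^bsub>M\<^esub> w" using split by blast
    have "B y x = a \<otimes>\<^bsub>R\<^esub> B z x \<oplus>\<^bsub>R\<^esub> B w x"
      using aw sub'[OF x] sub'[OF aw(2)] zM by (simp add: B_add B_smult)
    also have "\<dots> = \<zero>\<^bsub>R\<^esub>"
      using aw sub'[OF x] sub'[OF aw(2)] zM 0[OF aw(2)] B_commute[of z x] B_commute[of w x] by simp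
    finally show "B x y = \<zero>\<^bsub>R\<^esub>" using B_commute[of x y] sub'[OF x] sub[OF \<open>y \<in> W\<close>] by simp
  qed
  note IH = Suc.IH[OF closed' nd' card']
  have prod: "form_sum W s = gauss_sum (s \<otimes>\<^bsub>R\<^esub> Q z) * form_sum W' s" if s: "s \<in> carrier R" for s
  proof -
    have "form_sum W s = (\<Sum>aw\<in>carrier R \<times> W'. \<psi> (s \<otimes>\<^bsub>R\<^esub> Q (?h aw)))"
      unfolding form_sum_def by (rule sum.reindex_bij_betw[OF bij, symmetric])
    also have "\<dots> = (\<Sum>a\<in>carrier R. \<Sum>w\<in>W'. \<psi> (s \<otimes>\<^bsub>R\<^esub> Q (a \<odot>\<^bsub>M\<^esub> z \<oplus>\<^bsub>M\<^esub> w)))"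
      by (simp add: sum.cartesian_product split_def)
    also have "\<dots> = (\<Sum>a\<in>carrier R. \<Sum>w\<in>W'. \<psi> (s \<otimes>\<^bsub>R\<^esub> Q z \<otimes>\<^bsub>R\<^esub> (a \<otimes>\<^bsub>R\<^esub> a)) * \<psi> (s \<otimes>\<^bsub>R\<^esub> Q w))"
    proof (intro sum.cong refl)
      fix a w assume a: "a \<in> carrier R" and w: "w \<in> W'"
      have "B (a \<odot>\<^bsub>M\<^esub> z) w = \<zero>\<^bsub>R\<^esub>"
        using a zM sub'[OF w] B_commute[of z w] by (simp add: B_smult)
      then have "Q (a \<odot>\<^bsub>M\<^esub> z \<oplus>\<^bsub>M\<^esub> w) = a \<otimes>\<^bsub>R\<^esub> a \<otimes>\<^bsub>R\<^esub> Q z \<oplus>\<^bsub>R\<^esub> Q w"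
        using a zM sub'[OF w] by (simp add: Q_add Q_smult)
      then have "s \<otimes>\<^bsub>R\<^esub> Q (a \<odot>\<^bsub>M\<^esub> z \<oplus>\<^bsub>M\<^esub> w) = s \<otimes>\<^bsub>R\<^esub> Q z \<otimes>\<^bsub>R\<^esub> (a \<otimes>\<^bsub>R\<^esub> a) \<oplus>\<^bsub>R\<^esub> s \<otimes>\<^bsub>R\<^esub> Q w"
        using a zM sub'[OF w] s by (simp add: R.r_distr R.m_ac)
      then show "\<psi> (s \<otimes>\<^bsub>R\<^esub> Q (a \<odot>\<^bsub>M\<^esub> z \<oplus>\<^bsub>M\<^esub> w)) =
          \<psi> (s \<otimes>\<^bsub>R\<^esub> Q z \<otimes>\<^bsub>R\<^esub> (a \<otimes>\<^bsub>R\<^esub> a)) * \<psi> (s \<otimes>\<^bsub>R\<^esub> Q w)"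
        using a zM sub'[OF w] s by (simp add: psi_add)
    qed
    also have "\<dots> = gauss_sum (s \<otimes>\<^bsub>R\<^esub> Q z) * form_sum W' s"
      by (simp add: gauss_sum_def form_sum_def sum_product)
    finally show ?thesis .
  qed
  have prod1: "form_sum W \<one>\<^bsub>R\<^esub> = gauss_sum (Q z) * form_sum W' \<one>\<^bsub>R\<^esub>"
    using prod[of "\<one>\<^bsub>R\<^esub>"] zM by simp
  show ?case
  proof (intro conjI ballI)
    have "form_sum W \<one>\<^bsub>R\<^esub> * cnj (form_sum W \<one>\<^bsub>R\<^esub>) =
        (gauss_sum (Q z) * cnj (gauss_sum (Q z))) * (form_sum W' \<one>\<^bsub>R\<^esub> * cnj (form_sum W' \<one>\<^bsub>R\<^esub>))"
      by (simp add: prod1)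
    then show "form_sum W \<one>\<^bsub>R\<^esub> * cnj (form_sum W \<one>\<^bsub>R\<^esub>) = of_nat (q ^ Suc n)"
      using conjunct1[OF IH] norm_gauss_sum[of "Q z"] zM z(2) by simp
    show "form_sum W s = eta s ^ Suc n * form_sum W \<one>\<^bsub>R\<^esub>" if "s \<in> Kx" for s
    proof -
      have "form_sum W s = gauss_sum (s \<otimes>\<^bsub>R\<^esub> Q z) * form_sum W' s" using that by (intro prod) simp
      also have "gauss_sum (s \<otimes>\<^bsub>R\<^esub> Q z) = eta s * gauss_sum (Q z)" using zM z(2) that by (intro gauss_sum_scale) auto
      also have "form_sum W' s = eta s ^ n * form_sum W' \<one>\<^bsub>R\<^esub>" using conjunct2[OF IH] that by blast
      finally show ?thesis by (simp add: prod1)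
    qed
  qed
qed

end

section \<open>Fourier transform of the zero set\<close>

lemma sum_power2_cmod:
  fixes f :: "'x \<Rightarrow> complex"
  shows "complex_of_real ((cmod (\<Sum>x\<in>E. f x))\<^sup>2) = (\<Sum>x\<in>E. \<Sum>y\<in>E. f x * cnj (f y))"
  by (simp only: complex_norm_square sum_product cnj_sum)

lemma (in abelian_group) minus_eq_zero_iff:
  assumes "x \<in> carrier G" "y \<in> carrier G"
  shows "x \<ominus> y = \<zero> \<longleftrightarrow> x = y"
proof
  assume "x \<ominus> y = \<zero>"
  then have "\<ominus> (\<ominus> y) = x" using assms by (intro minus_equality) (simp_all add: minus_eq)
  then show "x = y" using assms by simp
qed (use assms in \<open>simp add: minus_eq r_neg\<close>)

context quadratic_space
begin

definition S :: "'c set" where "S = {x \<in> carrier M. Q x = \<zero>\<^bsub>R\<^esub>}"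

text \<open>Unnormalised. The form B identifies frequencies with vectors, so that Q can be evaluated
  at a frequency and S occurs on the frequency side as well.\<close>

definition ft :: "('c \<Rightarrow> complex) \<Rightarrow> 'c \<Rightarrow> complex" where
  "ft f u = (\<Sum>x\<in>carrier M. f x * \<psi> (B x u))"

definition ft_set :: "'c set \<Rightarrow> 'c \<Rightarrow> complex" where
  "ft_set E u = (\<Sum>x\<in>E. \<psi> (B x u))"

abbreviation N :: nat where "N \<equiv> card (carrier M)"

lemma S_subset: "S \<subseteq> carrier M" by (auto simp: S_def)

lemma finite_S: "finite S" using S_subset finite_space finite_subset by blast

lemma N_pos: "0 < N" using finite_space M.zero_closed by (auto simp: card_gt_0_iff)

lemma psi_B_minus:
  "x \<in> carrier M \<Longrightarrow> y \<in> carrier M \<Longrightarrow> u \<in> carrier M \<Longrightarrow>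
    \<psi> (B (x \<ominus>\<^bsub>M\<^esub> y) u) = \<psi> (B x u) * cnj (\<psi> (B y u))"
  by (simp add: M.minus_eq B_add B_neg psi_add psi_neg)

lemma sum_psi_B:
  assumes u: "u \<in> carrier M"
  shows "(\<Sum>x\<in>carrier M. \<psi> (B x u)) = (if u = \<zero>\<^bsub>M\<^esub> then of_nat N else 0)"
proof (cases "u = \<zero>\<^bsub>M\<^esub>")
  case True
  then show ?thesis by simp
next
  case False
  then obtain y where y: "y \<in> carrier M" "B u y \<noteq> \<zero>\<^bsub>R\<^esub>" using B_nondegenerate[OF u] by blast
  obtain t where t: "t \<in> carrier R" "\<psi> t \<noteq> 1" using psi_nontrivial by blast
  have Bk: "B y u \<in> Kx" using y u B_commute by simp
  \<comment> \<open>y is not orthogonal to u by nondegeneracy; this multiple of y pairs with u to t,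
    where the character differs from 1.\<close>
  let ?x = "(t \<otimes>\<^bsub>R\<^esub> inv\<^bsub>R\<^esub> (B y u)) \<odot>\<^bsub>M\<^esub> y"
  have i: "inv\<^bsub>R\<^esub> (B y u) \<in> carrier R" using inv_Kx[OF Bk] by simp
  have "B ?x u = t \<otimes>\<^bsub>R\<^esub> inv\<^bsub>R\<^esub> (B y u) \<otimes>\<^bsub>R\<^esub> B y u" using y u t i by (simp add: B_smult)
  also have "\<dots> = t" using Bk t by (simp add: R.m_assoc field_Units)
  finally have Bx: "B ?x u = t" .
  have "(\<Sum>x\<in>carrier M. \<psi> (B x u)) = 0"
  proof (rule M.sum_character_eq_0)
    show "?x \<in> carrier M" using t y i by simp
    show "\<psi> (B ?x u) \<noteq> 1" unfolding Bx by (rule t(2))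
    show "\<psi> (B (x \<oplus>\<^bsub>M\<^esub> y) u) = \<psi> (B x u) * \<psi> (B y u)" if "x \<in> carrier M" "y \<in> carrier M" for x y
      using that u by (simp add: B_add psi_add)
  qed
  then show ?thesis using False by simp
qed

lemma sum_psi_B_right:
  assumes u: "u \<in> carrier M"
  shows "(\<Sum>x\<in>carrier M. \<psi> (B u x)) = (if u = \<zero>\<^bsub>M\<^esub> then of_nat N else 0)"
proof -
  have "(\<Sum>x\<in>carrier M. \<psi> (B u x)) = (\<Sum>x\<in>carrier M. \<psi> (B x u))"
    using u by (intro sum.cong refl) (simp add: B_commute)
  then show ?thesis using sum_psi_B[OF u] by simp
qed

lemma Plancherel: "(\<Sum>u\<in>carrier M. (cmod (ft f u))\<^sup>2) = N * (\<Sum>x\<in>carrier M. (cmod (f x))\<^sup>2)"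
proof -
  have "complex_of_real (\<Sum>u\<in>carrier M. (cmod (ft f u))\<^sup>2) =
      (\<Sum>u\<in>carrier M. \<Sum>x\<in>carrier M. \<Sum>y\<in>carrier M. f x * \<psi> (B x u) * cnj (f y * \<psi> (B y u)))"
    unfolding of_real_sum ft_def sum_power2_cmod ..
  also have "\<dots> = (\<Sum>x\<in>carrier M. \<Sum>y\<in>carrier M. \<Sum>u\<in>carrier M. f x * \<psi> (B x u) * cnj (f y * \<psi> (B y u)))"
    by (subst sum.swap, rule sum.cong[OF refl], rule sum.swap)
  also have "\<dots> = (\<Sum>x\<in>carrier M. \<Sum>y\<in>carrier M. if x = y then of_nat N * (f x * cnj (f y)) else 0)"
  proof (intro sum.cong refl)
    fix x y assume xy: "x \<in> carrier M" "y \<in> carrier M"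
    have "(\<Sum>u\<in>carrier M. f x * \<psi> (B x u) * cnj (f y * \<psi> (B y u))) =
        f x * cnj (f y) * (\<Sum>u\<in>carrier M. \<psi> (B (x \<ominus>\<^bsub>M\<^esub> y) u))"
      unfolding sum_distrib_left using xy by (intro sum.cong refl) (simp add: psi_B_minus)
    also have "(\<Sum>u\<in>carrier M. \<psi> (B (x \<ominus>\<^bsub>M\<^esub> y) u)) = (if x = y then of_nat N else 0)"
      using xy by (subst sum_psi_B_right) (simp_all add: M.minus_eq_zero_iff)
    finally show "(\<Sum>u\<in>carrier M. f x * \<psi> (B x u) * cnj (f y * \<psi> (B y u))) =
        (if x = y then of_nat N * (f x * cnj (f y)) else 0)" by simp
  qed
  also have "\<dots> = (\<Sum>x\<in>carrier M. of_nat N * (f x * cnj (f x)))"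
    using finite_space by (intro sum.cong refl) simp
  also have "\<dots> = complex_of_real (N * (\<Sum>x\<in>carrier M. (cmod (f x))\<^sup>2))"
    by (simp only: of_real_mult of_real_sum complex_norm_square sum_distrib_left of_real_of_nat_eq)
  finally show ?thesis by (simp only: of_real_eq_iff)
qed

lemma ft_indicator:
  assumes "E \<subseteq> carrier M"
  shows "ft (indicator E) = ft_set E"
proof
  fix u
  show "ft (indicator E) u = ft_set E u"
    unfolding ft_def ft_set_def using assms finite_space by (intro sum.mono_neutral_cong_right) auto
qed

lemma Plancherel_set:
  assumes "E \<subseteq> carrier M"
  shows "(\<Sum>u\<in>carrier M. (cmod (ft_set E u))\<^sup>2) = N * card E"
proof -
  have "(\<Sum>x\<in>carrier M. (cmod (indicator E x))\<^sup>2) = (\<Sum>x\<in>E. 1::real)"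
    using assms finite_space by (intro sum.mono_neutral_cong_right) auto
  then show ?thesis using Plancherel[of "indicator E"] by (simp add: ft_indicator[OF assms])
qed

text \<open>Completing the square: translation by v = -u/s changes s Q(x) + B(x, u) into s Q(x) -
  Q(u)/s.\<close>

lemma sum_psi_Q_B:
  assumes s: "s \<in> Kx" and u: "u \<in> carrier M"
  shows "(\<Sum>x\<in>carrier M. \<psi> (s \<otimes>\<^bsub>R\<^esub> Q x) * \<psi> (B x u)) =
    \<psi> (\<ominus>\<^bsub>R\<^esub> (inv\<^bsub>R\<^esub> s \<otimes>\<^bsub>R\<^esub> Q u)) * form_sum (carrier M) s"
proof -
  define t where "t = inv\<^bsub>R\<^esub> s"
  have t: "t \<in> carrier R" "s \<otimes>\<^bsub>R\<^esub> t = \<one>\<^bsub>R\<^esub>" and sR: "s \<in> carrier R"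
    using s inv_Kx[OF s] by (simp_all add: t_def field_Units)
  define v where "v = (\<ominus>\<^bsub>R\<^esub> t) \<odot>\<^bsub>M\<^esub> u"
  have v: "v \<in> carrier M" using t u by (simp add: v_def)
  have "(\<Sum>x\<in>carrier M. \<psi> (s \<otimes>\<^bsub>R\<^esub> Q x) * \<psi> (B x u)) =
      (\<Sum>x\<in>carrier M. \<psi> (s \<otimes>\<^bsub>R\<^esub> Q (x \<oplus>\<^bsub>M\<^esub> v)) * \<psi> (B (x \<oplus>\<^bsub>M\<^esub> v) u))"
    by (rule M.sum_translate[OF v, of "\<lambda>x. \<psi> (s \<otimes>\<^bsub>R\<^esub> Q x) * \<psi> (B x u)", symmetric])
  also have "\<dots> = (\<Sum>x\<in>carrier M. \<psi> (\<ominus>\<^bsub>R\<^esub> (t \<otimes>\<^bsub>R\<^esub> Q u)) * \<psi> (s \<otimes>\<^bsub>R\<^esub> Q x))"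
  proof (rule sum.cong[OF refl])
    fix x assume x: "x \<in> carrier M"
    have c: "Q x \<in> carrier R" "Q u \<in> carrier R" "B x u \<in> carrier R" using x u by simp_all
    have Qv: "Q v = t \<otimes>\<^bsub>R\<^esub> t \<otimes>\<^bsub>R\<^esub> Q u"
      unfolding v_def using t u by (subst Q_smult) (simp_all add: R.l_minus R.r_minus)
    have Bxv: "B x v = \<ominus>\<^bsub>R\<^esub> t \<otimes>\<^bsub>R\<^esub> B x u"
      using x u t v B_commute[of x v] B_commute[of x u] by (simp add: v_def B_smult)
    have Bvu: "B v u = \<ominus>\<^bsub>R\<^esub> t \<otimes>\<^bsub>R\<^esub> (Q u \<oplus>\<^bsub>R\<^esub> Q u)"
      using u t by (simp add: v_def B_smult B_self)
    have "s \<otimes>\<^bsub>R\<^esub> Q (x \<oplus>\<^bsub>M\<^esub> v) =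
        s \<otimes>\<^bsub>R\<^esub> Q x \<oplus>\<^bsub>R\<^esub> (s \<otimes>\<^bsub>R\<^esub> t) \<otimes>\<^bsub>R\<^esub> (t \<otimes>\<^bsub>R\<^esub> Q u) \<oplus>\<^bsub>R\<^esub> \<ominus>\<^bsub>R\<^esub> ((s \<otimes>\<^bsub>R\<^esub> t) \<otimes>\<^bsub>R\<^esub> B x u)"
      unfolding Q_add[OF x v] Qv Bxv using c t(1) sR by (simp add: R.r_distr R.m_assoc R.r_minus R.l_minus R.minus_eq)
    then have 1: "s \<otimes>\<^bsub>R\<^esub> Q (x \<oplus>\<^bsub>M\<^esub> v) = s \<otimes>\<^bsub>R\<^esub> Q x \<oplus>\<^bsub>R\<^esub> t \<otimes>\<^bsub>R\<^esub> Q u \<oplus>\<^bsub>R\<^esub> \<ominus>\<^bsub>R\<^esub> B x u"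
      using c t by simp
    have 2: "B (x \<oplus>\<^bsub>M\<^esub> v) u = B x u \<oplus>\<^bsub>R\<^esub> \<ominus>\<^bsub>R\<^esub> (t \<otimes>\<^bsub>R\<^esub> Q u) \<oplus>\<^bsub>R\<^esub> \<ominus>\<^bsub>R\<^esub> (t \<otimes>\<^bsub>R\<^esub> Q u)"
      unfolding B_add[OF x v u] Bvu using c t(1) by (simp add: R.r_distr R.l_minus R.a_assoc)
    have nz: "\<psi> (B x u) * cnj (\<psi> (B x u)) = 1" "\<psi> (t \<otimes>\<^bsub>R\<^esub> Q u) * cnj (\<psi> (t \<otimes>\<^bsub>R\<^esub> Q u)) = 1"
      using c t by (simp_all add: psi_mult_cnj)
    have "\<psi> (s \<otimes>\<^bsub>R\<^esub> Q (x \<oplus>\<^bsub>M\<^esub> v)) * \<psi> (B (x \<oplus>\<^bsub>M\<^esub> v) u) =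
        (\<psi> (B x u) * cnj (\<psi> (B x u))) * (\<psi> (t \<otimes>\<^bsub>R\<^esub> Q u) * cnj (\<psi> (t \<otimes>\<^bsub>R\<^esub> Q u))) *
          (cnj (\<psi> (t \<otimes>\<^bsub>R\<^esub> Q u)) * \<psi> (s \<otimes>\<^bsub>R\<^esub> Q x))"
      unfolding 1 2 using c t(1) sR by (simp add: psi_add psi_neg mult_ac)
    then show "\<psi> (s \<otimes>\<^bsub>R\<^esub> Q (x \<oplus>\<^bsub>M\<^esub> v)) * \<psi> (B (x \<oplus>\<^bsub>M\<^esub> v) u) =
        \<psi> (\<ominus>\<^bsub>R\<^esub> (t \<otimes>\<^bsub>R\<^esub> Q u)) * \<psi> (s \<otimes>\<^bsub>R\<^esub> Q x)"
      unfolding nz using c t(1) by (simp add: psi_neg)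
  qed
  finally show ?thesis by (simp add: form_sum_def t_def sum_distrib_left)
qed

text \<open>The condition Q x = 0 is detected by summing \<psi>(s Q x) over all s. The term s = 0
  gives the point mass at frequency 0, the others are completed to squares.\<close>

lemma ft_S:
  assumes u: "u \<in> carrier M"
  shows "of_nat q * ft_set S u = (if u = \<zero>\<^bsub>M\<^esub> then of_nat N else 0) +
    (\<Sum>s\<in>Kx. \<psi> (\<ominus>\<^bsub>R\<^esub> (inv\<^bsub>R\<^esub> s \<otimes>\<^bsub>R\<^esub> Q u)) * form_sum (carrier M) s)"
proof -
  have "of_nat q * ft_set S u = (\<Sum>x\<in>carrier M. (if Q x = \<zero>\<^bsub>R\<^esub> then of_nat q else 0) * \<psi> (B x u))"
    unfolding ft_set_def sum_distrib_left S_def using finite_space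
    by (intro sum.mono_neutral_cong_left) auto
  also have "\<dots> = (\<Sum>x\<in>carrier M. \<Sum>s\<in>carrier R. \<psi> (s \<otimes>\<^bsub>R\<^esub> Q x) * \<psi> (B x u))"
    by (intro sum.cong refl) (simp add: sum_psi flip: sum_distrib_right)
  also have "\<dots> = (\<Sum>s\<in>carrier R. \<Sum>x\<in>carrier M. \<psi> (s \<otimes>\<^bsub>R\<^esub> Q x) * \<psi> (B x u))"
    by (rule sum.swap)
  also have "\<dots> = (\<Sum>x\<in>carrier M. \<psi> (\<zero>\<^bsub>R\<^esub> \<otimes>\<^bsub>R\<^esub> Q x) * \<psi> (B x u)) +
      (\<Sum>s\<in>Kx. \<Sum>x\<in>carrier M. \<psi> (s \<otimes>\<^bsub>R\<^esub> Q x) * \<psi> (B x u))"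
    by (rule sum.remove) (simp_all add: finite_carrier)
  also have "(\<Sum>x\<in>carrier M. \<psi> (\<zero>\<^bsub>R\<^esub> \<otimes>\<^bsub>R\<^esub> Q x) * \<psi> (B x u)) = (\<Sum>x\<in>carrier M. \<psi> (B x u))"
    by (intro sum.cong refl) simp
  also have "\<dots> = (if u = \<zero>\<^bsub>M\<^esub> then of_nat N else 0)" by (rule sum_psi_B[OF u])
  also have "(\<Sum>s\<in>Kx. \<Sum>x\<in>carrier M. \<psi> (s \<otimes>\<^bsub>R\<^esub> Q x) * \<psi> (B x u)) =
      (\<Sum>s\<in>Kx. \<psi> (\<ominus>\<^bsub>R\<^esub> (inv\<^bsub>R\<^esub> s \<otimes>\<^bsub>R\<^esub> Q u)) * form_sum (carrier M) s)"
    by (intro sum.cong refl sum_psi_Q_B u)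
  finally show ?thesis .
qed

definition hits :: "'c set \<Rightarrow> 'c \<Rightarrow> nat" where
  "hits E y = card {x \<in> S. y \<ominus>\<^bsub>M\<^esub> x \<in> E}"

definition discrepancy :: "'c set \<Rightarrow> 'c \<Rightarrow> real" where
  "discrepancy E y = real (hits E y) - real (card S) * real (card E) / real N"

lemma ft_hits:
  assumes E: "E \<subseteq> carrier M" and u: "u \<in> carrier M"
  shows "ft (\<lambda>y. of_nat (hits E y)) u = ft_set S u * ft_set E u"
proof -
  have "ft (\<lambda>y. of_nat (hits E y)) u = (\<Sum>y\<in>carrier M. \<Sum>x\<in>S. indicator E (y \<ominus>\<^bsub>M\<^esub> x) * \<psi> (B y u))"
    unfolding ft_def
  proof (rule sum.cong[OF refl])
    fix y
    have "(\<Sum>x\<in>S. indicator E (y \<ominus>\<^bsub>M\<^esub> x)) = (\<Sum>x\<in>{x\<in>S. y \<ominus>\<^bsub>M\<^esub> x \<in> E}. 1::complex)"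
      using finite_S by (intro sum.mono_neutral_cong_right) auto
    then show "of_nat (hits E y) * \<psi> (B y u) = (\<Sum>x\<in>S. indicator E (y \<ominus>\<^bsub>M\<^esub> x) * \<psi> (B y u))"
      by (simp add: hits_def flip: sum_distrib_right)
  qed
  also have "\<dots> = (\<Sum>x\<in>S. \<Sum>y\<in>carrier M. indicator E (y \<ominus>\<^bsub>M\<^esub> x) * \<psi> (B y u))" by (rule sum.swap)
  also have "\<dots> = (\<Sum>x\<in>S. \<Sum>z\<in>carrier M. \<psi> (B x u) * (indicator E z * \<psi> (B z u)))"
  proof (rule sum.cong[OF refl])
    fix x assume "x \<in> S"
    then have x: "x \<in> carrier M" using S_subset by blast
    have "(\<Sum>y\<in>carrier M. indicator E (y \<ominus>\<^bsub>M\<^esub> x) * \<psi> (B y u)) =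
        (\<Sum>z\<in>carrier M. indicator E (z \<oplus>\<^bsub>M\<^esub> x \<ominus>\<^bsub>M\<^esub> x) * \<psi> (B (z \<oplus>\<^bsub>M\<^esub> x) u))"
      by (rule M.sum_translate[OF x, of "\<lambda>y. indicator E (y \<ominus>\<^bsub>M\<^esub> x) * \<psi> (B y u)", symmetric])
    also have "\<dots> = (\<Sum>z\<in>carrier M. \<psi> (B x u) * (indicator E z * \<psi> (B z u)))"
      using x u by (intro sum.cong refl) (simp add: M.minus_eq M.a_assoc M.r_neg B_add psi_add)
    finally show "(\<Sum>y\<in>carrier M. indicator E (y \<ominus>\<^bsub>M\<^esub> x) * \<psi> (B y u)) =
        (\<Sum>z\<in>carrier M. \<psi> (B x u) * (indicator E z * \<psi> (B z u)))" .
  qed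
  also have "\<dots> = ft_set S u * ft (indicator E) u"
    by (simp add: ft_set_def ft_def sum_product)
  finally show ?thesis by (simp add: ft_indicator[OF E])
qed

text \<open>\<open>hits\<close> is the convolution of the indicators of S and E, so its transform is
  a product; subtracting the expected value removes exactly the zero frequency. Plancherel does the
  rest.\<close>

lemma sum_discrepancy:
  assumes E: "E \<subseteq> carrier M"
  shows "N * (\<Sum>y\<in>carrier M. (discrepancy E y)\<^sup>2) =
    (\<Sum>u\<in>carrier M - {\<zero>\<^bsub>M\<^esub>}. (cmod (ft_set S u))\<^sup>2 * (cmod (ft_set E u))\<^sup>2)"
proof -
  have finE: "finite E" using E finite_space finite_subset by blast
  let ?c = "complex_of_real (real (card S) * real (card E) / real N)"
  have ft: "ft (\<lambda>y. of_real (discrepancy E y)) u = (if u = \<zero>\<^bsub>M\<^esub> then 0 else ft_set S u * ft_set E u)"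
    if u: "u \<in> carrier M" for u
  proof -
    have "ft (\<lambda>y. of_real (discrepancy E y)) u = ft (\<lambda>y. of_nat (hits E y)) u - ?c * (\<Sum>x\<in>carrier M. \<psi> (B x u))"
      by (simp add: ft_def discrepancy_def left_diff_distrib sum_subtractf sum_distrib_left)
    also have "\<dots> = ft_set S u * ft_set E u - ?c * (if u = \<zero>\<^bsub>M\<^esub> then of_nat N else 0)"
      unfolding ft_hits[OF E u] sum_psi_B[OF u] ..
    also have "\<dots> = (if u = \<zero>\<^bsub>M\<^esub> then 0 else ft_set S u * ft_set E u)"
    proof -
      have "ft_set W \<zero>\<^bsub>M\<^esub> = of_nat (card W)" if "W \<subseteq> carrier M" for W
        unfolding ft_set_def using that by (subst sum.cong[OF refl, of _ _ "\<lambda>_. 1"]) auto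
      then show ?thesis using E S_subset N_pos by simp
    qed
    finally show ?thesis .
  qed
  have "N * (\<Sum>y\<in>carrier M. (discrepancy E y)\<^sup>2) = (\<Sum>u\<in>carrier M. (cmod (ft (\<lambda>y. of_real (discrepancy E y)) u))\<^sup>2)"
    by (simp add: Plancherel)
  also have "\<dots> = (\<Sum>u\<in>carrier M. if u = \<zero>\<^bsub>M\<^esub> then 0 else (cmod (ft_set S u))\<^sup>2 * (cmod (ft_set E u))\<^sup>2)"
    by (intro sum.cong refl) (simp add: ft norm_mult power_mult_distrib)
  also have "\<dots> = (\<Sum>u\<in>carrier M - {\<zero>\<^bsub>M\<^esub>}. (cmod (ft_set S u))\<^sup>2 * (cmod (ft_set E u))\<^sup>2)"
    using finite_space by (intro sum.mono_neutral_cong_right) auto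
  finally show ?thesis .
qed

lemma sum_discrepancy_le:
  assumes E: "E \<subseteq> carrier M" and C: "\<And>u. u \<in> carrier M \<Longrightarrow> u \<noteq> \<zero>\<^bsub>M\<^esub> \<Longrightarrow> (cmod (ft_set S u))\<^sup>2 \<le> C"
    and "0 \<le> C"
  shows "(\<Sum>y\<in>carrier M. (discrepancy E y)\<^sup>2) \<le> C * card E"
proof -
  have "N * (\<Sum>y\<in>carrier M. (discrepancy E y)\<^sup>2) \<le> (\<Sum>u\<in>carrier M - {\<zero>\<^bsub>M\<^esub>}. C * (cmod (ft_set E u))\<^sup>2)"
    unfolding sum_discrepancy[OF E] by (intro sum_mono mult_right_mono C) auto
  also have "\<dots> \<le> (\<Sum>u\<in>carrier M. C * (cmod (ft_set E u))\<^sup>2)"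
    using finite_space \<open>0 \<le> C\<close> by (intro sum_mono2) auto
  also have "\<dots> = N * (C * card E)" using Plancherel_set[OF E] by (simp flip: sum_distrib_left)
  finally show ?thesis using N_pos by simp
qed

end

section \<open>Sizes of the transform of S and of the discrepancy, by parity of the
  dimension\<close>

locale quadratic_space_dim = quadratic_space +
  fixes d :: nat
  assumes card_space: "card (carrier M) = q ^ d" and d_ge_3: "3 \<le> d"
begin

abbreviation G1 :: complex where "G1 \<equiv> form_sum (carrier M) \<one>\<^bsub>R\<^esub>"

lemma form_sum_facts:
  shows norm_G1: "cmod G1 = sqrt (real q ^ d)"
    and form_sum_eta: "s \<in> Kx \<Longrightarrow> form_sum (carrier M) s = eta s ^ d * G1"
proof -
  have "closed (carrier M)" by (auto simp: closed_def)
  then have *: "G1 * cnj G1 = of_nat (q ^ d) \<and> (\<forall>s\<in>Kx. form_sum (carrier M) s = eta s ^ d * G1)"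
    using B_nondegenerate card_space by (intro form_sum_scale) auto
  then show "s \<in> Kx \<Longrightarrow> form_sum (carrier M) s = eta s ^ d * G1" by blast
  have "complex_of_real ((cmod G1)\<^sup>2) = of_real (real q ^ d)"
    using conjunct1[OF *] by (simp only: complex_norm_square) simp
  then have "(cmod G1)\<^sup>2 = real q ^ d" by (simp only: of_real_eq_iff)
  then show "cmod G1 = sqrt (real q ^ d)" by (simp add: real_sqrt_unique)
qed

lemma eta_power_even: "even n \<Longrightarrow> eta s ^ n = 1"
  by (auto simp: eta_def)

lemma eta_power_odd: "odd n \<Longrightarrow> eta s ^ n = eta s"
  by (auto simp: eta_def)

text \<open>An even power of \<open>eta\<close> is 1, so the sum over s is untwisted: it is q - 1
  where Q u = 0 and -1 elsewhere. This makes the transform of S large on S.\<close>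

lemma ft_S_even:
  assumes "even d" "u \<in> carrier M"
  shows "of_nat q * ft_set S u = (if u = \<zero>\<^bsub>M\<^esub> then of_nat N else 0) +
    ((if Q u = \<zero>\<^bsub>R\<^esub> then of_nat q else 0) - 1) * G1"
proof -
  have "(\<Sum>s\<in>Kx. \<psi> (\<ominus>\<^bsub>R\<^esub> (inv\<^bsub>R\<^esub> s \<otimes>\<^bsub>R\<^esub> Q u)) * form_sum (carrier M) s) =
      (\<Sum>s\<in>Kx. \<psi> (\<ominus>\<^bsub>R\<^esub> (inv\<^bsub>R\<^esub> s \<otimes>\<^bsub>R\<^esub> Q u))) * G1"
    unfolding sum_distrib_right
  proof (rule sum.cong[OF refl])
    fix s assume "s \<in> Kx"
    from form_sum_eta[OF this] assms
    show "\<psi> (\<ominus>\<^bsub>R\<^esub> (inv\<^bsub>R\<^esub> s \<otimes>\<^bsub>R\<^esub> Q u)) * form_sum (carrier M) s = \<psi> (\<ominus>\<^bsub>R\<^esub> (inv\<^bsub>R\<^esub> s \<otimes>\<^bsub>R\<^esub> Q u)) * G1"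
      by (simp add: eta_power_even)
  qed
  then show ?thesis using ft_S[OF assms(2)] assms(2) by (simp add: sum_psi_inv)
qed

text \<open>An odd power of \<open>eta\<close> is \<open>eta\<close>, so the sum over s stays
  twisted and has modulus at most sqrt q at every frequency.\<close>

lemma ft_S_odd:
  assumes "odd d" "u \<in> carrier M"
  shows "of_nat q * ft_set S u = (if u = \<zero>\<^bsub>M\<^esub> then of_nat N else 0) +
    (\<Sum>s\<in>Kx. \<psi> (\<ominus>\<^bsub>R\<^esub> (inv\<^bsub>R\<^esub> s \<otimes>\<^bsub>R\<^esub> Q u)) * eta s) * G1"
proof -
  have "(\<Sum>s\<in>Kx. \<psi> (\<ominus>\<^bsub>R\<^esub> (inv\<^bsub>R\<^esub> s \<otimes>\<^bsub>R\<^esub> Q u)) * form_sum (carrier M) s) =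
      (\<Sum>s\<in>Kx. \<psi> (\<ominus>\<^bsub>R\<^esub> (inv\<^bsub>R\<^esub> s \<otimes>\<^bsub>R\<^esub> Q u)) * eta s) * G1"
    unfolding sum_distrib_right
  proof (rule sum.cong[OF refl])
    fix s assume "s \<in> Kx"
    from form_sum_eta[OF this] assms
    show "\<psi> (\<ominus>\<^bsub>R\<^esub> (inv\<^bsub>R\<^esub> s \<otimes>\<^bsub>R\<^esub> Q u)) * form_sum (carrier M) s = \<psi> (\<ominus>\<^bsub>R\<^esub> (inv\<^bsub>R\<^esub> s \<otimes>\<^bsub>R\<^esub> Q u)) * eta s * G1"
      by (simp add: eta_power_odd)
  qed
  then show ?thesis using ft_S[OF assms(2)] by simp
qed

lemma card_S_eq: "ft_set S \<zero>\<^bsub>M\<^esub> = of_nat (card S)"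
  unfolding ft_set_def using S_subset by (subst sum.cong[OF refl, of _ _ "\<lambda>_. 1"]) auto

text \<open>The transform at frequency 0 counts S. For even d the error term is (q - 1) q^(d/2) / q;
  for odd d it vanishes, since \<open>eta\<close> sums to 0 over \<open>Kx\<close>.\<close>

lemma card_S_near: "\<bar>real (card S) - real q ^ (d - 1)\<bar> \<le> sqrt (real q ^ d)"
proof -
  have qd: "real q ^ d = real q * real q ^ (d - 1)" using d_ge_3 by (cases d) auto
  have "cmod (of_nat q * ft_set S \<zero>\<^bsub>M\<^esub> - of_nat N) \<le> real q * sqrt (real q ^ d)"
  proof (cases "even d")
    case True
    have "cmod (of_nat q * ft_set S \<zero>\<^bsub>M\<^esub> - of_nat N) = cmod ((of_nat q - 1) * G1)"
      using ft_S_even[OF True, of "\<zero>\<^bsub>M\<^esub>"] by simp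
    also have "\<dots> = cmod (complex_of_real (real q - 1)) * sqrt (real q ^ d)"
      unfolding norm_mult norm_G1 by simp
    also have "\<dots> \<le> real q * sqrt (real q ^ d)"
      using q_gt_1 by (intro mult_right_mono) (auto simp del: of_real_diff)
    finally show ?thesis .
  next
    case False
    then show ?thesis using ft_S_odd[OF False, of "\<zero>\<^bsub>M\<^esub>"] sum_eta_psi_inv(2)[of "\<zero>\<^bsub>R\<^esub>"] by simp
  qed
  also have "of_nat q * ft_set S \<zero>\<^bsub>M\<^esub> - of_nat N = complex_of_real (real q * (real (card S) - real q ^ (d - 1)))"
  proof -
    have "(of_nat q :: complex) ^ d = of_nat q * of_nat q ^ (d - 1)" using d_ge_3 by (cases d) auto
    then show ?thesis by (simp add: card_S_eq card_space right_diff_distrib)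
  qed
  finally have "real q * \<bar>real (card S) - real q ^ (d - 1)\<bar> \<le> real q * sqrt (real q ^ d)"
    by (simp add: abs_mult norm_of_real del: of_real_diff of_real_mult)
  then show ?thesis using q_gt_1 by simp
qed

text \<open>The moduli multiply to sqrt q q^(d/2), and division by q leaves q^((d-1)/2).\<close>

lemma ft_S_le_odd:
  assumes "odd d" "u \<in> carrier M" "u \<noteq> \<zero>\<^bsub>M\<^esub>"
  shows "(cmod (ft_set S u))\<^sup>2 \<le> real q ^ (d - 1)"
proof -
  have qd: "real q ^ d = real q * real q ^ (d - 1)" using d_ge_3 by (cases d) auto
  have "real q * cmod (ft_set S u) = cmod (of_nat q * ft_set S u)" by (simp add: norm_mult)
  also have "\<dots> = cmod (\<Sum>s\<in>Kx. \<psi> (\<ominus>\<^bsub>R\<^esub> (inv\<^bsub>R\<^esub> s \<otimes>\<^bsub>R\<^esub> Q u)) * eta s) * cmod G1"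
    unfolding ft_S_odd[OF assms(1,2)] using assms(3) by (simp add: norm_mult)
  also have "\<dots> \<le> sqrt (real q) * sqrt (real q ^ d)"
    unfolding norm_G1 using assms(2) by (intro mult_right_mono sum_eta_psi_inv(1)) simp_all
  also have "\<dots> = real q * sqrt (real q ^ (d - 1))" by (simp add: qd real_sqrt_mult)
  finally have "cmod (ft_set S u) \<le> sqrt (real q ^ (d - 1))" using q_gt_1 by simp
  then have "(cmod (ft_set S u))\<^sup>2 \<le> (sqrt (real q ^ (d - 1)))\<^sup>2" by (intro power_mono) auto
  then show ?thesis by simp
qed

text \<open>The factor in front of \<open>G1\<close> has modulus q - 1 on S and 1 off S. The two
  resulting sizes differ by a factor of about q, the obstacle special to even d.\<close>

lemma ft_S_le_even:
  assumes "even d" "u \<in> carrier M" "u \<noteq> \<zero>\<^bsub>M\<^esub>"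
  shows "(cmod (ft_set S u))\<^sup>2 \<le> real q ^ d"
    and "u \<notin> S \<Longrightarrow> (cmod (ft_set S u))\<^sup>2 \<le> real q ^ (d - 2)"
proof -
  have "real q * cmod (ft_set S u) = cmod (of_nat q * ft_set S u)" by (simp add: norm_mult)
  also have "\<dots> = cmod ((if Q u = \<zero>\<^bsub>R\<^esub> then of_nat q else 0) - 1) * cmod G1"
    unfolding ft_S_even[OF assms(1,2)] using assms(3) by (simp add: norm_mult)
  finally have eq: "real q * cmod (ft_set S u) = cmod ((if Q u = \<zero>\<^bsub>R\<^esub> then of_nat q else 0) - 1) * sqrt (real q ^ d)"
    by (simp only: norm_G1)
  have "cmod ((if Q u = \<zero>\<^bsub>R\<^esub> then of_nat q else 0) - 1) \<le> real q"
    using q_gt_1 norm_of_real[of "real q - 1", where 'a=complex] by auto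
  then have "real q * cmod (ft_set S u) \<le> real q * sqrt (real q ^ d)"
    unfolding eq by (intro mult_right_mono) auto
  then have "cmod (ft_set S u) \<le> sqrt (real q ^ d)" using q_gt_1 by simp
  then have "(cmod (ft_set S u))\<^sup>2 \<le> (sqrt (real q ^ d))\<^sup>2" by (intro power_mono) auto
  then show "(cmod (ft_set S u))\<^sup>2 \<le> real q ^ d" by simp
  assume "u \<notin> S"
  then have "Q u \<noteq> \<zero>\<^bsub>R\<^esub>" using assms by (simp add: S_def)
  then have "(real q * cmod (ft_set S u))\<^sup>2 = real q ^ d" by (simp add: eq)
  also have "\<dots> = (real q)\<^sup>2 * real q ^ (d - 2)"
  proof -
    have "2 + (d - 2) = d" using d_ge_3 by simp
    then show ?thesis using power_add[of "real q" 2 "d - 2"] by (simp only:)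
  qed
  finally show "(cmod (ft_set S u))\<^sup>2 \<le> real q ^ (d - 2)" using q_gt_1 by (simp add: power_mult_distrib)
qed

lemma discrepancy_odd:
  assumes "odd d" "E \<subseteq> carrier M"
  shows "(\<Sum>y\<in>carrier M. (discrepancy E y)\<^sup>2) \<le> real q ^ (d - 1) * card E"
  using assms ft_S_le_odd by (intro sum_discrepancy_le) auto

lemma discrepancy_even:
  assumes "even d" "E \<subseteq> carrier M"
  shows "(\<Sum>y\<in>carrier M. (discrepancy E y)\<^sup>2) \<le> real q ^ d * card E"
  using assms ft_S_le_even by (intro sum_discrepancy_le) auto

text \<open>For small \<open>E\<close> the transform of \<open>E\<close> has little mass on \<open>S\<close>, where the transform of \<open>S\<close> is large.\<close>

lemma ft_set_mass_on_S:
  assumes "even d" and E: "E \<subseteq> carrier M"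
  shows "(\<Sum>u\<in>S. (cmod (ft_set E u))\<^sup>2) \<le> real (card S) * card E + sqrt (real q ^ d) * (real (card E))\<^sup>2"
proof -
  have finE: "finite E" using E finite_space finite_subset by blast
  have "complex_of_real (\<Sum>u\<in>S. (cmod (ft_set E u))\<^sup>2) =
      (\<Sum>u\<in>S. \<Sum>x\<in>E. \<Sum>y\<in>E. \<psi> (B x u) * cnj (\<psi> (B y u)))"
    unfolding of_real_sum ft_set_def sum_power2_cmod ..
  also have "\<dots> = (\<Sum>x\<in>E. \<Sum>y\<in>E. \<Sum>u\<in>S. \<psi> (B x u) * cnj (\<psi> (B y u)))"
    by (subst sum.swap, rule sum.cong[OF refl], rule sum.swap)
  \<comment> \<open>S now plays the role of the summation domain, so the inner sum is the transform
    of S at x - y: card S on the diagonal and at most q^(d/2) off it.\<close>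
  also have "\<dots> = (\<Sum>x\<in>E. \<Sum>y\<in>E. ft_set S (x \<ominus>\<^bsub>M\<^esub> y))"
  proof (intro sum.cong refl)
    fix x y assume "x \<in> E" "y \<in> E"
    then have xy: "x \<in> carrier M" "y \<in> carrier M" using E by auto
    have "\<psi> (B x u) * cnj (\<psi> (B y u)) = \<psi> (B u (x \<ominus>\<^bsub>M\<^esub> y))" if "u \<in> S" for u
      using xy that S_subset B_commute[of u "x \<ominus>\<^bsub>M\<^esub> y"] by (auto simp: psi_B_minus)
    then show "(\<Sum>u\<in>S. \<psi> (B x u) * cnj (\<psi> (B y u))) = ft_set S (x \<ominus>\<^bsub>M\<^esub> y)"
      by (simp add: ft_set_def)
  qed
  finally have eq: "complex_of_real (\<Sum>u\<in>S. (cmod (ft_set E u))\<^sup>2) = (\<Sum>x\<in>E. \<Sum>y\<in>E. ft_set S (x \<ominus>\<^bsub>M\<^esub> y))" .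
  have "(\<Sum>u\<in>S. (cmod (ft_set E u))\<^sup>2) = cmod (complex_of_real (\<Sum>u\<in>S. (cmod (ft_set E u))\<^sup>2))"
    unfolding norm_of_real by (simp add: sum_nonneg)
  also have "\<dots> = cmod (\<Sum>x\<in>E. \<Sum>y\<in>E. ft_set S (x \<ominus>\<^bsub>M\<^esub> y))" unfolding eq ..
  also have "\<dots> \<le> (\<Sum>x\<in>E. \<Sum>y\<in>E. cmod (ft_set S (x \<ominus>\<^bsub>M\<^esub> y)))"
    by (rule order_trans[OF norm_sum sum_mono[OF norm_sum]])
  also have "\<dots> \<le> (\<Sum>x\<in>E. \<Sum>y\<in>E. (if x = y then real (card S) else 0) + sqrt (real q ^ d))"
  proof (intro sum_mono)
    fix x y assume "x \<in> E" "y \<in> E"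
    then have xy: "x \<in> carrier M" "y \<in> carrier M" using E by auto
    show "cmod (ft_set S (x \<ominus>\<^bsub>M\<^esub> y)) \<le> (if x = y then real (card S) else 0) + sqrt (real q ^ d)"
    proof (cases "x = y")
      case True
      then show ?thesis using xy by (simp add: M.minus_eq_zero_iff[THEN iffD2] card_S_eq)
    next
      case False
      then have "x \<ominus>\<^bsub>M\<^esub> y \<noteq> \<zero>\<^bsub>M\<^esub>" using xy by (simp add: M.minus_eq_zero_iff)
      then have "(cmod (ft_set S (x \<ominus>\<^bsub>M\<^esub> y)))\<^sup>2 \<le> real q ^ d" using xy assms by (intro ft_S_le_even) auto
      then show ?thesis using False by (auto intro: real_le_rsqrt)
    qed
  qed
  also have "\<dots> = real (card S) * card E + sqrt (real q ^ d) * (real (card E))\<^sup>2"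
    using finE by (simp add: sum.distrib power2_eq_square algebra_simps)
  finally show ?thesis .
qed

text \<open>On S the factor q^d multiplies only the mass of the transform of E on S, and q^d = N
  cancels the N of Plancherel. Off S the small factor q^(d-2) multiplies the whole mass N card
  E.\<close>

lemma discrepancy_even_small:
  assumes "even d" and E: "E \<subseteq> carrier M"
  shows "(\<Sum>y\<in>carrier M. (discrepancy E y)\<^sup>2) \<le>
    real (card S) * card E + sqrt (real q ^ d) * (real (card E))\<^sup>2 + real q ^ (d - 2) * card E"
proof -
  let ?e = "\<lambda>u. (cmod (ft_set E u))\<^sup>2"
  have "N * (\<Sum>y\<in>carrier M. (discrepancy E y)\<^sup>2) \<le>
      (\<Sum>u\<in>carrier M - {\<zero>\<^bsub>M\<^esub>}. (if u \<in> S then real q ^ d * ?e u else 0) + real q ^ (d - 2) * ?e u)"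
    unfolding sum_discrepancy[OF E]
  proof (rule sum_mono)
    fix u assume u: "u \<in> carrier M - {\<zero>\<^bsub>M\<^esub>}"
    show "(cmod (ft_set S u))\<^sup>2 * ?e u \<le> (if u \<in> S then real q ^ d * ?e u else 0) + real q ^ (d - 2) * ?e u"
    proof (cases "u \<in> S")
      case True
      have "(cmod (ft_set S u))\<^sup>2 * ?e u \<le> real q ^ d * ?e u"
        using u assms by (intro mult_right_mono ft_S_le_even) auto
      then show ?thesis using True by (simp add: add_increasing2)
    next
      case False
      then show ?thesis using u assms by (auto intro!: mult_right_mono ft_S_le_even)
    qed
  qed
  also have "\<dots> \<le> (\<Sum>u\<in>carrier M. (if u \<in> S then real q ^ d * ?e u else 0) + real q ^ (d - 2) * ?e u)"
    using finite_space by (intro sum_mono2) auto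
  also have "\<dots> = (\<Sum>u\<in>S. real q ^ d * ?e u) + (\<Sum>u\<in>carrier M. real q ^ (d - 2) * ?e u)"
    using finite_space S_subset by (simp add: sum.distrib sum.If_cases Int_absorb1)
  also have "\<dots> = real N * (\<Sum>u\<in>S. ?e u) + real q ^ (d - 2) * (real N * card E)"
    using Plancherel_set[OF E] card_space by (simp flip: sum_distrib_left)
  also have "\<dots> \<le> real N * (real (card S) * card E + sqrt (real q ^ d) * (real (card E))\<^sup>2) + real q ^ (d - 2) * (real N * card E)"
    using ft_set_mass_on_S[OF assms] by (intro add_right_mono mult_left_mono) auto
  also have "\<dots> = real N * (real (card S) * card E + sqrt (real q ^ d) * (real (card E))\<^sup>2 + real q ^ (d - 2) * card E)"
    by (simp add: algebra_simps)
  finally show ?thesis using N_pos by simp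
qed

end

section \<open>Forms on coordinate spaces\<close>

text \<open>The matrix \<open>c\<close> is not assumed symmetric, matching
  \<open>quadratic_form\<close>; the polar form is the sum of this form and its transpose.\<close>

definition bilinear_sum :: "'a ring \<Rightarrow> nat \<Rightarrow> (nat \<Rightarrow> nat \<Rightarrow> 'a) \<Rightarrow> (nat \<Rightarrow> 'a) \<Rightarrow> (nat \<Rightarrow> 'a) \<Rightarrow> 'a" where
  "bilinear_sum K d c x y = (\<Oplus>\<^bsub>K\<^esub>i\<in>{..<d}. \<Oplus>\<^bsub>K\<^esub>j\<in>{..<d}. c i j \<otimes>\<^bsub>K\<^esub> x i \<otimes>\<^bsub>K\<^esub> y j)"

lemma coord_space_nth: "x \<in> carrier (coord_space K d) \<Longrightarrow> i < d \<Longrightarrow> x i \<in> carrier K"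
  by (auto simp: coord_space_simps)

context
  fixes K :: "'a ring" and d :: nat and c
  assumes cring: "cring K" and c: "\<forall>i<d. \<forall>j<d. c i j \<in> carrier K"
begin

interpretation cring K by (rule cring)

lemma bilinear_sum_closed:
  assumes "x \<in> carrier (coord_space K d)" "y \<in> carrier (coord_space K d)"
  shows "bilinear_sum K d c x y \<in> carrier K"
  unfolding bilinear_sum_def using c coord_space_nth[OF assms(1)] coord_space_nth[OF assms(2)]
  by (intro finsum_closed) (auto intro!: finsum_closed)

lemma bilinear_sum_add_left:
  assumes "x \<in> carrier (coord_space K d)" "x' \<in> carrier (coord_space K d)" "y \<in> carrier (coord_space K d)"
  shows "bilinear_sum K d c (x \<oplus>\<^bsub>coord_space K d\<^esub> x') y = bilinear_sum K d c x y \<oplus>\<^bsub>K\<^esub> bilinear_sum K d c x' y"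
proof -
  note [simp] = coord_space_nth[OF assms(1)] coord_space_nth[OF assms(2)] coord_space_nth[OF assms(3)] c[rule_format]
  have "bilinear_sum K d c (x \<oplus>\<^bsub>coord_space K d\<^esub> x') y =
      (\<Oplus>\<^bsub>K\<^esub>i\<in>{..<d}. (\<Oplus>\<^bsub>K\<^esub>j\<in>{..<d}. c i j \<otimes>\<^bsub>K\<^esub> x i \<otimes>\<^bsub>K\<^esub> y j) \<oplus>\<^bsub>K\<^esub> (\<Oplus>\<^bsub>K\<^esub>j\<in>{..<d}. c i j \<otimes>\<^bsub>K\<^esub> x' i \<otimes>\<^bsub>K\<^esub> y j))"
    unfolding bilinear_sum_def
  proof (rule finsum_cong')
    fix i assume i: "i \<in> {..<d}"
    have "(\<Oplus>\<^bsub>K\<^esub>j\<in>{..<d}. c i j \<otimes>\<^bsub>K\<^esub> (x \<oplus>\<^bsub>coord_space K d\<^esub> x') i \<otimes>\<^bsub>K\<^esub> y j) =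
        (\<Oplus>\<^bsub>K\<^esub>j\<in>{..<d}. c i j \<otimes>\<^bsub>K\<^esub> x i \<otimes>\<^bsub>K\<^esub> y j \<oplus>\<^bsub>K\<^esub> c i j \<otimes>\<^bsub>K\<^esub> x' i \<otimes>\<^bsub>K\<^esub> y j)"
      using i by (intro finsum_cong') (auto simp: coord_space_simps l_distr r_distr)
    also have "\<dots> = (\<Oplus>\<^bsub>K\<^esub>j\<in>{..<d}. c i j \<otimes>\<^bsub>K\<^esub> x i \<otimes>\<^bsub>K\<^esub> y j) \<oplus>\<^bsub>K\<^esub> (\<Oplus>\<^bsub>K\<^esub>j\<in>{..<d}. c i j \<otimes>\<^bsub>K\<^esub> x' i \<otimes>\<^bsub>K\<^esub> y j)"
      using i by (intro finsum_addf) auto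
    finally show "(\<Oplus>\<^bsub>K\<^esub>j\<in>{..<d}. c i j \<otimes>\<^bsub>K\<^esub> (x \<oplus>\<^bsub>coord_space K d\<^esub> x') i \<otimes>\<^bsub>K\<^esub> y j) =
        (\<Oplus>\<^bsub>K\<^esub>j\<in>{..<d}. c i j \<otimes>\<^bsub>K\<^esub> x i \<otimes>\<^bsub>K\<^esub> y j) \<oplus>\<^bsub>K\<^esub> (\<Oplus>\<^bsub>K\<^esub>j\<in>{..<d}. c i j \<otimes>\<^bsub>K\<^esub> x' i \<otimes>\<^bsub>K\<^esub> y j)" .
  qed (auto intro!: finsum_closed)
  also have "\<dots> = bilinear_sum K d c x y \<oplus>\<^bsub>K\<^esub> bilinear_sum K d c x' y"
    unfolding bilinear_sum_def by (intro finsum_addf) (auto intro!: finsum_closed)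
  finally show ?thesis .
qed

lemma bilinear_sum_add_right:
  assumes "x \<in> carrier (coord_space K d)" "y \<in> carrier (coord_space K d)" "y' \<in> carrier (coord_space K d)"
  shows "bilinear_sum K d c x (y \<oplus>\<^bsub>coord_space K d\<^esub> y') = bilinear_sum K d c x y \<oplus>\<^bsub>K\<^esub> bilinear_sum K d c x y'"
proof -
  note [simp] = coord_space_nth[OF assms(1)] coord_space_nth[OF assms(2)] coord_space_nth[OF assms(3)] c[rule_format]
  have "bilinear_sum K d c x (y \<oplus>\<^bsub>coord_space K d\<^esub> y') =
      (\<Oplus>\<^bsub>K\<^esub>i\<in>{..<d}. (\<Oplus>\<^bsub>K\<^esub>j\<in>{..<d}. c i j \<otimes>\<^bsub>K\<^esub> x i \<otimes>\<^bsub>K\<^esub> y j) \<oplus>\<^bsub>K\<^esub> (\<Oplus>\<^bsub>K\<^esub>j\<in>{..<d}. c i j \<otimes>\<^bsub>K\<^esub> x i \<otimes>\<^bsub>K\<^esub> y' j))"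
    unfolding bilinear_sum_def
  proof (rule finsum_cong')
    fix i assume i: "i \<in> {..<d}"
    have "(\<Oplus>\<^bsub>K\<^esub>j\<in>{..<d}. c i j \<otimes>\<^bsub>K\<^esub> x i \<otimes>\<^bsub>K\<^esub> (y \<oplus>\<^bsub>coord_space K d\<^esub> y') j) =
        (\<Oplus>\<^bsub>K\<^esub>j\<in>{..<d}. c i j \<otimes>\<^bsub>K\<^esub> x i \<otimes>\<^bsub>K\<^esub> y j \<oplus>\<^bsub>K\<^esub> c i j \<otimes>\<^bsub>K\<^esub> x i \<otimes>\<^bsub>K\<^esub> y' j)"
      using i by (intro finsum_cong') (auto simp: coord_space_simps l_distr r_distr)
    also have "\<dots> = (\<Oplus>\<^bsub>K\<^esub>j\<in>{..<d}. c i j \<otimes>\<^bsub>K\<^esub> x i \<otimes>\<^bsub>K\<^esub> y j) \<oplus>\<^bsub>K\<^esub> (\<Oplus>\<^bsub>K\<^esub>j\<in>{..<d}. c i j \<otimes>\<^bsub>K\<^esub> x i \<otimes>\<^bsub>K\<^esub> y' j)"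
      using i by (intro finsum_addf) auto
    finally show "(\<Oplus>\<^bsub>K\<^esub>j\<in>{..<d}. c i j \<otimes>\<^bsub>K\<^esub> x i \<otimes>\<^bsub>K\<^esub> (y \<oplus>\<^bsub>coord_space K d\<^esub> y') j) =
        (\<Oplus>\<^bsub>K\<^esub>j\<in>{..<d}. c i j \<otimes>\<^bsub>K\<^esub> x i \<otimes>\<^bsub>K\<^esub> y j) \<oplus>\<^bsub>K\<^esub> (\<Oplus>\<^bsub>K\<^esub>j\<in>{..<d}. c i j \<otimes>\<^bsub>K\<^esub> x i \<otimes>\<^bsub>K\<^esub> y' j)" .
  qed (auto intro!: finsum_closed)
  also have "\<dots> = bilinear_sum K d c x y \<oplus>\<^bsub>K\<^esub> bilinear_sum K d c x y'"
    unfolding bilinear_sum_def by (intro finsum_addf) (auto intro!: finsum_closed)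
  finally show ?thesis .
qed

lemma bilinear_sum_smult:
  assumes "x \<in> carrier (coord_space K d)" "y \<in> carrier (coord_space K d)" "a \<in> carrier K" "b \<in> carrier K"
  shows "bilinear_sum K d c (a \<odot>\<^bsub>coord_space K d\<^esub> x) (b \<odot>\<^bsub>coord_space K d\<^esub> y) = a \<otimes>\<^bsub>K\<^esub> b \<otimes>\<^bsub>K\<^esub> bilinear_sum K d c x y"
proof -
  note [simp] = coord_space_nth[OF assms(1)] coord_space_nth[OF assms(2)] c[rule_format] assms(3,4)
  have "bilinear_sum K d c (a \<odot>\<^bsub>coord_space K d\<^esub> x) (b \<odot>\<^bsub>coord_space K d\<^esub> y) =
      (\<Oplus>\<^bsub>K\<^esub>i\<in>{..<d}. a \<otimes>\<^bsub>K\<^esub> b \<otimes>\<^bsub>K\<^esub> (\<Oplus>\<^bsub>K\<^esub>j\<in>{..<d}. c i j \<otimes>\<^bsub>K\<^esub> x i \<otimes>\<^bsub>K\<^esub> y j))"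
    unfolding bilinear_sum_def
  proof (rule finsum_cong')
    fix i assume i: "i \<in> {..<d}"
    have "(\<Oplus>\<^bsub>K\<^esub>j\<in>{..<d}. c i j \<otimes>\<^bsub>K\<^esub> (a \<odot>\<^bsub>coord_space K d\<^esub> x) i \<otimes>\<^bsub>K\<^esub> (b \<odot>\<^bsub>coord_space K d\<^esub> y) j) =
        (\<Oplus>\<^bsub>K\<^esub>j\<in>{..<d}. a \<otimes>\<^bsub>K\<^esub> b \<otimes>\<^bsub>K\<^esub> (c i j \<otimes>\<^bsub>K\<^esub> x i \<otimes>\<^bsub>K\<^esub> y j))"
      using i by (intro finsum_cong') (auto simp: coord_space_simps m_ac)
    also have "\<dots> = a \<otimes>\<^bsub>K\<^esub> b \<otimes>\<^bsub>K\<^esub> (\<Oplus>\<^bsub>K\<^esub>j\<in>{..<d}. c i j \<otimes>\<^bsub>K\<^esub> x i \<otimes>\<^bsub>K\<^esub> y j)"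
      using i by (intro finsum_rdistr[symmetric]) auto
    finally show "(\<Oplus>\<^bsub>K\<^esub>j\<in>{..<d}. c i j \<otimes>\<^bsub>K\<^esub> (a \<odot>\<^bsub>coord_space K d\<^esub> x) i \<otimes>\<^bsub>K\<^esub> (b \<odot>\<^bsub>coord_space K d\<^esub> y) j) =
        a \<otimes>\<^bsub>K\<^esub> b \<otimes>\<^bsub>K\<^esub> (\<Oplus>\<^bsub>K\<^esub>j\<in>{..<d}. c i j \<otimes>\<^bsub>K\<^esub> x i \<otimes>\<^bsub>K\<^esub> y j)" .
  qed (auto intro!: finsum_closed)
  also have "\<dots> = a \<otimes>\<^bsub>K\<^esub> b \<otimes>\<^bsub>K\<^esub> bilinear_sum K d c x y"
    unfolding bilinear_sum_def by (intro finsum_rdistr[symmetric]) (auto intro!: finsum_closed)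
  finally show ?thesis .
qed

end

lemma (in finite_field) two_neq_0_if_odd:
  assumes "odd (card (carrier R))"
  shows "\<one> \<oplus> \<one> \<noteq> \<zero>"
proof
  assume "\<one> \<oplus> \<one> = \<zero>"
  then have "nmult 2 \<one> = \<zero>" using add.nat_pow_Suc[of 1 \<one>] by (simp add: numeral_2_eq_2)
  then have "characteristic dvd 2" by (simp only: nat_mult_one_eq_0_iff)
  then have "characteristic = 2"
    using prime_gt_1_nat[OF prime_characteristic] dvd_imp_le[of characteristic 2] by simp
  moreover have "nmult (card (carrier R)) \<one> = \<zero>" by (intro add.power_order_eq_one finite_carrier one_closed)
  then have "characteristic dvd card (carrier R)" by (simp only: nat_mult_one_eq_0_iff)
  ultimately show False using assms by simp
qed

lemma card_coord_space: "finite (carrier K) \<Longrightarrow> card (carrier (coord_space K d)) = card (carrier K) ^ d"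
  by (simp add: coord_space_simps card_PiE)

lemma finite_coord_space: "finite (carrier K) \<Longrightarrow> finite (carrier (coord_space K d))"
  by (simp add: coord_space_simps finite_PiE)

lemma quadratic_space_coord_space:
  assumes K: "field K" "finite (carrier K)" "odd (card (carrier K))"
    and Q: "nondegenerate_form K d Q" and d: "3 \<le> d"
  obtains \<psi> where "quadratic_space_dim K \<psi> (coord_space K d) Q (polar_form K d Q) d"
proof -
  interpret field K by (rule K)
  interpret finite_field K by unfold_locales (rule K)
  obtain \<psi> where psi: "\<And>x. x \<in> carrier K \<Longrightarrow> cmod (\<psi> x) = 1"
    "\<And>x y. x \<in> carrier K \<Longrightarrow> y \<in> carrier K \<Longrightarrow> \<psi> (x \<oplus>\<^bsub>K\<^esub> y) = \<psi> x * \<psi> y"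
    "\<exists>x\<in>carrier K. \<psi> x \<noteq> 1" using exists_additive_character by blast
  let ?M = "coord_space K d"
  interpret M: module K ?M by (rule module_coord_space) (rule is_cring)
  obtain c where c: "\<forall>i<d. \<forall>j<d. c i j \<in> carrier K"
    and Qc: "\<forall>x \<in> carrier ?M. Q x = (\<Oplus>\<^bsub>K\<^esub>i\<in>{..<d}. \<Oplus>\<^bsub>K\<^esub>j\<in>{..<d}. c i j \<otimes>\<^bsub>K\<^esub> x i \<otimes>\<^bsub>K\<^esub> x j)"
    using Q unfolding nondegenerate_form_def quadratic_form_def by blast
  let ?b = "bilinear_sum K d c"
  have Qb: "Q x = ?b x x" if "x \<in> carrier ?M" for x using Qc that by (simp add: bilinear_sum_def)
  note b_closed = bilinear_sum_closed[OF is_cring c] and b_add1 = bilinear_sum_add_left[OF is_cring c]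
    and b_add2 = bilinear_sum_add_right[OF is_cring c] and b_smult = bilinear_sum_smult[OF is_cring c]
  have polar: "polar_form K d Q x y = ?b x y \<oplus>\<^bsub>K\<^esub> ?b y x" if xy: "x \<in> carrier ?M" "y \<in> carrier ?M" for x y
  proof -
    have "polar_form K d Q x y = (?b x x \<oplus>\<^bsub>K\<^esub> ?b y x \<oplus>\<^bsub>K\<^esub> (?b x y \<oplus>\<^bsub>K\<^esub> ?b y y)) \<ominus>\<^bsub>K\<^esub> ?b x x \<ominus>\<^bsub>K\<^esub> ?b y y"
      unfolding polar_form_def using xy by (simp add: Qb b_add1 b_add2)
    also have "\<dots> = ?b x y \<oplus>\<^bsub>K\<^esub> ?b y x"
      using b_closed[OF xy] b_closed[OF xy(2,1)] b_closed[OF xy(1,1)] b_closed[OF xy(2,2)] by algebra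
    finally show ?thesis .
  qed
  have one: "\<one>\<^bsub>K\<^esub> \<odot>\<^bsub>?M\<^esub> x = x" if "x \<in> carrier ?M" for x using that by simp
  have "quadratic_space_dim K \<psi> ?M Q (polar_form K d Q) d"
  proof unfold_locales
    show "\<And>x. x \<in> carrier K \<Longrightarrow> cmod (\<psi> x) = 1" by (rule psi(1))
    show "\<And>x y. x \<in> carrier K \<Longrightarrow> y \<in> carrier K \<Longrightarrow> \<psi> (x \<oplus>\<^bsub>K\<^esub> y) = \<psi> x * \<psi> y" by (rule psi(2))
    show "\<exists>x\<in>carrier K. \<psi> x \<noteq> 1" by (rule psi(3))
    show "\<one>\<^bsub>K\<^esub> \<oplus>\<^bsub>K\<^esub> \<one>\<^bsub>K\<^esub> \<noteq> \<zero>\<^bsub>K\<^esub>" by (rule two_neq_0_if_odd[OF K(3)])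
    show "finite (carrier ?M)" by (rule finite_coord_space[OF K(2)])
    show "card (carrier ?M) = card (carrier K) ^ d" by (rule card_coord_space[OF K(2)])
    show "3 \<le> d" by (rule d)
    fix x y x' a
    assume x: "x \<in> carrier ?M"
    show "Q x \<in> carrier K" using x by (simp add: Qb b_closed)
    show "(\<And>y. y \<in> carrier ?M \<Longrightarrow> polar_form K d Q x y = \<zero>\<^bsub>K\<^esub>) \<Longrightarrow> x = \<zero>\<^bsub>?M\<^esub>"
      using Q x unfolding nondegenerate_form_def by blast
    assume y: "y \<in> carrier ?M"
    show "polar_form K d Q x y \<in> carrier K" using x y by (simp add: polar b_closed)
    show "polar_form K d Q x y = polar_form K d Q y x" using x y by (simp add: polar b_closed a_comm)
    show "Q (x \<oplus>\<^bsub>?M\<^esub> y) = Q x \<oplus>\<^bsub>K\<^esub> Q y \<oplus>\<^bsub>K\<^esub> polar_form K d Q x y"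
    proof -
      have "Q (x \<oplus>\<^bsub>?M\<^esub> y) \<in> carrier K" "Q x \<in> carrier K" "Q y \<in> carrier K"
        using x y by (simp_all add: Qb b_closed)
      then show ?thesis unfolding polar_form_def by algebra
    qed
    show "polar_form K d Q (x \<oplus>\<^bsub>?M\<^esub> x') y = polar_form K d Q x y \<oplus>\<^bsub>K\<^esub> polar_form K d Q x' y"
      if x': "x' \<in> carrier ?M"
      using x x' y by (simp add: polar b_add1 b_add2 b_closed a_ac)
    assume a: "a \<in> carrier K"
    show "polar_form K d Q (a \<odot>\<^bsub>?M\<^esub> x) y = a \<otimes>\<^bsub>K\<^esub> polar_form K d Q x y"
      using b_smult[OF x y a one_closed] b_smult[OF y x one_closed a] x y a one
      by (simp add: polar b_closed r_distr)
  next
    fix a x assume "a \<in> carrier K" "x \<in> carrier ?M"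
    then show "Q (a \<odot>\<^bsub>?M\<^esub> x) = a \<otimes>\<^bsub>K\<^esub> a \<otimes>\<^bsub>K\<^esub> Q x" by (simp add: Qb b_smult)
  qed
  then show thesis by (rule that)
qed

section \<open>The averaging kernel and the deviation of averages from their mean\<close>

context quadratic_space_dim
begin

abbreviation V :: "'c set" where "V \<equiv> carrier M"

definition avg_kernel :: "'c \<Rightarrow> 'c \<Rightarrow> real" where
  "avg_kernel x y = indicator S (y \<ominus>\<^bsub>M\<^esub> x) / card S"

definition fluct :: "'c set \<Rightarrow> 'c \<Rightarrow> real" where
  "fluct E y = kop V avg_kernel (indicator E) y - dens V E"

lemma V_ne: "V \<noteq> {}" using M.zero_closed by blast

lemma q_ge_3: "3 \<le> q"
proof -
  have "card {\<zero>\<^bsub>R\<^esub>, \<one>\<^bsub>R\<^esub>, \<ominus>\<^bsub>R\<^esub> \<one>\<^bsub>R\<^esub>} \<le> q"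
    by (intro card_mono finite_carrier) auto
  moreover have "\<one>\<^bsub>R\<^esub> \<noteq> \<ominus>\<^bsub>R\<^esub> \<one>\<^bsub>R\<^esub>" using two_neq_0 R.r_neg[of "\<one>\<^bsub>R\<^esub>"] by force
  moreover have "\<zero>\<^bsub>R\<^esub> \<noteq> \<ominus>\<^bsub>R\<^esub> \<one>\<^bsub>R\<^esub>" using R.r_neg[of "\<one>\<^bsub>R\<^esub>"] by force
  ultimately show ?thesis by simp
qed

text \<open>With q \<ge> 3 and d \<ge> 3 this reduces to 9 \<le> 4 q q^(d-3), where the left side of
  that is below 12. It leaves card S between 1/3 and 5/3 of q^(d-1).\<close>

lemma sqrt_N_le: "sqrt (real q ^ d) \<le> 2 / 3 * real q ^ (d - 1)"
proof (rule real_le_lsqrt)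
  have "d = 3 + (d - 3)" using d_ge_3 by simp
  define e where "e = d - 3"
  have d: "d = e + 3" "d - 1 = e + 2" using d_ge_3 by (auto simp: e_def)
  have "9 \<le> 4 * real q * real q ^ e"
    using q_ge_3 mult_mono[of 9 "4 * real q" 1 "real q ^ e"] by simp
  then have "9 * real q ^ (e + 3) \<le> 4 * real q * real q ^ e * real q ^ (e + 3)"
    by (intro mult_right_mono) auto
  also have "\<dots> = (2 * real q ^ (e + 2))\<^sup>2"
    by (simp add: power_mult_distrib power_add power2_eq_square power3_eq_cube)
  finally show "real q ^ d \<le> (2 / 3 * real q ^ (d - 1))\<^sup>2"
    by (simp add: d power_mult_distrib power_divide)
qed simp_all

lemma card_S_bounds: "real q ^ (d - 1) \<le> 3 * real (card S)" "real (card S) \<le> 2 * real q ^ (d - 1)"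
  using card_S_near sqrt_N_le by (auto simp: abs_le_iff)

lemma card_S_pos: "0 < card S"
proof -
  have "0 < real q ^ (d - 1)" using q_ge_3 by simp
  then have "real (card S) \<noteq> 0" using card_S_bounds(1) by linarith
  then show ?thesis by simp
qed

lemma Q_neg: "x \<in> V \<Longrightarrow> Q (\<ominus>\<^bsub>M\<^esub> x) = Q x"
  using Q_smult[of "\<ominus>\<^bsub>R\<^esub> \<one>\<^bsub>R\<^esub>" x] by (simp add: neg_eq_smult R.l_minus R.r_minus)

lemma S_neg: "x \<in> V \<Longrightarrow> \<ominus>\<^bsub>M\<^esub> x \<in> S \<longleftrightarrow> x \<in> S"
  by (simp add: S_def Q_neg)

text \<open>S = -S since Q is even; this is what makes the averaging kernel symmetric and duality
  available.\<close>

lemma S_minus_commute: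
  assumes "x \<in> V" "y \<in> V"
  shows "y \<ominus>\<^bsub>M\<^esub> x \<in> S \<longleftrightarrow> x \<ominus>\<^bsub>M\<^esub> y \<in> S"
proof -
  have "\<ominus>\<^bsub>M\<^esub> (x \<ominus>\<^bsub>M\<^esub> y) = y \<ominus>\<^bsub>M\<^esub> x" using assms by (simp add: M.minus_eq M.minus_add M.a_comm)
  then show ?thesis using S_neg[of "x \<ominus>\<^bsub>M\<^esub> y"] assms by simp
qed

lemma kop_eq:
  assumes y: "y \<in> V"
  shows "kop V avg_kernel f y = (\<Sum>x\<in>S. f (y \<ominus>\<^bsub>M\<^esub> x)) / card S"
proof -
  have "(\<Sum>x\<in>V. indicator S (y \<ominus>\<^bsub>M\<^esub> x) * f x) =
      (\<Sum>x\<in>V. indicator S (y \<ominus>\<^bsub>M\<^esub> (y \<ominus>\<^bsub>M\<^esub> x)) * f (y \<ominus>\<^bsub>M\<^esub> x))"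
    by (rule sum.reindex_bij_betw[OF M.bij_betw_reflect[OF y], symmetric])
  also have "\<dots> = (\<Sum>x\<in>V. indicator S x * f (y \<ominus>\<^bsub>M\<^esub> x))"
    using y by (intro sum.cong refl) (simp add: M.minus_eq M.minus_add M.r_neg M.a_assoc[symmetric])
  also have "\<dots> = (\<Sum>x\<in>S. f (y \<ominus>\<^bsub>M\<^esub> x))"
    by (rule sum_over_subset[OF finite_space S_subset])
  finally show ?thesis by (simp add: kop_def avg_kernel_def flip: sum_divide_distrib)
qed

lemma avg_kernel_nonneg: "0 \<le> avg_kernel x y" by (simp add: avg_kernel_def)

lemma avg_kernel_commute: "x \<in> V \<Longrightarrow> y \<in> V \<Longrightarrow> avg_kernel x y = avg_kernel y x"
  using S_minus_commute[of x y] by (simp add: avg_kernel_def indicator_def)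

lemma avg_kernel_stoch: "y \<in> V \<Longrightarrow> (\<Sum>x\<in>V. avg_kernel x y) = 1"
  using kop_eq[of y "\<lambda>_. 1"] card_S_pos by (simp add: kop_def)

lemma kop_hits: "y \<in> V \<Longrightarrow> kop V avg_kernel (indicator E) y = real (hits E y) / card S"
proof -
  assume y: "y \<in> V"
  have "(\<Sum>x\<in>S. indicator E (y \<ominus>\<^bsub>M\<^esub> x)) = (\<Sum>x\<in>{x\<in>S. y \<ominus>\<^bsub>M\<^esub> x \<in> E}. 1::real)"
    using finite_S by (intro sum.mono_neutral_cong_right) auto
  then show ?thesis by (simp add: kop_eq[OF y] hits_def)
qed

lemma fluct_eq: "y \<in> V \<Longrightarrow> fluct E y = discrepancy E y / card S"
  using card_S_pos by (simp add: fluct_def kop_hits discrepancy_def dens_def diff_divide_distrib)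

text \<open>The fluctuation is the discrepancy over card S, and card S \<ge> q^(d-1) / 3; the square
  of 3 is the 9.\<close>

lemma mean_fluct_le:
  assumes "(\<Sum>y\<in>V. (discrepancy E y)\<^sup>2) \<le> D" "0 \<le> D"
  shows "mean V (\<lambda>y. (fluct E y)\<^sup>2) \<le> 9 * D / (real N * (real q ^ (d - 1))\<^sup>2)"
proof -
  have "mean V (\<lambda>y. (fluct E y)\<^sup>2) = (\<Sum>y\<in>V. (discrepancy E y)\<^sup>2) / (real N * (real (card S))\<^sup>2)"
    unfolding mean_def by (simp add: fluct_eq power_divide mult.commute flip: sum_divide_distrib)
  also have "\<dots> \<le> D / (real N * (real (card S))\<^sup>2)" by (intro divide_right_mono assms) auto
  also have "\<dots> \<le> D / (real N * ((real q ^ (d - 1))\<^sup>2 / 9))"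
  proof (intro divide_left_mono mult_left_mono assms mult_pos_pos)
    have "(real q ^ (d - 1) / 3)\<^sup>2 \<le> (real (card S))\<^sup>2" using card_S_bounds by (intro power_mono) auto
    then show "(real q ^ (d - 1))\<^sup>2 / 9 \<le> (real (card S))\<^sup>2" by (simp add: power_divide)
  qed (use N_pos card_S_pos q_ge_3 in auto)
  finally show ?thesis by (simp add: mult.commute)
qed

lemma N_eq: "real N = real q * real q ^ (d - 1)"
  using d_ge_3 by (cases d) (auto simp: card_space)

lemma card_eq_dens: "E \<subseteq> V \<Longrightarrow> real (card E) = real N * dens V E"
  using N_pos by (simp add: dens_def)

lemma fluct_odd:
  assumes "odd d" "E \<subseteq> V"
  shows "mean V (\<lambda>y. (fluct E y)\<^sup>2) \<le> 9 / real q ^ (d - 1) * dens V E"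
proof -
  have "mean V (\<lambda>y. (fluct E y)\<^sup>2) \<le> 9 * (real q ^ (d - 1) * card E) / (real N * (real q ^ (d - 1))\<^sup>2)"
    using discrepancy_odd[OF assms] by (intro mean_fluct_le) auto
  then show ?thesis using card_eq_dens[OF assms(2)] N_pos q_ge_3 by (simp add: power2_eq_square)
qed

lemma fluct_even:
  assumes "even d" "E \<subseteq> V"
  shows "mean V (\<lambda>y. (fluct E y)\<^sup>2) \<le> 9 / real q ^ (d - 2) * dens V E"
proof -
  have "mean V (\<lambda>y. (fluct E y)\<^sup>2) \<le> 9 * (real q ^ d * card E) / (real N * (real q ^ (d - 1))\<^sup>2)"
    using discrepancy_even[OF assms] by (intro mean_fluct_le) auto
  also have "\<dots> = 9 * (real q ^ d / (real q ^ (d - 1))\<^sup>2) * dens V E"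
    using card_eq_dens[OF assms(2)] N_pos q_ge_3 by simp
  also have "real q ^ d / (real q ^ (d - 1))\<^sup>2 = 1 / real q ^ (d - 2)"
  proof -
    have "(real q ^ (d - 1))\<^sup>2 = real q ^ d * real q ^ (d - 2)"
      using d_ge_3 by (simp flip: power_mult power_add) (simp add: algebra_simps numeral_2_eq_2)
    then show ?thesis using q_ge_3 by simp
  qed
  finally show ?thesis by simp
qed

text \<open>27 is 9 (2 + 1): card S contributes 2 q^(d-1), and q^(d-2) is enlarged to
  q^(d-1).\<close>

lemma fluct_even_small:
  assumes "even d" "E \<subseteq> V"
  shows "mean V (\<lambda>y. (fluct E y)\<^sup>2) \<le>
    27 / real q ^ (d - 1) * dens V E + 9 * (real q)\<^sup>2 / sqrt (real q ^ d) * (dens V E)\<^sup>2"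
proof -
  let ?m = "dens V E" and ?Q = "real q ^ (d - 1)"
  have Q2: "?Q\<^sup>2 = (real N)\<^sup>2 / (real q)\<^sup>2" using q_ge_3 by (simp add: N_eq power_mult_distrib)
  have sq: "sqrt (real q ^ d) * sqrt (real q ^ d) = real N" "sqrt (real q ^ d) \<noteq> 0"
    using q_ge_3 by (simp_all add: card_space)
  have le: "real q ^ (d - 2) \<le> ?Q" using q_ge_3 by (intro power_increasing) auto
  have "mean V (\<lambda>y. (fluct E y)\<^sup>2) \<le>
      9 * (real (card S) * card E + sqrt (real q ^ d) * (real (card E))\<^sup>2 + real q ^ (d - 2) * card E) / (real N * ?Q\<^sup>2)"
    using discrepancy_even_small[OF assms] by (intro mean_fluct_le) auto
  also have "\<dots> \<le> 9 * (2 * ?Q * card E + sqrt (real q ^ d) * (real (card E))\<^sup>2 + ?Q * card E) / (real N * ?Q\<^sup>2)"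
    using card_S_bounds(2) le
    by (intro divide_right_mono mult_left_mono add_mono mult_right_mono) auto
  also have "\<dots> = 27 * (?Q * (real N * ?m)) / (real N * ?Q\<^sup>2) + 9 * (sqrt (real q ^ d) * (real N * ?m)\<^sup>2) / (real N * ?Q\<^sup>2)"
    unfolding card_eq_dens[OF assms(2)] add_divide_distrib[symmetric]
    by (rule arg_cong[where f = "\<lambda>t. t / (real N * ?Q\<^sup>2)"]) (simp add: algebra_simps)
  also have "27 * (?Q * (real N * ?m)) / (real N * ?Q\<^sup>2) = 27 / ?Q * ?m"
    using N_pos q_ge_3 by (simp add: power2_eq_square)
  also have "9 * (sqrt (real q ^ d) * (real N * ?m)\<^sup>2) / (real N * ?Q\<^sup>2) = 9 * (real q)\<^sup>2 * (sqrt (real q ^ d) / real N) * ?m\<^sup>2"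
    unfolding Q2 using N_pos q_ge_3 by (simp add: power2_eq_square)
  also have "sqrt (real q ^ d) / real N = 1 / sqrt (real q ^ d)" using sq N_pos by (simp add: field_simps)
  finally show ?thesis by simp
qed

text \<open>As x runs through S the points y - x are distinct, so at most card E of them lie in E;
  then card E is divided by card S.\<close>

lemma kop_set_le:
  assumes "E \<subseteq> V" "y \<in> V"
  shows "kop V avg_kernel (indicator E) y \<le> 3 * real q * dens V E"
proof -
  have "hits E y \<le> card E"
  proof -
    have "inj_on (\<lambda>x. y \<ominus>\<^bsub>M\<^esub> x) {x \<in> S. y \<ominus>\<^bsub>M\<^esub> x \<in> E}"
      using bij_betw_imp_inj_on[OF M.bij_betw_reflect[OF assms(2)]] S_subset by (auto intro: inj_on_subset)
    then show ?thesis unfolding hits_def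
      using assms(1) finite_space by (intro card_inj_on_le[of "\<lambda>x. y \<ominus>\<^bsub>M\<^esub> x"]) (auto intro: finite_subset)
  qed
  then have "kop V avg_kernel (indicator E) y \<le> real (card E) / real (card S)"
    unfolding kop_hits[OF assms(2)] by (intro divide_right_mono) auto
  also have "\<dots> \<le> real (card E) / (real q ^ (d - 1) / 3)"
    using card_S_bounds card_S_pos q_ge_3 by (intro divide_left_mono) auto
  also have "\<dots> = 3 * real q * dens V E"
    using card_eq_dens[OF assms(1)] q_ge_3 by (simp add: N_eq)
  finally show ?thesis .
qed

lemma abs_fluct_le:
  assumes "E \<subseteq> V" "y \<in> V"
  shows "\<bar>fluct E y\<bar> \<le> 3 * real q * dens V E"
proof -
  have "0 \<le> kop V avg_kernel (indicator E) y" by (intro kop_nonneg avg_kernel_nonneg) auto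
  moreover have "1 * dens V E \<le> 3 * real q * dens V E" using q_ge_3 by (intro mult_right_mono dens_nonneg) auto
  ultimately show ?thesis using kop_set_le[OF assms] dens_nonneg[of V E] by (simp add: fluct_def abs_le_iff)
qed

lemma pairing_fluct:
  "pairing V avg_kernel (indicator E) g = dens V E * mean V g + mean V (\<lambda>y. fluct E y * g y)"
proof -
  have "pairing V avg_kernel (indicator E) g = mean V (\<lambda>y. dens V E * g y + fluct E y * g y)"
    unfolding pairing_def fluct_def by (simp add: algebra_simps)
  then show ?thesis by (simp add: mean_add mean_cmult)
qed

end

section \<open>Estimates for indicator functions\<close>

text \<open>The coordinates of \<open>P1\<close>. Since 1 / \<open>beta1 d\<close> is the integer d
  - 1, the norm with index \<open>beta1 d\<close> is an ordinary moment of order d - 1.\<close>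

definition alpha1 :: "nat \<Rightarrow> real" where
  "alpha1 d = ((real d)\<^sup>2 - 2 * real d + 2) / (real d * (real d - 1))"

definition beta1 :: "nat \<Rightarrow> real" where "beta1 d = 1 / (real d - 1)"

context quadratic_space_dim
begin

text \<open>The estimate from index 1 to index 0, that is from L^1 to the sup norm, for the
  deviation. Its constant grows like q.\<close>

lemma set_bound_sup:
  "set_bound V avg_kernel 1 (3 * real q) 1 1"
  unfolding set_bound_def
proof (intro allI impI)
  fix E F assume EF: "E \<subseteq> V" "F \<subseteq> V"
  have "mean V (\<lambda>y. fluct E y * indicator F y) \<le> mean V (\<lambda>y. 3 * real q * dens V E * indicator F y)"
    using abs_fluct_le[OF EF(1)] by (intro mean_mono mult_right_mono) (auto simp: abs_le_iff)
  then show "pairing V avg_kernel (indicator E) (indicator F) \<le>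
      1 * (dens V E * dens V F) + 3 * real q * (dens V E powr 1 * dens V F powr 1)"
    by (simp add: pairing_fluct mean_cmult mean_indicator[OF finite_space EF(2)] dens_nonneg)
qed

text \<open>Cauchy-Schwarz with the mean square of the fluctuation. The constant decays like
  q^(-(d-1)/2), against the growth in \<open>set_bound_sup\<close>.\<close>

lemma set_bound_odd:
  assumes "odd d"
  shows "set_bound V avg_kernel 1 (3 / sqrt (real q ^ (d - 1))) (1 / 2) (1 / 2)"
  unfolding set_bound_def
proof (intro allI impI)
  fix E F assume EF: "E \<subseteq> V" "F \<subseteq> V"
  have "mean V (\<lambda>y. fluct E y * indicator F y) \<le> mean V (\<lambda>y. \<bar>fluct E y\<bar> * indicator F y)"
    by (intro mean_mono mult_right_mono) auto
  also have "\<dots> \<le> pnorm V (1/2) (\<lambda>y. \<bar>fluct E y\<bar>) * pnorm V (1/2) (indicator F)"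
    using finite_space V_ne by (intro Hoelder) auto
  also have "pnorm V (1/2) (indicator F) = dens V F powr (1/2)"
    using EF finite_space V_ne by (intro pnorm_indicator) auto
  also have "pnorm V (1/2) (\<lambda>y. \<bar>fluct E y\<bar>) = sqrt (mean V (\<lambda>y. (fluct E y)\<^sup>2))"
    by (simp add: pnorm_def powr_half_sqrt mean_nonneg)
  also have "sqrt (mean V (\<lambda>y. (fluct E y)\<^sup>2)) * dens V F powr (1/2) \<le>
      sqrt (9 / real q ^ (d - 1) * dens V E) * dens V F powr (1/2)"
    using fluct_odd[OF assms EF(1)] by (intro mult_right_mono real_sqrt_le_mono) auto
  also have "sqrt (9 / real q ^ (d - 1) * dens V E) = 3 / sqrt (real q ^ (d - 1)) * dens V E powr (1/2)"
    by (simp add: real_sqrt_mult real_sqrt_divide powr_half_sqrt dens_nonneg)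
  finally show "pairing V avg_kernel (indicator E) (indicator F) \<le>
      1 * (dens V E * dens V F) + 3 / sqrt (real q ^ (d - 1)) * (dens V E powr (1 / 2) * dens V F powr (1 / 2))"
    by (simp add: pairing_fluct mean_indicator[OF finite_space EF(2)] mult.assoc)
qed

text \<open>Of the d - 1 factors, d - 3 are estimated by the sup bound and two by the mean square.
  The exponent d - 2 + 2/d is what both regimes of the density m support; 36 = 27 + 9 comes from the
  regime of small m.\<close>

lemma fluct_power_le:
  assumes "even d" and E: "E \<subseteq> V" "E \<noteq> {}"
  shows "mean V (\<lambda>y. \<bar>fluct E y\<bar> ^ (d - 1)) \<le> 36 * 3 ^ (d - 3) * dens V E powr (real d - 2 + 2 / real d)"
proof -
  define m where "m = dens V E"
  define M2 where "M2 = mean V (\<lambda>y. (fluct E y)\<^sup>2)"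
  define Q where "Q = real q"
  have d: "3 < d" using d_ge_3 \<open>even d\<close> by (cases "d = 3") auto
  have Q: "1 < Q" using q_ge_3 by (simp add: Q_def)
  have m: "0 < m" "m \<le> 1" using E finite_space by (auto simp: m_def intro!: dens_pos dens_le_1)
  \<comment> \<open>A nonempty set has at least one point; this lower limit of m is needed to turn
    q^-2 into m^(2/d).\<close>
  have mN: "Q powr (- real d) \<le> m"
  proof -
    have "card E \<ge> 1" using E finite_space by (metis One_nat_def Suc_leI card_gt_0_iff finite_subset)
    then have "1 / real N \<le> m" unfolding m_def dens_def by (intro divide_right_mono) auto
    then show ?thesis using Q by (simp add: card_space Q_def powr_minus powr_realpow divide_inverse)
  qed
  have "mean V (\<lambda>y. \<bar>fluct E y\<bar> ^ (d - 1)) \<le> mean V (\<lambda>y. (3 * Q * m) ^ (d - 3) * (fluct E y)\<^sup>2)"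
  proof (rule mean_mono)
    fix y assume y: "y \<in> V"
    have "d - 1 = (d - 3) + 2" using d by simp
    then have "\<bar>fluct E y\<bar> ^ (d - 1) = \<bar>fluct E y\<bar> ^ (d - 3) * (fluct E y)\<^sup>2"
      by (simp only: power_add power2_abs)
    also have "\<dots> \<le> (3 * Q * m) ^ (d - 3) * (fluct E y)\<^sup>2"
      using abs_fluct_le[OF E(1) y] by (intro mult_right_mono power_mono) (auto simp: Q_def m_def)
    finally show "\<bar>fluct E y\<bar> ^ (d - 1) \<le> (3 * Q * m) ^ (d - 3) * (fluct E y)\<^sup>2" .
  qed
  also have "\<dots> = 3 ^ (d - 3) * (Q ^ (d - 3) * m ^ (d - 3) * M2)"
    by (simp add: mean_cmult M2_def power_mult_distrib)
  also have "\<dots> \<le> 3 ^ (d - 3) * (36 * m powr (real d - 2 + 2 / real d))"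
  proof (rule mult_left_mono)
    have pw: "Q ^ (d - 3) = Q powr (real d - 3)" "m ^ (d - 3) = m powr (real d - 3)"
      "Q ^ (d - 2) = Q powr (real d - 2)" "Q ^ (d - 1) = Q powr (real d - 1)"
      "sqrt (Q ^ d) = Q powr (real d / 2)"
      using Q m d by (simp_all add: powr_realpow[symmetric] of_nat_diff powr_half_sqrt[symmetric] powr_powr)
    have M2: "M2 \<le> 9 / Q powr (real d - 2) * m"
      "M2 \<le> 27 / Q powr (real d - 1) * m + 9 * Q\<^sup>2 / Q powr (real d / 2) * m\<^sup>2"
      using fluct_even[OF assms(1) E(1)] fluct_even_small[OF assms(1) E(1)]
      by (simp_all add: M2_def m_def flip: Q_def pw)
    have M2_0: "0 \<le> M2" by (simp add: M2_def mean_nonneg)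
    have mm: "m powr (real d - 3) * m = m powr (real d - 2)"
      using m powr_add[of m "real d - 3" 1] by simp
    have rd: "0 < real d" using d by simp
    show "Q ^ (d - 3) * m ^ (d - 3) * M2 \<le> 36 * m powr (real d - 2 + 2 / real d)"
    \<comment> \<open>At m = q^(-d/2) the general mean square bound and the quadratic term of the
      refined one coincide. Above it the general bound leaves a factor q^-1, which is at most
      m^(2/d).\<close>
    proof (cases "Q powr (- real d / 2) \<le> m")
      case True
      have "(Q powr (- real d / 2)) powr (2 / real d) \<le> m powr (2 / real d)"
        using True rd by (intro powr_mono2) auto
      then have 1: "Q powr (- 1) \<le> m powr (2 / real d)" using rd by (simp add: powr_powr)
      have "Q ^ (d - 3) * m ^ (d - 3) * M2 \<le> Q ^ (d - 3) * m ^ (d - 3) * (9 / Q powr (real d - 2) * m)"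
        using Q m by (intro mult_left_mono M2) auto
      also have "\<dots> = 9 * (Q powr (real d - 3) / Q powr (real d - 2)) * (m powr (real d - 3) * m)"
        by (simp add: pw)
      also have "Q powr (real d - 3) / Q powr (real d - 2) = Q powr (- 1)"
        by (simp flip: powr_diff)
      also have "9 * Q powr (- 1) * (m powr (real d - 3) * m) \<le> 36 * (m powr (2 / real d) * m powr (real d - 2))"
        unfolding mm mult.assoc using 1 by (intro mult_mono mult_right_mono) auto
      also have "\<dots> = 36 * m powr (real d - 2 + 2 / real d)" by (simp flip: powr_add add: add.commute)
      finally show ?thesis .
    next
      case False
      have "(Q powr (- real d)) powr (2 / real d) \<le> m powr (2 / real d)"
        using mN rd by (intro powr_mono2) auto
      then have 1: "Q powr (- 2) \<le> m powr (2 / real d)" using rd by (simp add: powr_powr)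
      have "m powr (1 - 2 / real d) \<le> (Q powr (- real d / 2)) powr (1 - 2 / real d)"
        using False m rd d by (intro powr_mono2) auto
      also have "\<dots> = Q powr ((- real d / 2) * (1 - 2 / real d))" by (rule powr_powr)
      also have "(- real d / 2) * (1 - 2 / real d) = 1 - real d / 2" using rd by (simp add: field_simps)
      finally have 2: "m powr (1 - 2 / real d) \<le> Q powr (1 - real d / 2)" .
      \<comment> \<open>The quadratic term leaves m q^(d/2 - 1); splitting off m^(2/d), the
        remaining power of m cancels q^(d/2 - 1) by the upper limit on m.\<close>
      have "m * Q powr (real d / 2 - 1) = m powr (1 - 2 / real d) * m powr (2 / real d) * Q powr (real d / 2 - 1)"
        using m by (simp flip: powr_add)
      also have "\<dots> \<le> Q powr (1 - real d / 2) * m powr (2 / real d) * Q powr (real d / 2 - 1)"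
        using 2 by (intro mult_right_mono) auto
      also have "\<dots> = (Q powr (1 - real d / 2) * Q powr (real d / 2 - 1)) * m powr (2 / real d)" by simp
      also have "\<dots> = m powr (2 / real d)" using Q by (simp flip: powr_add)
      finally have 3: "m * Q powr (real d / 2 - 1) \<le> m powr (2 / real d)" .
      have "Q ^ (d - 3) * m ^ (d - 3) * M2 \<le> Q ^ (d - 3) * m ^ (d - 3) *
          (27 / Q powr (real d - 1) * m + 9 * Q\<^sup>2 / Q powr (real d / 2) * m\<^sup>2)"
        using Q m by (intro mult_left_mono M2) auto
      also have "\<dots> = 27 * (Q powr (real d - 3) / Q powr (real d - 1)) * (m powr (real d - 3) * m) +
          9 * (Q powr (real d - 3) * Q powr 2 / Q powr (real d / 2)) * (m powr (real d - 3) * m) * m"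
        using Q by (simp add: pw powr_realpow[of Q 2] power2_eq_square algebra_simps)
      also have "Q powr (real d - 3) / Q powr (real d - 1) = Q powr (- 2)" by (simp flip: powr_diff)
      also have "Q powr (real d - 3) * Q powr 2 / Q powr (real d / 2) = Q powr (real d / 2 - 1)"
        by (simp flip: powr_add powr_diff)
      also have "27 * Q powr (- 2) * (m powr (real d - 3) * m) + 9 * Q powr (real d / 2 - 1) * (m powr (real d - 3) * m) * m
          = m powr (real d - 2) * (27 * Q powr (- 2) + 9 * (m * Q powr (real d / 2 - 1)))"
        unfolding mm by (simp add: algebra_simps)
      also have "\<dots> \<le> m powr (real d - 2) * (27 * m powr (2 / real d) + 9 * m powr (2 / real d))"
        using 1 3 by (intro mult_left_mono add_mono) auto
      also have "\<dots> = 36 * m powr (real d - 2 + 2 / real d)" by (simp add: powr_add)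
      finally show ?thesis .
    qed
  qed simp
  finally show ?thesis by (simp add: m_def mult_ac)
qed

text \<open>An arbitrary g in place of an indicator costs nothing, since Hoelder is applied to the
  moment of the fluctuation. This one-sided form carries the endpoint estimates: summed over layers
  of f it gives the strong bound at \<open>P1\<close>, transposed it gives the weak bound at
  \<open>P2\<close>.\<close>

lemma even_test:
  assumes "even d" and E: "E \<subseteq> V" and g: "\<And>y. y \<in> V \<Longrightarrow> 0 \<le> g y"
  shows "pairing V avg_kernel (indicator E) g \<le>
    (1 + (36 * 3 ^ (d - 3)) powr beta1 d) * (dens V E powr alpha1 d * pnorm V (1 - beta1 d) g)"
proof (cases "E = {}")
  case True
  then show ?thesis by (simp add: pairing_eq dens_def)
next
  case False
  note V = finite_space V_ne
  define m where "m = dens V E"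
  have m: "0 < m" "m \<le> 1" using False E finite_space by (auto simp: m_def intro!: dens_pos dens_le_1)
  have d: "3 < d" using d_ge_3 \<open>even d\<close> by (cases "d = 3") auto
  have b: "0 < beta1 d" "beta1 d < 1" using d by (auto simp: beta1_def)
  have a: "alpha1 d \<le> 1" using d by (simp add: alpha1_def divide_le_eq power2_eq_square algebra_simps)
  define C :: real where "C = 36 * 3 ^ (d - 3)"
  have "pnorm V (beta1 d) (\<lambda>y. \<bar>fluct E y\<bar>) = mean V (\<lambda>y. \<bar>fluct E y\<bar> ^ (d - 1)) powr beta1 d"
  proof -
    have "\<bar>x\<bar> powr (real d - 1) = \<bar>x\<bar> ^ (d - 1)" for x :: real
      using d powr_realpow'[of "\<bar>x\<bar>" "d - 1"] by (simp add: of_nat_diff)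
    then show ?thesis using b by (simp add: pnorm_def beta1_def)
  qed
  also have "\<dots> \<le> (C * m powr (real d - 2 + 2 / real d)) powr beta1 d"
    unfolding C_def m_def using fluct_power_le[OF assms(1) E False] b
    by (intro powr_mono2) (auto intro!: mean_nonneg)
  also have "\<dots> = C powr beta1 d * m powr ((real d - 2 + 2 / real d) * beta1 d)"
    by (simp add: powr_mult powr_powr C_def)
  also have "(real d - 2 + 2 / real d) * beta1 d = alpha1 d"
    using d by (simp add: alpha1_def beta1_def field_simps power2_eq_square)
  finally have pn: "pnorm V (beta1 d) (\<lambda>y. \<bar>fluct E y\<bar>) \<le> C powr beta1 d * m powr alpha1 d" .
  have "mean V (\<lambda>y. fluct E y * g y) \<le> mean V (\<lambda>y. \<bar>fluct E y\<bar> * g y)"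
    using g by (intro mean_mono mult_right_mono) auto
  also have "\<dots> \<le> pnorm V (beta1 d) (\<lambda>y. \<bar>fluct E y\<bar>) * pnorm V (1 - beta1 d) g"
    using V b g by (intro Hoelder) auto
  also have "\<dots> \<le> C powr beta1 d * m powr alpha1 d * pnorm V (1 - beta1 d) g"
    by (intro mult_right_mono pn pnorm_nonneg V)
  finally have 1: "mean V (\<lambda>y. fluct E y * g y) \<le> C powr beta1 d * m powr alpha1 d * pnorm V (1 - beta1 d) g" .
  \<comment> \<open>The expected part \<open>m * mean V g\<close> fits under the same bound, because
    m \<le> m powr \<open>alpha1 d\<close> for m \<le> 1 and \<open>alpha1 d\<close> \<le>
    1.\<close>
  have "mean V g = pnorm V 1 g" unfolding pnorm_one using g by (intro mean_cong) simp
  also have "\<dots> \<le> pnorm V (1 - beta1 d) g" using b V by (intro pnorm_antimono) auto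
  finally have "m * mean V g \<le> m powr alpha1 d * pnorm V (1 - beta1 d) g"
    using m a powr_mono'[of "alpha1 d" 1 m] g by (intro mult_mono) (auto intro: mean_nonneg)
  with 1 show ?thesis unfolding pairing_fluct C_def[symmetric] m_def[symmetric] by (simp add: algebra_simps)
qed

end

section \<open>Averaging over a family of quadrics\<close>

lemma recip_finite:
  assumes "1 \<le> (p :: ennreal)" "p \<noteq> \<infinity>"
  shows "recip p = 1 / enn2real p" "1 \<le> enn2real p"
proof -
  have p: "p = ennreal (enn2real p)" using assms(2) by (simp add: ennreal_enn2real less_top)
  have "enn2real 1 \<le> enn2real p" using assms by (intro enn2real_mono) (auto simp: less_top)
  then show 1: "1 \<le> enn2real p" by simp
  have "inverse p = ennreal (inverse (enn2real p))"
    using 1 by (subst p) (rule inverse_ennreal, simp)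
  then show "recip p = 1 / enn2real p" using 1 by (simp add: recip_def divide_inverse)
qed

lemma recip_infinity: "recip \<infinity> = 0"
  by (simp add: recip_def)

lemmas recip_top [simp] = recip_infinity[unfolded infinity_ennreal_def]

lemma recip_bounds:
  assumes "1 \<le> (p :: ennreal)"
  shows "0 \<le> recip p" "recip p \<le> 1"
  using recip_finite[OF assms] by (cases "p = \<infinity>", auto)+

lemma integral_dx:
  fixes f :: "_ \<Rightarrow> real"
  assumes "finite (carrier (coord_space K d))"
  shows "(\<integral>x. f x \<partial>dx K d) = mean (carrier (coord_space K d)) f"
  unfolding dx_def mean_def using integral_uniform_count_measure[OF assms, of f] by simp

lemma AE_dx:
  assumes "finite (carrier (coord_space K d))"
  shows "(AE x in dx K d. P x) \<longleftrightarrow> (\<forall>x\<in>carrier (coord_space K d). P x)"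
  unfolding dx_def uniform_count_measure_def using assms
  by (subst AE_point_measure) (auto simp: card_gt_0_iff)

lemma space_dx: "space (dx K d) = carrier (coord_space K d)"
  by (simp add: dx_def uniform_count_measure_def space_point_measure)

lemma measurable_dx: "f \<in> borel_measurable (dx K d)"
  by (simp add: dx_def uniform_count_measure_def)

text \<open>Every point has positive mass, so no point can be discarded as a null set and the
  essential supremum is the maximum.\<close>

lemma Lp_norm_eq_pnorm:
  assumes "1 \<le> p" and V: "finite (carrier (coord_space K d))" "carrier (coord_space K d) \<noteq> {}"
  shows "Lp_norm (dx K d) p f = pnorm (carrier (coord_space K d)) (recip p) (\<lambda>x. cmod (f x))"
proof (cases "p = \<infinity>")
  case True
  let ?V = "carrier (coord_space K d)" and ?m = "Max ((\<lambda>x. \<bar>cmod (f x)\<bar>) ` carrier (coord_space K d))"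
  have le: "cmod (f x) \<le> ?m" if "x \<in> ?V" for x using le_pnorm_0[OF V(1) that, of "\<lambda>x. cmod (f x)"] by (simp add: pnorm_def)
  have "?m \<in> (\<lambda>x. \<bar>cmod (f x)\<bar>) ` ?V" using V by (intro Max_in) auto
  then obtain x where x: "x \<in> ?V" "?m = cmod (f x)" by (rule imageE) simp
  have "esssup (dx K d) (\<lambda>x. ennreal (cmod (f x))) = Inf {z. \<forall>x\<in>?V. ennreal (cmod (f x)) \<le> z}"
    by (simp add: esssup_eq_AE[OF measurable_dx] AE_dx[OF V(1)])
  also have "\<dots> = ennreal ?m"
  proof (rule antisym)
    show "Inf {z. \<forall>x\<in>?V. ennreal (cmod (f x)) \<le> z} \<le> ennreal ?m"
      using le by (intro Inf_lower) (simp add: ennreal_leI)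
    show "ennreal ?m \<le> Inf {z. \<forall>x\<in>?V. ennreal (cmod (f x)) \<le> z}"
      using x by (intro Inf_greatest) simp
  qed
  finally have "enn2real (esssup (dx K d) (\<lambda>x. ennreal (cmod (f x)))) = ?m"
    using x(2) by simp
  then show ?thesis using True by (simp add: Lp_norm_def pnorm_def)
next
  case False
  note r = recip_finite[OF assms(1) False]
  then have "recip p \<noteq> 0" by auto
  moreover have "1 / recip p = enn2real p" using r by simp
  ultimately show ?thesis using False r by (simp add: Lp_norm_def pnorm_def integral_dx[OF V(1)])
qed

text \<open>\<open>avg_kernel\<close> in terms of K, d and Q alone, so that a whole family can be
  named before characters are chosen for its fields.\<close>

definition quad_kernel :: "'a ring \<Rightarrow> nat \<Rightarrow> ((nat \<Rightarrow> 'a) \<Rightarrow> 'a) \<Rightarrow> (nat \<Rightarrow> 'a) \<Rightarrow> (nat \<Rightarrow> 'a) \<Rightarrow> real" where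
  "quad_kernel K d Q x y = indicator (quadric K d Q) (y \<ominus>\<^bsub>coord_space K d\<^esub> x) / card (quadric K d Q)"

locale quadric_family =
  fixes d :: nat and I :: "nat set" and K :: "nat \<Rightarrow> 'a ring" and Q :: "nat \<Rightarrow> (nat \<Rightarrow> 'a) \<Rightarrow> 'a"
  assumes family: "form_family d I K Q" and d_ge_3: "3 \<le> d"
begin

abbreviation sp :: "nat \<Rightarrow> (nat \<Rightarrow> 'a) set" where "sp q \<equiv> carrier (coord_space (K q) d)"

abbreviation ker :: "nat \<Rightarrow> (nat \<Rightarrow> 'a) \<Rightarrow> (nat \<Rightarrow> 'a) \<Rightarrow> real" where "ker q \<equiv> quad_kernel (K q) d (Q q)"

lemma
  assumes "q \<in> I"
  shows card_K: "card (carrier (K q)) = q" and finite_K: "finite (carrier (K q))"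
proof -
  show card: "card (carrier (K q)) = q" using family assms by (auto simp: form_family_def Coset.order_def)
  have "odd q" using family assms by (auto simp: form_family_def)
  then have "q \<noteq> 0" by (rule contrapos_nn) simp
  then show "finite (carrier (K q))" using card by (intro card_ge_0_finite) simp
qed

lemma quad_space:
  assumes q: "q \<in> I"
  obtains \<psi> where
    "quadratic_space_dim (K q) \<psi> (coord_space (K q) d) (Q q) (polar_form (K q) d (Q q)) d"
    "quadratic_space_dim.avg_kernel (K q) (coord_space (K q) d) (Q q) = ker q"
    "quadratic_space.S (K q) (coord_space (K q) d) (Q q) = quadric (K q) d (Q q)"
proof -
  have "field (K q)" "odd q" "nondegenerate_form (K q) d (Q q)"
    using family q by (auto simp: form_family_def)
  then obtain \<psi> where qs: "quadratic_space_dim (K q) \<psi> (coord_space (K q) d) (Q q) (polar_form (K q) d (Q q)) d"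
    using quadratic_space_coord_space[of "K q" d "Q q"] finite_K[OF q] card_K[OF q] d_ge_3 by auto
  interpret quadratic_space_dim "K q" \<psi> "coord_space (K q) d" "Q q" "polar_form (K q) d (Q q)" d by (rule qs)
  have S: "S = quadric (K q) d (Q q)" by (simp add: S_def quadric_def)
  then have "avg_kernel = ker q" by (intro ext) (simp add: avg_kernel_def quad_kernel_def)
  then show thesis by (rule that[OF qs _ S])
qed

definition W where "W = (\<lambda>q. (sp q, ker q)) ` I"

lemma sp_finite: "q \<in> I \<Longrightarrow> finite (sp q)" using finite_coord_space[OF finite_K] .

lemma sp_ne:
  assumes "q \<in> I" shows "sp q \<noteq> {}"
proof -
  obtain \<psi> where "quadratic_space_dim (K q) \<psi> (coord_space (K q) d) (Q q) (polar_form (K q) d (Q q)) d"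
    using quad_space[OF assms] .
  then interpret quadratic_space_dim "K q" \<psi> "coord_space (K q) d" "Q q" "polar_form (K q) d (Q q)" d .
  show ?thesis by (rule V_ne)
qed

sublocale markov_family W
proof
  fix V w x y assume "(V, w) \<in> W"
  then obtain q where q: "q \<in> I" "V = sp q" "w = ker q" by (auto simp: W_def)
  obtain \<psi> where qs: "quadratic_space_dim (K q) \<psi> (coord_space (K q) d) (Q q) (polar_form (K q) d (Q q)) d"
    and ker: "quadratic_space_dim.avg_kernel (K q) (coord_space (K q) d) (Q q) = ker q" using quad_space[OF q(1)] .
  interpret quadratic_space_dim "K q" \<psi> "coord_space (K q) d" "Q q" "polar_form (K q) d (Q q)" d by (rule qs)
  show "finite V" "V \<noteq> {}" using q sp_finite sp_ne by auto
  show "0 \<le> w x y" if "x \<in> V" "y \<in> V" using avg_kernel_nonneg[of x y] by (simp add: q(3) ker)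
  show "w x y = w y x" if "x \<in> V" "y \<in> V" using avg_kernel_commute[of x y] that by (simp add: q ker)
  show "(\<Sum>x\<in>V. w x y) = 1" if "y \<in> V" using avg_kernel_stoch[of y] that by (simp add: q ker)
qed

text \<open>The kernel is nonnegative, so the triangle inequality reduces complex functions to their
  moduli, and real functions show that nothing is lost.\<close>

lemma averaging_kop:
  assumes q: "q \<in> I" and y: "y \<in> sp q"
  shows "cmod (averaging (K q) d (Q q) f y) \<le> kop (sp q) (ker q) (\<lambda>x. cmod (f x)) y"
    and "averaging (K q) d (Q q) (\<lambda>x. complex_of_real (g x)) y = complex_of_real (kop (sp q) (ker q) g y)"
proof -
  obtain \<psi> where qs: "quadratic_space_dim (K q) \<psi> (coord_space (K q) d) (Q q) (polar_form (K q) d (Q q)) d"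
    and ker: "quadratic_space_dim.avg_kernel (K q) (coord_space (K q) d) (Q q) = ker q"
    and S: "quadratic_space.S (K q) (coord_space (K q) d) (Q q) = quadric (K q) d (Q q)" using quad_space[OF q] .
  interpret quadratic_space_dim "K q" \<psi> "coord_space (K q) d" "Q q" "polar_form (K q) d (Q q)" d by (rule qs)
  have ne: "carrier (K q) \<noteq> {}" by auto
  note k = kop_eq[OF y, unfolded ker S]
  show "averaging (K q) d (Q q) (\<lambda>x. complex_of_real (g x)) y = complex_of_real (kop (sp q) (ker q) g y)"
    by (simp add: averaging_eq[OF finite_K[OF q] ne] k)
  show "cmod (averaging (K q) d (Q q) f y) \<le> kop (sp q) (ker q) (\<lambda>x. cmod (f x)) y"
    by (simp add: averaging_eq[OF finite_K[OF q] ne] k norm_divide divide_right_mono norm_sum)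
qed

lemma Lp_norm_eq:
  "q \<in> I \<Longrightarrow> 1 \<le> p \<Longrightarrow> Lp_norm (dx (K q) d) p f = pnorm (sp q) (recip p) (\<lambda>x. cmod (f x))"
  using sp_finite sp_ne by (intro Lp_norm_eq_pnorm) auto

lemma Lp_norm_averaging_le:
  assumes "q \<in> I" "1 \<le> r"
  shows "Lp_norm (dx (K q) d) r (averaging (K q) d (Q q) f) \<le> pnorm (sp q) (recip r) (kop (sp q) (ker q) (\<lambda>x. cmod (f x)))"
  unfolding Lp_norm_eq[OF assms] using sp_finite[OF assms(1)] sp_ne[OF assms(1)] averaging_kop(1)[OF assms(1)] recip_bounds[OF assms(2)]
  by (intro pnorm_mono) (auto intro: order_trans[OF _ abs_ge_self])

lemma Lp_norm_averaging_of_real: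
  assumes "q \<in> I" "1 \<le> r"
  shows "Lp_norm (dx (K q) d) r (averaging (K q) d (Q q) (\<lambda>x. complex_of_real (g x))) = pnorm (sp q) (recip r) (kop (sp q) (ker q) g)"
  unfolding Lp_norm_eq[OF assms] using averaging_kop(2)[OF assms(1), of _ g]
  by (intro pnorm_cong) simp

lemma W_I: "q \<in> I \<Longrightarrow> (sp q, ker q) \<in> W" by (simp add: W_def)

text \<open>A bound in the wrong direction, with a loss depending on q. It serves to show that
  admissible constants exist for each single q, so that the infimum in \<open>avg_const\<close> is
  meaningful.\<close>

lemma pnorm_0_le:
  assumes "finite V" "V \<noteq> {}" "0 \<le> a"
  shows "pnorm V 0 f \<le> real (card V) powr a * pnorm V a f"
proof (cases "a = 0")
  case True
  have "card V > 0" using assms by (simp add: card_gt_0_iff)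
  then show ?thesis using True by simp
next
  case False
  have "\<bar>f x\<bar> \<le> real (card V) powr a * pnorm V a f" if x: "x \<in> V" for x
  proof -
    have c: "real (card V) > 0" using assms by (simp add: card_gt_0_iff)
    have "\<bar>f x\<bar> powr (1/a) / card V \<le> mean V (\<lambda>x. \<bar>f x\<bar> powr (1/a))"
      by (rule mean_ge_single) (use assms x in auto)
    then have "\<bar>f x\<bar> powr (1/a) \<le> real (card V) * mean V (\<lambda>x. \<bar>f x\<bar> powr (1/a))"
      using c by (simp add: divide_le_eq mult.commute)
    then have "(\<bar>f x\<bar> powr (1/a)) powr a \<le> (real (card V) * mean V (\<lambda>x. \<bar>f x\<bar> powr (1/a))) powr a"
      using assms(3) by (intro powr_mono2) auto
    then show ?thesis using False assms(3) by (simp add: powr_powr powr_mult pnorm_def mean_nonneg)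
  qed
  then show ?thesis using assms by (simp add: pnorm_def[of V 0])
qed

lemma avg_bounded_iff_strong:
  assumes "1 \<le> p" "1 \<le> r"
  shows "avg_bounded d I K Q p r \<longleftrightarrow> strong (recip p) (recip r)"
proof -
  define adm where "adm = (\<lambda>q. {A. 0 \<le> A \<and>
       (\<forall>f. Lp_norm (dx (K q) d) r (averaging (K q) d (Q q) f) \<le> A * Lp_norm (dx (K q) d) p f)})"
  have const: "avg_const (K q) d (Q q) p r = Inf (adm q)" for q by (simp add: avg_const_def adm_def)
  have bdd: "bdd_below (adm q)" for q by (rule bdd_belowI[of _ 0]) (simp add: adm_def)
  have adm: "A \<in> adm q" if q: "q \<in> I" and A: "0 \<le> A"
    and *: "\<And>f. \<forall>x\<in>sp q. 0 \<le> f x \<Longrightarrow> pnorm (sp q) (recip r) (kop (sp q) (ker q) f) \<le> A * pnorm (sp q) (recip p) f" for A q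
    unfolding adm_def
  proof (intro CollectI conjI allI A)
    fix f
    show "Lp_norm (dx (K q) d) r (averaging (K q) d (Q q) f) \<le> A * Lp_norm (dx (K q) d) p f"
      unfolding Lp_norm_eq[OF q assms(1)]
      by (rule order_trans[OF Lp_norm_averaging_le[OF q assms(2)]]) (rule *, simp)
  qed
  have nonempty: "adm q \<noteq> {}" if q: "q \<in> I" for q
  proof -
    note V = sp_finite[OF q] sp_ne[OF q]
    have "real (card (sp q)) powr recip p \<in> adm q"
    proof (rule adm[OF q])
      fix f :: "(nat \<Rightarrow> 'a) \<Rightarrow> real" assume f: "\<forall>x\<in>sp q. 0 \<le> f x"
      have "pnorm (sp q) (recip r) (kop (sp q) (ker q) f) \<le> pnorm (sp q) 0 (kop (sp q) (ker q) f)"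
        using recip_bounds[OF assms(2)] by (intro pnorm_antimono V) auto
      also have "\<dots> \<le> pnorm (sp q) 0 f"
      proof -
        have "\<bar>kop (sp q) (ker q) f y\<bar> \<le> pnorm (sp q) 0 f" if y: "y \<in> sp q" for y
        proof -
          have "f x \<le> pnorm (sp q) 0 f" if "x \<in> sp q" for x using le_pnorm_0[OF V(1) that, of f] by simp
          then have "kop (sp q) (ker q) f y \<le> pnorm (sp q) 0 f" by (rule kop_le_Max[OF W_I[OF q] y])
          then show ?thesis using kop_ge_0[OF W_I[OF q] f y] by simp
        qed
        then show ?thesis using V by (simp add: pnorm_def[of _ 0 "kop (sp q) (ker q) f"])
      qed
      also have "\<dots> \<le> real (card (sp q)) powr recip p * pnorm (sp q) (recip p) f"
        using recip_bounds[OF assms(1)] by (intro pnorm_0_le V)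
      finally show "pnorm (sp q) (recip r) (kop (sp q) (ker q) f) \<le> real (card (sp q)) powr recip p * pnorm (sp q) (recip p) f" .
    qed simp
    then show ?thesis by blast
  qed
  show ?thesis
  proof
    assume "strong (recip p) (recip r)"
    then obtain C where C: "0 \<le> C" "\<And>V w f. (V, w) \<in> W \<Longrightarrow> \<forall>x\<in>V. 0 \<le> f x \<Longrightarrow>
      pnorm V (recip r) (kop V w f) \<le> C * pnorm V (recip p) f" by (rule strongE) blast
    have "avg_const (K q) d (Q q) p r \<le> C" if q: "q \<in> I" for q
      unfolding const by (rule cInf_lower[OF adm[OF q C(1) C(2)[OF W_I[OF q]]] bdd])
    then show "avg_bounded d I K Q p r" unfolding avg_bounded_def by blast
  next
    assume "avg_bounded d I K Q p r"
    then obtain C where C: "\<And>q. q \<in> I \<Longrightarrow> Inf (adm q) \<le> C" unfolding avg_bounded_def const by blast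
    show "strong (recip p) (recip r)"
    proof (rule strongI)
      show "0 \<le> \<bar>C\<bar> + 1" by simp
      fix V w and f :: "(nat \<Rightarrow> 'a) \<Rightarrow> real" assume "(V, w) \<in> W" and f: "\<forall>x\<in>V. 0 \<le> f x"
      then obtain q where q: "q \<in> I" "V = sp q" "w = ker q" by (auto simp: W_def)
      \<comment> \<open>The slack 1 produces an admissible constant below |C| + 1 without proving
        that the infimum is attained.\<close>
      have "Inf (adm q) < \<bar>C\<bar> + 1" using C[OF q(1)] by linarith
      from cInf_lessD[OF nonempty[OF q(1)] this] obtain A where A: "A \<in> adm q" "A < \<bar>C\<bar> + 1" by blast
      let ?g = "\<lambda>x. complex_of_real (f x)"
      have "Lp_norm (dx (K q) d) r (averaging (K q) d (Q q) ?g) \<le> A * Lp_norm (dx (K q) d) p ?g"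
        using A(1) unfolding adm_def by blast
      then have "pnorm V (recip r) (kop V w f) \<le> A * pnorm V (recip p) (\<lambda>x. cmod (?g x))"
        unfolding Lp_norm_averaging_of_real[OF q(1) assms(2)] Lp_norm_eq[OF q(1) assms(1)] q(2,3) .
      also have "pnorm V (recip p) (\<lambda>x. cmod (?g x)) = pnorm V (recip p) f" by (rule pnorm_cong) simp
      also have "A * pnorm V (recip p) f \<le> (\<bar>C\<bar> + 1) * pnorm V (recip p) f"
        using A(2) sp_finite[OF q(1)] sp_ne[OF q(1)] by (intro mult_right_mono pnorm_nonneg) (auto simp: q)
      finally show "pnorm V (recip r) (kop V w f) \<le> (\<bar>C\<bar> + 1) * pnorm V (recip p) f" .
    qed
  qed
qed

end

section \<open>The regions of exponents\<close>

lemma convex_halfplane: "convex {p :: real \<times> real. \<alpha> * fst p + \<beta> * snd p \<le> \<gamma>}"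
proof -
  have "{p :: real \<times> real. \<alpha> * fst p + \<beta> * snd p \<le> \<gamma>} = {p. inner (\<alpha>, \<beta>) p \<le> \<gamma>}"
    by (auto simp: inner_prod_def)
  then show ?thesis by (simp only: convex_halfspace_le)
qed

text \<open>The vertical line at abscissa \<open>a\<close> meets the chord at height l and the top
  edge at height 1; both points lie in H, and b is between the two heights.\<close>

lemma mem_convex_above_chord:
  fixes H :: "(real \<times> real) set"
  assumes H: "convex H" "(x0, y0) \<in> H" "(x1, y1) \<in> H" "(0, 1) \<in> H" "(1, 1) \<in> H"
    and a: "x0 < x1" "x0 \<le> a" "a \<le> x1" "0 \<le> a" "a \<le> 1"
    and b: "(a - x0) * (y1 - y0) \<le> (b - y0) * (x1 - x0)" "b \<le> 1"
  shows "(a, b) \<in> H"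
proof -
  define t where "t = (a - x0) / (x1 - x0)"
  define l where "l = (1 - t) * y0 + t * y1"
  have t01: "0 \<le> t" "t \<le> 1" using a by (auto simp: t_def divide_le_eq)
  have "(1 - t) * x0 + t * x1 = x0 + t * (x1 - x0)" by (simp add: algebra_simps)
  also have "\<dots> = a" using a(1) by (simp add: t_def)
  finally have t: "0 \<le> t" "t \<le> 1" "(1 - t) * x0 + t * x1 = a" using t01 by simp_all
  have low: "(a, l) \<in> H"
    using convexD_alt[OF H(1,2,3) t(1,2)] t(3) by (simp add: l_def)
  have top: "(a, 1) \<in> H"
    using convexD_alt[OF H(1,4,5) a(4,5)] by (simp add: algebra_simps)
  have "l = y0 + t * (y1 - y0)" by (simp add: l_def algebra_simps)
  then have "l - y0 = (a - x0) * (y1 - y0) / (x1 - x0)" by (simp add: t_def)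
  also have "(a - x0) * (y1 - y0) / (x1 - x0) \<le> b - y0" using b(1) a(1) by (simp add: pos_divide_le_eq)
  finally have lb: "l \<le> b" by simp
  show ?thesis
  proof (cases "l = 1")
    case True
    then show ?thesis using lb b(2) top by simp
  next
    case False
    define s where "s = (b - l) / (1 - l)"
    have l1: "l < 1" using False lb b(2) by simp
    have s: "0 \<le> s" "s \<le> 1" using lb b(2) l1 by (auto simp: s_def divide_le_eq)
    have "(1 - s) * l + s * 1 = l + s * (1 - l)" by (simp add: algebra_simps)
    also have "\<dots> = b" using l1 by (simp add: s_def)
    finally have "(1 - s) * l + s * 1 = b" .
    moreover have "(1 - s) * a + s * a = a" by (simp add: algebra_simps)
    ultimately show ?thesis using convexD_alt[OF H(1) low top s] by simp
  qed
qed

text \<open>The two slanted inequalities are the lower edges: a = d b joins (0, 0) to the vertex, d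
  a = d - 1 + b joins the vertex to (1, 1). They are also what the test on the quadric and the test
  on a point yield.\<close>

lemma T_region_iff:
  assumes d: "3 \<le> d"
  shows "(a, b) \<in> T_region d \<longleftrightarrow>
    0 \<le> a \<and> a \<le> 1 \<and> b \<le> 1 \<and> a \<le> real d * b \<and> real d * a \<le> real d - 1 + b"
proof -
  define x where "x = real d / (real d + 1)"
  define y where "y = 1 / (real d + 1)"
  have T: "T_region d = convex hull {(0, 0), (0, 1), (1, 1), (x, y)}" by (simp add: T_region_def x_def y_def)
  have xy: "x = real d * y" "x + y = 1" "0 < x" "0 < y" "x < 1" "y < 1" using d by (auto simp: x_def y_def field_simps)
  have "real d * x = real d * (1 - y)" using xy(2) by (simp flip: eq_diff_eq)
  then have dx: "real d * x = real d - 1 + y" using xy(1,2) by (simp add: right_diff_distrib)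
  show ?thesis
  proof
    let ?P = "{p. - 1 * fst p + 0 * snd p \<le> 0} \<inter> {p. 1 * fst p + 0 * snd p \<le> 1} \<inter> {p. 0 * fst p + 1 * snd p \<le> 1} \<inter>
      {p :: real \<times> real. 1 * fst p + (- real d) * snd p \<le> 0} \<inter> {p. real d * fst p + (- 1) * snd p \<le> real d - 1}"
    have "T_region d \<subseteq> ?P"
      unfolding T
    proof (rule hull_minimal)
      show "{(0, 0), (0, 1), (1, 1), (x, y)} \<subseteq> ?P" using d xy dx by simp
      show "convex ?P" by (intro convex_Int convex_halfplane)
    qed
    then show "(a, b) \<in> T_region d \<Longrightarrow> 0 \<le> a \<and> a \<le> 1 \<and> b \<le> 1 \<and> a \<le> real d * b \<and> real d * a \<le> real d - 1 + b"
      by auto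
  next
    assume ab: "0 \<le> a \<and> a \<le> 1 \<and> b \<le> 1 \<and> a \<le> real d * b \<and> real d * a \<le> real d - 1 + b"
    have H: "convex (T_region d)" "(0, 0) \<in> T_region d" "(0, 1) \<in> T_region d" "(1, 1) \<in> T_region d" "(x, y) \<in> T_region d"
      by (auto simp: T intro: hull_inc)
    show "(a, b) \<in> T_region d"
    proof (cases "a \<le> x")
      case True
      have "a * y \<le> real d * b * y" using ab xy by (intro mult_right_mono) auto
      then have "(a - 0) * (y - 0) \<le> (b - 0) * (x - 0)" by (simp add: xy(1) mult_ac)
      then show ?thesis
        using True ab xy(3) by (intro mem_convex_above_chord[OF H(1,2,5,3,4)]) auto
    next
      case False
      have "real d * (a - x) \<le> b - y" using ab dx by (simp add: right_diff_distrib)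
      then have "real d * (a - x) * y \<le> (b - y) * y" using xy by (intro mult_right_mono) auto
      moreover have "1 - y = real d * y" "1 - x = y" using xy(1,2) by linarith+
      ultimately have "(a - x) * (1 - y) \<le> (b - y) * (1 - x)" by (simp add: mult_ac)
      then show ?thesis
        using False ab xy by (intro mem_convex_above_chord[OF H(1,5,4,3,4)]) auto
    qed
  qed
qed

lemma P1_eq: "P1 d = (alpha1 d, beta1 d)"
  by (simp add: P1_def alpha1_def beta1_def)

lemma P2_eq:
  assumes "4 \<le> d"
  shows "P2 d = (1 - beta1 d, 1 - alpha1 d)"
proof -
  define e where "e = real d"
  have e: "e \<noteq> 0" "e - 1 \<noteq> 0" using assms by (auto simp: e_def)
  have "(e - 2) / (e - 1) = 1 - 1 / (e - 1)"
    using e by (simp add: divide_simps)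
  moreover have "(e - 2) / (e * (e - 1)) = 1 - (e\<^sup>2 - 2 * e + 2) / (e * (e - 1))"
    using e by (simp add: divide_simps) (simp add: algebra_simps power2_eq_square)
  ultimately show ?thesis by (simp add: P2_def alpha1_def beta1_def e_def)
qed

text \<open>The last two equations place \<open>P1\<close> on the line of the subspace test and on
  the line of the point test. Reflection places \<open>P2\<close> on the first of these and on a = d
  b.\<close>

lemma vertex_relations:
  assumes d: "4 \<le> d"
  shows "0 < beta1 d" "beta1 d < 1" "alpha1 d < 1" "1 - beta1 d < alpha1 d" "1 - alpha1 d < beta1 d"
    "alpha1 d - beta1 d = (real d - 2) / real d" "real d * alpha1 d = real d - 1 + beta1 d"
proof -
  define e where "e = real d"
  have e: "4 \<le> e" using d by (simp add: e_def)
  have a: "alpha1 d = 1 - (e - 2) / (e * (e - 1))" and b: "beta1 d = 1 / (e - 1)"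
    using e by (simp_all add: alpha1_def beta1_def divide_simps flip: e_def) (simp add: algebra_simps power2_eq_square)
  have pos: "0 < (e - 2) / (e * (e - 1))" using e by simp
  have lt: "(e - 2) / (e * (e - 1)) < 1 / (e - 1)" using e by (simp add: divide_simps)
  show "0 < beta1 d" "beta1 d < 1" "alpha1 d < 1" "1 - beta1 d < alpha1 d" "1 - alpha1 d < beta1 d"
    using e pos lt by (simp_all add: a b)
  have "(e - 2) / (e * (e - 1)) + 1 / (e - 1) = 2 / e"
    using e by (simp add: divide_simps)
  moreover have "(e - 2) / e = 1 - 2 / e" using e by (simp add: divide_simps)
  ultimately show "alpha1 d - beta1 d = (real d - 2) / real d" by (simp add: a b flip: e_def)
  have "e * ((e - 2) / (e * (e - 1))) = 1 - 1 / (e - 1)" using e by (simp add: divide_simps)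
  then show "real d * alpha1 d = real d - 1 + beta1 d" by (simp add: a b right_diff_distrib flip: e_def)
qed

text \<open>One inequality for each of the three lower edges, (0, 0) to \<open>P2\<close>,
  \<open>P2\<close> to \<open>P1\<close>, and \<open>P1\<close> to (1, 1); the converse argues over
  the abscissas of these edges separately.\<close>

lemma Omega_region_iff:
  assumes d: "4 \<le> d"
  shows "(a, b) \<in> Omega_region d \<longleftrightarrow> 0 \<le> a \<and> a \<le> 1 \<and> b \<le> 1 \<and> a \<le> real d * b \<and>
    real d * a \<le> real d - 1 + b \<and> a - b \<le> (real d - 2) / real d"
proof
  note v = vertex_relations[OF d]
  let ?P = "{p. - 1 * fst p + 0 * snd p \<le> 0} \<inter> {p. 1 * fst p + 0 * snd p \<le> 1} \<inter> {p. 0 * fst p + 1 * snd p \<le> 1} \<inter>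
    {p :: real \<times> real. 1 * fst p + (- real d) * snd p \<le> 0} \<inter> {p. real d * fst p + (- 1) * snd p \<le> real d - 1} \<inter>
    {p. 1 * fst p + (- 1) * snd p \<le> (real d - 2) / real d}"
  have "Omega_region d \<subseteq> ?P"
    unfolding Omega_region_def P1_eq P2_eq[OF d]
  proof (rule hull_minimal)
    have 1: "alpha1 d \<le> real d * beta1 d"
    proof -
      have "1 \<le> real d * beta1 d" using d by (simp add: beta1_def le_divide_eq)
      then show ?thesis using v(3) by linarith
    qed
    have 2: "real d * (1 - beta1 d) \<le> real d - 1 + (1 - alpha1 d)"
      using 1 by (simp add: algebra_simps)
    have 3: "0 \<le> alpha1 d" using v by simp
    show "{(0, 0), (0, 1), (1, 1), (alpha1 d, beta1 d), (1 - beta1 d, 1 - alpha1 d)} \<subseteq> ?P"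
      using v d 1 2 3 by (auto simp: algebra_simps)
    show "convex ?P" by (intro convex_Int convex_halfplane)
  qed
  then show "(a, b) \<in> Omega_region d \<Longrightarrow> 0 \<le> a \<and> a \<le> 1 \<and> b \<le> 1 \<and> a \<le> real d * b \<and>
    real d * a \<le> real d - 1 + b \<and> a - b \<le> (real d - 2) / real d"
    by auto
next
  note v = vertex_relations[OF d]
  assume ab: "0 \<le> a \<and> a \<le> 1 \<and> b \<le> 1 \<and> a \<le> real d * b \<and>
    real d * a \<le> real d - 1 + b \<and> a - b \<le> (real d - 2) / real d"
  have H: "convex (Omega_region d)" "(0, 0) \<in> Omega_region d" "(0, 1) \<in> Omega_region d" "(1, 1) \<in> Omega_region d"
    "(alpha1 d, beta1 d) \<in> Omega_region d" "(1 - beta1 d, 1 - alpha1 d) \<in> Omega_region d"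
    by (auto simp: Omega_region_def P1_eq P2_eq[OF d] intro: hull_inc)
  have dpos: "0 < real d" using d by simp
  have a1: "1 - beta1 d = real d * (1 - alpha1 d)" using v(7) by (simp add: algebra_simps)
  consider "a \<le> 1 - beta1 d" | "1 - beta1 d \<le> a" "a \<le> alpha1 d" | "alpha1 d \<le> a" by linarith
  then show "(a, b) \<in> Omega_region d"
  proof cases
    case 1
    have "a * (1 - alpha1 d) \<le> real d * b * (1 - alpha1 d)" using ab v by (intro mult_right_mono) auto
    then have "(a - 0) * (1 - alpha1 d - 0) \<le> (b - 0) * (1 - beta1 d - 0)" by (simp add: a1 mult_ac)
    then show ?thesis
      using 1 ab v by (intro mem_convex_above_chord[OF H(1,2,6,3,4)]) auto
  next
    case 2
    have e: "beta1 d - (1 - alpha1 d) = alpha1 d - (1 - beta1 d)" by simp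
    have "a - (1 - beta1 d) \<le> b - (1 - alpha1 d)" using ab v(6) by simp
    then have "(a - (1 - beta1 d)) * (beta1 d - (1 - alpha1 d)) \<le> (b - (1 - alpha1 d)) * (alpha1 d - (1 - beta1 d))"
      unfolding e using v by (intro mult_right_mono) auto
    then show ?thesis
      using 2 ab v by (intro mem_convex_above_chord[OF H(1,6,5,3,4)]) auto
  next
    case 3
    have "real d * (a - alpha1 d) \<le> b - beta1 d" using ab v(7) by (simp add: algebra_simps)
    then have "real d * (a - alpha1 d) * (1 - alpha1 d) \<le> (b - beta1 d) * (1 - alpha1 d)" using v by (intro mult_right_mono) auto
    then have "(a - alpha1 d) * (1 - beta1 d) \<le> (b - beta1 d) * (1 - alpha1 d)" by (simp add: a1 mult_ac)
    then show ?thesis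
      using 3 ab v by (intro mem_convex_above_chord[OF H(1,5,4,3,4)]) auto
  qed
qed

section \<open>Strong estimates along the edges and in the whole regions\<close>

context markov_family
begin

lemma strong_on_chord:
  assumes r: "restricted x0 y0" "restricted x1 y1" and x: "x0 < x1" "y0 \<noteq> y1" "x0 < a" "a < x1"
    and b: "(b - y0) * (x1 - x0) = (a - x0) * (y1 - y0)" and ab: "0 < b" "b < a" "a \<le> 1"
  shows "strong a b"
proof -
  define \<theta> where "\<theta> = (a - x0) / (x1 - x0)"
  have \<theta>: "0 < \<theta>" "\<theta> < 1" using x by (auto simp: \<theta>_def)
  have "(1 - \<theta>) * x0 + \<theta> * x1 = x0 + \<theta> * (x1 - x0)" by (simp add: algebra_simps)
  also have "\<dots> = a" using x by (simp add: \<theta>_def)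
  finally have a: "(1 - \<theta>) * x0 + \<theta> * x1 = a" .
  have "(1 - \<theta>) * y0 + \<theta> * y1 = y0 + \<theta> * (y1 - y0)" by (simp add: algebra_simps)
  also have "\<dots> = b" using x b[symmetric] by (simp add: \<theta>_def)
  finally have b: "(1 - \<theta>) * y0 + \<theta> * y1 = b" .
  show ?thesis using strong_between[OF r _ x(2) \<theta>] x ab unfolding a b by simp
qed

end

context quadric_family
begin

lemma strong_odd_vertex:
  assumes "odd d"
  shows "strong (real d / (real d + 1)) (1 / (real d + 1))"
proof -
  \<comment> \<open>Solves (1 - \<theta>)(d - 1)/2 = \<theta>, so that the decay q^(-(d-1)/2) of the
    mean square estimate and the growth q of the sup estimate cancel.\<close>
  define \<theta> where "\<theta> = (real d - 1) / (real d + 1)"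
  have d: "3 \<le> real d" using d_ge_3 by simp
  have \<theta>: "0 < \<theta>" "\<theta> < 1" using d by (auto simp: \<theta>_def)
  have a: "(1 - \<theta>) * (1 / 2) + \<theta> * 1 = real d / (real d + 1)"
  proof -
    have "(1 - \<theta>) * (1 / 2) + \<theta> * 1 = (1 + \<theta>) / 2" by (simp add: diff_divide_distrib add_divide_distrib)
    also have "\<dots> = real d / (real d + 1)" using d by (simp add: \<theta>_def divide_simps)
    finally show ?thesis .
  qed
  have "1 / 2 < real d / (real d + 1)" using d by (simp add: less_divide_eq)
  then have side: "0 < real d / (real d + 1)" "real d / (real d + 1) \<le> 1" "1 < real d / (real d + 1) + real d / (real d + 1)"
    using d by (auto simp del: divide_eq_0_iff)
  have b: "1 - 1 / (real d + 1) = real d / (real d + 1)" using d by (simp add: field_simps)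
  note int = restricted_interpolation[OF \<theta>, of "1/2" 1 "1/2" 1, where 'v = "nat \<Rightarrow> 'a", unfolded a, OF side(1,1,2,2,3)]
  show ?thesis
  proof (rule int)
    fix C :: real
    assume C: "0 \<le> C" and *: "\<And>(V::(nat \<Rightarrow> 'a) set) w A0 A1 c f g. finite V \<Longrightarrow> V \<noteq> {} \<Longrightarrow>
      (\<And>x y. x \<in> V \<Longrightarrow> y \<in> V \<Longrightarrow> 0 \<le> w x y) \<Longrightarrow> 0 < A0 \<Longrightarrow> 0 < A1 \<Longrightarrow> 0 \<le> c \<Longrightarrow>
      set_bound V w c A0 (1/2) (1/2) \<Longrightarrow> set_bound V w c A1 1 1 \<Longrightarrow>
      (\<And>x. x \<in> V \<Longrightarrow> 0 \<le> f x) \<Longrightarrow> (\<And>x. x \<in> V \<Longrightarrow> 0 \<le> g x) \<Longrightarrow>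
      pairing V w f g \<le> C * (c + A0 powr (1 - \<theta>) * A1 powr \<theta>) *
        (pnorm V (real d / (real d + 1)) f * pnorm V (real d / (real d + 1)) g)"
    show ?thesis
    proof (rule strong_if_pairing[where C = "C * (1 + 3)"])
      show "0 < 1 / (real d + 1)" "1 / (real d + 1) < 1" using d by auto
      show "0 \<le> C * (1 + 3)" using C by simp
      fix V w and f g :: "(nat \<Rightarrow> 'a) \<Rightarrow> real" assume W: "(V, w) \<in> W" and fg: "\<forall>x\<in>V. 0 \<le> f x \<and> 0 \<le> g x"
      then obtain q where q: "q \<in> I" "V = sp q" "w = ker q" by (auto simp: W_def)
      obtain \<psi> where qs: "quadratic_space_dim (K q) \<psi> (coord_space (K q) d) (Q q) (polar_form (K q) d (Q q)) d"
        and ker: "quadratic_space_dim.avg_kernel (K q) (coord_space (K q) d) (Q q) = ker q" using quad_space[OF q(1)] .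
      interpret quadratic_space_dim "K q" \<psi> "coord_space (K q) d" "Q q" "polar_form (K q) d (Q q)" d by (rule qs)
      define A0 where "A0 = 3 / sqrt (real q ^ (d - 1))"
      define A1 where "A1 = 3 * real q"
      have q3: "3 \<le> real q" using q_ge_3 card_K[OF q(1)] by simp
      \<comment> \<open>The powers of q cancel by the choice of \<theta>; the constants 3 of both
        estimates combine to 3.\<close>
      have A: "A0 powr (1 - \<theta>) * A1 powr \<theta> = 3"
      proof -
        have sq: "sqrt (real q ^ (d - 1)) = real q powr ((real d - 1) / 2)"
          using q3 d_ge_3 by (simp add: powr_half_sqrt[symmetric] powr_realpow[symmetric] powr_powr of_nat_diff)
        have "A0 = 3 * real q powr (- ((real d - 1) / 2))"
          unfolding A0_def sq powr_minus by (rule divide_inverse)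
        then have 1: "A0 powr (1 - \<theta>) = 3 powr (1 - \<theta>) * real q powr (- ((real d - 1) / 2) * (1 - \<theta>))"
          by (simp only: powr_mult powr_powr)
        have 2: "A1 powr \<theta> = 3 powr \<theta> * real q powr \<theta>"
          by (simp only: A1_def powr_mult)
        have 3: "(3::real) powr (1 - \<theta>) * 3 powr \<theta> = 3"
          by (simp only: powr_add[symmetric]) simp
        have 4: "real q powr (- ((real d - 1) / 2) * (1 - \<theta>)) * real q powr \<theta> = 1"
        proof -
          have "1 - \<theta> = 2 / (real d + 1)" using d by (simp add: \<theta>_def divide_simps)
          then have "(real d - 1) / 2 * (1 - \<theta>) = (real d - 1) / 2 * (2 / (real d + 1))" by (simp only:)
          also have "\<dots> = \<theta>"
          proof -
            have "u / 2 * (2 / v) = u / v" for u v :: real by simp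
            then show ?thesis by (simp only: \<theta>_def)
          qed
          finally have "- ((real d - 1) / 2) * (1 - \<theta>) + \<theta> = 0" by (simp only: mult_minus_left)
          then show ?thesis using q3 by (simp only: powr_add[symmetric]) simp
        qed
        have "A0 powr (1 - \<theta>) * A1 powr \<theta> = (3 powr (1 - \<theta>) * 3 powr \<theta>) *
            (real q powr (- ((real d - 1) / 2) * (1 - \<theta>)) * real q powr \<theta>)"
          unfolding 1 2 by (simp only: mult_ac)
        then show ?thesis unfolding 3 4 by simp
      qed
      have "pairing V w f g \<le> C * (1 + A0 powr (1 - \<theta>) * A1 powr \<theta>) *
        (pnorm V (real d / (real d + 1)) f * pnorm V (real d / (real d + 1)) g)"
      proof (rule *)
        show "finite V" "V \<noteq> {}" using fin[OF W] ne[OF W] .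
        show "0 \<le> w x y" if "x \<in> V" "y \<in> V" for x y using nonneg[OF W that] .
        show "0 < A0" "0 < A1" "0 \<le> (1::real)" using q3 by (simp_all add: A0_def A1_def)
        show "set_bound V w 1 A0 (1/2) (1/2)"
          using set_bound_odd[OF assms] unfolding ker card_K[OF q(1)] q(2,3) A0_def .
        show "set_bound V w 1 A1 1 1"
          using set_bound_sup unfolding ker card_K[OF q(1)] q(2,3) A1_def .
        show "0 \<le> f x" "0 \<le> g x" if "x \<in> V" for x using fg that by blast+
      qed
      then show "pairing V w f g \<le> C * (1 + 3) *
          (pnorm V (real d / (real d + 1)) f * pnorm V (1 - 1 / (real d + 1)) g)"
        unfolding A b .
    qed
  qed simp_all
qed

text \<open>The vertex is strong, hence restricted, and is joined to (0, 0) and to (1, 1) by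
  interpolation. A point of the region is reached by raising b from the edge below it.\<close>

lemma strong_if_ineqs_odd:
  assumes "odd d" and ab: "0 \<le> a" "a \<le> 1" "b \<le> 1" "a \<le> real d * b" "real d * a \<le> real d - 1 + b"
  shows "strong a b"
proof -
  have d: "3 \<le> real d" using d_ge_3 by simp
  define x where "x = real d / (real d + 1)"
  define y where "y = 1 / (real d + 1)"
  have xy: "x = real d * y" "x + y = 1" using d by (auto simp: x_def y_def field_simps)
  have "real d * x = real d * (1 - y)" using xy(2) by (simp flip: eq_diff_eq)
  then have dx: "real d * x = real d - 1 + y" using xy(1,2) by (simp add: right_diff_distrib)
  have sX: "strong x y" unfolding x_def y_def by (rule strong_odd_vertex[OF assms(1)])
  have rX: "restricted x y" using d by (intro strong_imp_restricted[OF sX]) (auto simp: x_def y_def)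
  have x: "0 < x" "x < 1" "0 < y" "y < 1" using d by (auto simp: x_def y_def)
  have "0 \<le> real d * b" using ab(1,4) by linarith
  then have b0: "0 \<le> b" using d by (simp add: zero_le_mult_iff)
  consider "a = 0" | "a = 1" | "0 < a" "a < x" | "a = x" | "x < a" "a < 1" using ab by linarith
  then show ?thesis
  proof cases
    case 1
    then show ?thesis using strong_mono[OF strong_0_0, of a b] b0 by simp
  next
    case 2
    then show ?thesis using strong_1_1 ab by simp
  next
    case 3
    have "strong a (a / real d)"
    proof (rule strong_on_chord[OF restricted_0_0 rX])
      show "(a / real d - 0) * (x - 0) = (a - 0) * (y - 0)" using d by (simp add: xy(1))
      show "a / real d < a" using 3 d by (simp add: divide_less_eq)
      show "0 < x" "(0::real) \<noteq> y" "0 < a" "a < x" "a \<le> 1" using x 3 ab(2) by simp_all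
      show "0 < a / real d" using 3 d by simp
    qed
    moreover have "0 \<le> a / real d" "a / real d \<le> b" using ab d by (simp_all add: divide_le_eq mult.commute)
    ultimately show ?thesis by (rule strong_mono[OF _ ab(1) order_refl])
  next
    case 4
    have "y \<le> b" using ab(4) 4 d by (simp add: xy(1))
    then show ?thesis using strong_mono[OF sX, of a b] 4 x by simp
  next
    case 5
    have lt: "real d * x < real d * a" using 5 d by simp
    have "strong a (real d * a - (real d - 1))"
    proof (rule strong_on_chord[OF rX restricted_1_1])
      have "real d * a - (real d - 1) - y = real d * (a - x)" using dx by (simp add: right_diff_distrib)
      moreover have "real d * (1 - x) = 1 - y" using dx by (simp add: right_diff_distrib)
      ultimately show "(real d * a - (real d - 1) - y) * (1 - x) = (a - x) * (1 - y)" by (simp add: mult_ac)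
      show "0 < real d * a - (real d - 1)" using lt dx x by linarith
      have "(real d - 1) * a < (real d - 1) * 1" using 5 d by (intro mult_strict_left_mono) auto
      then show "real d * a - (real d - 1) < a" by (simp add: algebra_simps)
      show "x < 1" "y \<noteq> 1" "x < a" "a < 1" "a \<le> 1" using x 5 by simp_all
    qed
    moreover have "0 \<le> real d * a - (real d - 1)" "real d * a - (real d - 1) \<le> b" using ab(5) lt dx x by linarith+
    ultimately show ?thesis by (rule strong_mono[OF _ ab(1) order_refl])
  qed
qed

lemma even_test_family:
  assumes "even d"
  obtains C where "0 < C" "\<And>V w E g. (V, w) \<in> W \<Longrightarrow> E \<subseteq> V \<Longrightarrow> \<forall>y\<in>V. 0 \<le> g y \<Longrightarrow>
    pairing V w (indicator E) g \<le> C * (dens V E powr alpha1 d * pnorm V (1 - beta1 d) g)"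
proof (rule that[of "1 + (36 * 3 ^ (d - 3)) powr beta1 d"])
  show "0 < 1 + (36 * 3 ^ (d - 3)) powr beta1 d" by (simp add: add_pos_nonneg)
  fix V w E and g :: "(nat \<Rightarrow> 'a) \<Rightarrow> real" assume W: "(V, w) \<in> W" and E: "E \<subseteq> V" and g: "\<forall>y\<in>V. 0 \<le> g y"
  obtain q where q: "q \<in> I" "V = sp q" "w = ker q" using W by (auto simp: W_def)
  obtain \<psi> where qs: "quadratic_space_dim (K q) \<psi> (coord_space (K q) d) (Q q) (polar_form (K q) d (Q q)) d"
    and ker: "quadratic_space_dim.avg_kernel (K q) (coord_space (K q) d) (Q q) = ker q" using quad_space[OF q(1)] .
  interpret quadratic_space_dim "K q" \<psi> "coord_space (K q) d" "Q q" "polar_form (K q) d (Q q)" d by (rule qs)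
  show "pairing V w (indicator E) g \<le> (1 + (36 * 3 ^ (d - 3)) powr beta1 d) * (dens V E powr alpha1 d * pnorm V (1 - beta1 d) g)"
    using even_test[OF assms, of E g] E g by (simp add: q(2,3) ker)
qed

lemma restricted_P1:
  assumes "even d"
  shows "restricted (alpha1 d) (beta1 d)"
proof -
  obtain C where C: "0 < C" "\<And>V w E g. (V, w) \<in> W \<Longrightarrow> E \<subseteq> V \<Longrightarrow> \<forall>y\<in>V. 0 \<le> g y \<Longrightarrow>
    pairing V w (indicator E) g \<le> C * (dens V E powr alpha1 d * pnorm V (1 - beta1 d) g)"
    by (rule even_test_family[OF assms]) blast
  have d: "4 \<le> d" using d_ge_3 assms by (cases "d = 3") auto
  show ?thesis
  proof (rule restrictedI[OF C(1)])
    fix V w E F assume W: "(V, w) \<in> W" and E: "E \<subseteq> V" "F \<subseteq> V"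
    show "pairing V w (indicator E) (indicator F) \<le> C * (dens V E powr alpha1 d * dens V F powr (1 - beta1 d))"
      using C(2)[OF W E(1), of "indicator F"] pnorm_indicator[OF fin[OF W] ne[OF W] E(2), of "1 - beta1 d"]
        vertex_relations[OF d] by simp
  qed
qed

text \<open>At \<open>P1\<close> and \<open>P2\<close> only restricted estimates are at hand, so the
  open edges are strong but these two vertices are left out. Points above a vertex then need an
  argument of their own.\<close>

lemma strong_if_ineqs_even:
  assumes "even d" and ab: "0 \<le> a" "a \<le> 1" "b \<le> 1" "a \<le> real d * b" "real d * a \<le> real d - 1 + b"
    "a - b \<le> (real d - 2) / real d"
    and ne: "(a, b) \<noteq> P1 d" "(a, b) \<noteq> P2 d"
  shows "strong a b"
proof -
  have d4: "4 \<le> d" using d_ge_3 assms by (cases "d = 3") auto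
  then have d: "4 \<le> real d" by simp
  note v = vertex_relations[OF d4]
  define A where "A = alpha1 d"
  define B where "B = beta1 d"
  define D where "D = (real d - 2) / real d"
  have v: "0 < B" "B < 1" "A < 1" "1 - B < A" "1 - A < B" "A - B = D" "real d * A = real d - 1 + B"
    using v by (simp_all add: A_def B_def D_def)
  have a1: "1 - B = real d * (1 - A)" using v(7) by (simp add: algebra_simps)
  have r1: "restricted A B" unfolding A_def B_def by (rule restricted_P1[OF assms(1)])
  have r2: "restricted (1 - B) (1 - A)" by (rule restricted_dual[OF r1])
  \<comment> \<open>The lower boundary of \<open>Omega_region\<close> as the maximum of its three
    edge lines.\<close>
  define low where "low = (\<lambda>a. max (a / real d) (max (a - D) (real d * a - (real d - 1))))"
  have D: "0 < D" using d by (simp add: D_def)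
  have edge: "strong a' (low a')" if a': "0 < a'" "a' < 1" "a' \<noteq> A" "a' \<noteq> 1 - B" for a'
  proof -
    have low_pos: "0 < low a'" using a' d by (simp add: low_def less_max_iff_disj)
    have "(real d - 1) * a' < (real d - 1) * 1" using a' d by (intro mult_strict_left_mono) auto
    then have low_less: "low a' < a'"
      using a' d D by (simp add: low_def divide_less_eq algebra_simps)
    consider "a' < 1 - B" | "1 - B < a'" "a' < A" | "A < a'" using a' by linarith
    then show ?thesis
    proof cases
      case 1
      have "strong a' (a' / real d)"
      proof (rule strong_on_chord[OF restricted_0_0 r2])
        show "(a' / real d - 0) * (1 - B - 0) = (a' - 0) * (1 - A - 0)" using d by (simp add: a1)
        show "a' / real d < a'" using a' d by (simp add: divide_less_eq)
        show "0 < 1 - B" "0 \<noteq> 1 - A" "0 < a'" "a' < 1 - B" "a' \<le> 1" using v(2,3) 1 a'(1,2) by simp_all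
        show "0 < a' / real d" using a' d by simp
      qed
      moreover have "0 \<le> a' / real d" "a' / real d \<le> low a'" using a' d by (simp_all add: low_def)
      ultimately show ?thesis by (rule strong_mono[OF _ less_imp_le[OF a'(1)] order_refl])
    next
      case 2
      have "strong a' (a' - D)"
      proof (rule strong_on_chord[OF r2 r1])
        show "(a' - D - (1 - A)) * (A - (1 - B)) = (a' - (1 - B)) * (B - (1 - A))" using v(6) by (simp add: algebra_simps)
        show "0 < a' - D" using 2 v(6) v(3) by linarith
        show "1 - B < A" "1 - A \<noteq> B" "1 - B < a'" "a' < A" "a' - D < a'" "a' \<le> 1" using v(4,5) 2 a'(2) D by simp_all
      qed
      moreover have "0 \<le> a' - D" using 2 v(6) v(3) by linarith
      moreover have "a' - D \<le> low a'" by (simp add: low_def)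
      ultimately show ?thesis by (rule strong_mono[OF _ less_imp_le[OF a'(1)] order_refl])
    next
      case 3
      have lt: "real d * A < real d * a'" using 3 d by simp
      have "strong a' (real d * a' - (real d - 1))"
      proof (rule strong_on_chord[OF r1 restricted_1_1])
        have "real d * a' - (real d - 1) - B = real d * (a' - A)" using v(7) by (simp add: algebra_simps)
        then show "(real d * a' - (real d - 1) - B) * (1 - A) = (a' - A) * (1 - B)" by (simp add: a1 mult_ac)
        show "0 < real d * a' - (real d - 1)" using lt v by linarith
        show "real d * a' - (real d - 1) < a'" using \<open>(real d - 1) * a' < (real d - 1) * 1\<close> by (simp add: algebra_simps)
        show "A < 1" "B \<noteq> 1" "A < a'" "a' < 1" "a' \<le> 1" using v(2,3) 3 a'(2) by simp_all
      qed
      moreover have "0 \<le> real d * a' - (real d - 1)" using lt v by linarith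
      moreover have "real d * a' - (real d - 1) \<le> low a'" by (simp add: low_def)
      ultimately show ?thesis by (rule strong_mono[OF _ less_imp_le[OF a'(1)] order_refl])
    qed
  qed
  have low_b: "low a \<le> b" using ab d by (auto simp: low_def D_def divide_le_eq mult.commute)
  have low_0: "0 \<le> low x" if "0 \<le> x" for x using that d by (simp add: low_def le_max_iff_disj)
  consider "a = 0" | "a = 1" | "0 < a" "a < 1" "a \<noteq> A" "a \<noteq> 1 - B" | "a = A \<or> a = 1 - B" using ab by linarith
  then show ?thesis
  proof cases
    case 1
    then show ?thesis using strong_mono[OF strong_0_0, of a b] low_b low_0[of a] by simp
  next
    case 2
    then show ?thesis using strong_1_1 ab by simp
  next
    case 3
    then show ?thesis using strong_mono[OF edge[OF 3], of a b] low_b low_0[of a] by simp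
  next
    case 4
    text \<open>At an excluded abscissa the room above the vertex allows a step to the right along the edge.\<close>
    have "low a \<noteq> b"
    proof
      \<comment> \<open>Evaluating the three lines at A and at 1 - B shows that the boundary passes
        there through \<open>P1\<close> and \<open>P2\<close>, the two excluded points. The
        computation uses d B = 1 + B.\<close>
      assume "low a = b"
      have dD: "real d * D = real d - 2" using d by (simp add: D_def)
      have "real d * B = real d * A - real d * D" by (simp flip: v(6) add: right_diff_distrib)
      then have dB: "real d * B = 1 + B" using v(7) dD by simp
      have "A / real d \<le> B" using dB v d by (simp add: divide_le_eq mult.commute)
      moreover have "A - D = B" "real d * A - (real d - 1) = B" using v(6,7) by simp_all
      ultimately have "low A = B" by (simp add: low_def)
      moreover have "low (1 - B) = 1 - A"
      proof -
        have "(1 - B) / real d = 1 - A" using d by (simp add: a1)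
        moreover have "1 - B - D = 1 - A" using v(6) by simp
        moreover have "real d * (1 - B) - (real d - 1) \<le> 1 - A" using dB v(1,3) by (simp add: right_diff_distrib)
        ultimately show ?thesis by (simp add: low_def)
      qed
      ultimately show False using 4 \<open>low a = b\<close> ne d4 by (auto simp: P1_eq P2_eq A_def B_def)
    qed
    then have lt: "low a < b" using low_b by simp
    have lt1: "a < 1" using 4 v by auto
    \<comment> \<open>The boundary rises with slope at most d, so the first entry keeps
      \<open>low (a + e)\<close> below b. The second keeps a + e below 1, and the third, from a = 1
      - B, stops short of A; from a = A every step to the right avoids 1 - B.\<close>
    define e where "e = min ((b - low a) / real d) (min ((1 - a) / 2) (if a = A then 1 else (A - (1 - B)) / 2))"
    have e: "0 < e" using lt lt1 d v by (simp add: e_def)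
    have e': "e \<le> (b - low a) / real d" "e \<le> (1 - a) / 2" "e \<le> (if a = A then 1 else (A - (1 - B)) / 2)"
      unfolding e_def by (rule min.cobounded1, rule order_trans[OF min.cobounded2 min.cobounded1],
        rule order_trans[OF min.cobounded2 min.cobounded2])
    have "low (a + e) \<le> low a + real d * e"
    proof -
      have "1 * e \<le> real d * e" "e / real d \<le> e" using e d by (auto simp: divide_le_eq)
      then show ?thesis unfolding low_def by (auto simp: add_divide_distrib distrib_left)
    qed
    also have "\<dots> \<le> b" using e'(1) d by (simp add: pos_le_divide_eq mult.commute)
    finally have le: "low (a + e) \<le> b" .
    have "strong (a + e) (low (a + e))"
    proof (rule edge)
      show "0 < a + e" using ab e by simp
      show "a + e < 1" using e'(2) lt1 by simp
      show "a + e \<noteq> A" using 4 e e'(3) v by (cases "a = A") auto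
      show "a + e \<noteq> 1 - B" using 4 e e'(3) v by (cases "a = A") auto
    qed
    then show ?thesis using strong_mono[of "a + e" "low (a + e)" a b] le ab e low_0[of "a + e"] by simp
  qed
qed

end

section \<open>Necessary conditions\<close>

lemma exponent_nonpos:
  assumes "infinite I" and C: "\<And>q. q \<in> I \<Longrightarrow> real q powr e \<le> C"
  shows "e \<le> 0"
proof (rule ccontr)
  assume "\<not> e \<le> 0"
  then have e: "0 < e" by simp
  obtain n :: nat where n: "(\<bar>C\<bar> + 1) powr (1 / e) < real n" using reals_Archimedean2 by blast
  obtain q where q: "q \<in> I" "n \<le> q" using assms(1) by (meson infinite_nat_iff_unbounded_le)
  have "\<bar>C\<bar> + 1 = ((\<bar>C\<bar> + 1) powr (1 / e)) powr e" using e by (simp add: powr_powr)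
  also have "\<dots> \<le> real q powr e" using n q e by (intro powr_mono2) auto
  also have "\<dots> \<le> C" by (rule C[OF q(1)])
  finally show False by simp
qed

lemma dens_powr_le_pnorm:
  assumes V: "finite V" "E \<subseteq> V" "E \<noteq> {}" and a: "0 \<le> a" and c: "0 \<le> c"
    and h: "\<And>y. y \<in> E \<Longrightarrow> c \<le> h y"
  shows "c * dens V E powr a \<le> pnorm V a h"
proof -
  have ne: "V \<noteq> {}" using V by auto
  have "c * dens V E powr a = c * pnorm V a (indicator E)"
  proof (cases "a = 0")
    case True
    have "Max ((\<lambda>x. \<bar>indicator E x\<bar>) ` V) = (1::real)"
      using V ne by (intro Max_eqI) (auto simp: indicator_def image_iff)
    then show ?thesis using True dens_pos[OF V] by (simp add: pnorm_def)
  next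
    case False
    then show ?thesis using pnorm_indicator[OF V(1) ne V(2)] a by simp
  qed
  also have "\<dots> = pnorm V a (\<lambda>x. c * indicator E x)" by (rule pnorm_cmult[OF V(1) ne c a, symmetric])
  also have "\<dots> \<le> pnorm V a h"
    using h c by (intro pnorm_mono[OF V(1) ne _ a]) (auto simp: indicator_def intro: order_trans[OF _ abs_ge_self])
  finally show ?thesis .
qed

lemma pnorm_indicator_nonempty:
  assumes V: "finite V" "E \<subseteq> V" "E \<noteq> {}" and a: "0 \<le> a"
  shows "pnorm V a (indicator E) = dens V E powr a"
proof (cases "a = 0")
  case True
  have "Max ((\<lambda>x. \<bar>indicator E x\<bar>) ` V) = (1::real)"
    using V by (intro Max_eqI) (auto simp: indicator_def image_iff)
  then show ?thesis using True dens_pos[OF V] by (simp add: pnorm_def)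
next
  case False
  then show ?thesis using pnorm_indicator[of V E a] V a by auto
qed

context quadratic_space_dim
begin

lemma zero_in_S: "\<zero>\<^bsub>M\<^esub> \<in> S" by (simp add: S_def)

lemma dens_singleton: "x \<in> V \<Longrightarrow> dens V {x} = real q powr (- real d)"
  using q_ge_3 by (simp add: dens_def card_space powr_minus powr_realpow divide_inverse)

lemma q_power: "real q ^ (d - 1) = real q powr (real d - 1)"
  using q_ge_3 d_ge_3 by (simp add: powr_realpow[symmetric] of_nat_diff)

lemma card_S_le: "real (card S) \<le> 2 * real q powr (real d - 1)"
  using card_S_bounds(2) unfolding q_power .

lemma dens_S: "real q powr (- 1) / 3 \<le> dens V S" "dens V S \<le> 2 * real q powr (- 1)"
proof -
  have N: "real N = real q * real q ^ (d - 1)" by (rule N_eq)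
  have "0 < real q ^ (d - 1)" using q_ge_3 by simp
  then show "real q powr (- 1) / 3 \<le> dens V S" "dens V S \<le> 2 * real q powr (- 1)"
    using card_S_bounds q_ge_3 by (simp_all add: dens_def N powr_minus field_simps)
qed

text \<open>The average of a point mass at 0 is 1 / card S on S. The 6 is 2 from card S \<le> 2
  q^(d-1) times 3 from the density of S.\<close>

lemma point_test:
  assumes "0 \<le> a" "0 \<le> b" "b \<le> 1"
    and le: "pnorm V b (kop V avg_kernel (indicator {\<zero>\<^bsub>M\<^esub>})) \<le> C * pnorm V a (indicator {\<zero>\<^bsub>M\<^esub>})"
  shows "real q powr (real d * a - (real d - 1) - b) \<le> 6 * C"
proof -
  have q: "0 < real q" using q_ge_3 by simp
  have val: "1 / real (card S) \<le> kop V avg_kernel (indicator {\<zero>\<^bsub>M\<^esub>}) y" if "y \<in> S" for y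
  proof -
    have y: "y \<in> V" using that S_subset by blast
    have "{x \<in> S. y \<ominus>\<^bsub>M\<^esub> x \<in> {\<zero>\<^bsub>M\<^esub>}} = {y}"
      using that S_subset y by (auto simp: M.minus_eq_zero_iff)
    then show ?thesis by (simp add: kop_hits[OF y] hits_def)
  qed
  have "real q powr (- (real d - 1)) * real q powr (- b) / 6 \<le> (1 / (2 * real q powr (real d - 1))) * (real q powr (- b) / 3)"
    unfolding powr_minus_divide[of _ "real d - 1"] by simp
  also have "\<dots> \<le> (1 / real (card S)) * dens V S powr b"
  proof (rule mult_mono)
    show "1 / (2 * real q powr (real d - 1)) \<le> 1 / real (card S)"
      using card_S_le card_S_pos q by (intro divide_left_mono mult_pos_pos) simp_all
    have "real q powr (- b) / 3 \<le> real q powr (- b) / 3 powr b"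
      using assms powr_mono[of b 1 3] by (intro divide_left_mono) auto
    also have "\<dots> = (real q powr (- 1) / 3) powr b" by (simp only: powr_divide powr_powr) simp
    also have "\<dots> \<le> dens V S powr b" using dens_S assms by (intro powr_mono2) auto
    finally show "real q powr (- b) / 3 \<le> dens V S powr b" .
  qed auto
  also have "\<dots> \<le> pnorm V b (kop V avg_kernel (indicator {\<zero>\<^bsub>M\<^esub>}))"
    using val zero_in_S by (intro dens_powr_le_pnorm finite_space S_subset assms) auto
  also have "\<dots> \<le> C * pnorm V a (indicator {\<zero>\<^bsub>M\<^esub>})" by (rule le)
  also have "pnorm V a (indicator {\<zero>\<^bsub>M\<^esub>}) = real q powr (- real d * a)"
    using assms by (subst pnorm_indicator_nonempty[OF finite_space]) (auto simp: dens_singleton powr_powr)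
  finally have le: "real q powr (- (real d - 1)) * real q powr (- b) \<le> 6 * C * real q powr (- real d * a)" by simp
  have "real d * a - (real d - 1) - b = - (real d - 1) + - b + real d * a" by simp
  then have "real q powr (real d * a - (real d - 1) - b) =
      real q powr (- (real d - 1)) * real q powr (- b) * real q powr (real d * a)"
    by (simp only: powr_add)
  also have "\<dots> \<le> 6 * C * real q powr (- real d * a) * real q powr (real d * a)"
    by (rule mult_right_mono[OF le]) simp
  also have "\<dots> = 6 * C" unfolding mult.assoc powr_add[symmetric] using q by simp
  finally show ?thesis .
qed

text \<open>As S = -S, the average of the indicator of S at the origin is 1; the norm on the left is
  bounded below by this one point.\<close>

lemma cone_test:
  assumes "0 \<le> a" "a \<le> 1" "0 \<le> b" and C: "0 \<le> C"
    and le: "pnorm V b (kop V avg_kernel (indicator S)) \<le> C * pnorm V a (indicator S)"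
  shows "real q powr (a - real d * b) \<le> 2 * C"
proof -
  have q: "0 < real q" using q_ge_3 by simp
  have "{x \<in> S. \<zero>\<^bsub>M\<^esub> \<ominus>\<^bsub>M\<^esub> x \<in> S} = S"
    using S_subset S_neg by (auto simp: M.minus_eq)
  then have val: "kop V avg_kernel (indicator S) \<zero>\<^bsub>M\<^esub> = 1"
    using card_S_pos by (simp add: kop_hits hits_def)
  have "real q powr (- real d * b) = 1 * dens V {\<zero>\<^bsub>M\<^esub>} powr b"
    by (simp add: dens_singleton powr_powr)
  also have "\<dots> \<le> pnorm V b (kop V avg_kernel (indicator S))"
    using val by (intro dens_powr_le_pnorm finite_space assms) auto
  also have "\<dots> \<le> C * pnorm V a (indicator S)" by (rule le)
  also have "pnorm V a (indicator S) = dens V S powr a"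
    using zero_in_S by (intro pnorm_indicator_nonempty finite_space S_subset assms) auto
  also have "dens V S powr a \<le> (2 * real q powr (- 1)) powr a"
    using dens_S(2) assms by (intro powr_mono2) (auto simp: dens_nonneg)
  also have "\<dots> = 2 powr a * real q powr (- a)" by (simp only: powr_mult powr_powr) simp
  also have "\<dots> \<le> 2 * real q powr (- a)"
    using assms powr_mono[of a 1 2] by (intro mult_right_mono) auto
  finally have le: "real q powr (- real d * b) \<le> 2 * C * real q powr (- a)" using C by (simp add: mult_left_mono)
  have "a - real d * b = - real d * b + a" by simp
  then have "real q powr (a - real d * b) = real q powr (- real d * b) * real q powr a" by (simp only: powr_add)
  also have "\<dots> \<le> 2 * C * real q powr (- a) * real q powr a" by (rule mult_right_mono[OF le]) simp
  also have "\<dots> = 2 * C" unfolding mult.assoc powr_add[symmetric] using q by simp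
  finally show ?thesis .
qed

text \<open>For y in H the whole translate y - H = H lies in S, so the average of the indicator of H
  is at least card H / card S throughout H.\<close>

lemma subspace_test:
  assumes "0 \<le> a" "0 \<le> b" "even d"
    and H: "H \<subseteq> S" "card H = q ^ (d div 2)" "\<And>x y. x \<in> H \<Longrightarrow> y \<in> H \<Longrightarrow> y \<ominus>\<^bsub>M\<^esub> x \<in> H"
    and le: "pnorm V b (kop V avg_kernel (indicator H)) \<le> C * pnorm V a (indicator H)"
  shows "real q powr (real d / 2 * (a - b) - (real d - 2) / 2) \<le> 2 * C"
proof -
  have q: "0 < real q" using q_ge_3 by simp
  have HV: "H \<subseteq> V" using H(1) S_subset by blast
  have Hne: "H \<noteq> {}" using H(2) q_ge_3 by auto
  have cH: "real (card H) = real q powr (real d / 2)"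
    using H(2) q \<open>even d\<close> by (auto simp: powr_realpow[symmetric] elim!: evenE)
  have dH: "dens V H = real q powr (- (real d / 2))"
    using q by (simp add: dens_def cH card_space powr_realpow[symmetric] flip: powr_diff)
  have val: "real q powr (real d / 2) / real (card S) \<le> kop V avg_kernel (indicator H) y" if y: "y \<in> H" for y
  proof -
    have "H \<subseteq> {x \<in> S. y \<ominus>\<^bsub>M\<^esub> x \<in> H}" using H y by auto
    then have "card H \<le> hits H y" unfolding hits_def using finite_S by (intro card_mono) auto
    then show ?thesis using y HV by (subst kop_hits) (auto simp: cH[symmetric] divide_right_mono)
  qed
  have "real q powr (real d / 2) / (2 * real q powr (real d - 1)) * real q powr (- (real d / 2) * b) \<le>
      real q powr (real d / 2) / real (card S) * dens V H powr b"
  proof (rule mult_mono)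
    show "real q powr (real d / 2) / (2 * real q powr (real d - 1)) \<le> real q powr (real d / 2) / real (card S)"
      using card_S_le card_S_pos q by (intro divide_left_mono mult_pos_pos) simp_all
  qed (auto simp: dH powr_powr)
  also have "\<dots> \<le> pnorm V b (kop V avg_kernel (indicator H))"
    using val by (intro dens_powr_le_pnorm finite_space HV Hne assms) auto
  also have "\<dots> \<le> C * pnorm V a (indicator H)" by (rule le)
  also have "pnorm V a (indicator H) = real q powr (- (real d / 2) * a)"
    using assms by (subst pnorm_indicator_nonempty[OF finite_space HV Hne]) (auto simp: dH powr_powr)
  finally have le1: "real q powr (real d / 2) / (2 * real q powr (real d - 1)) * real q powr (- (real d / 2) * b) \<le>
    C * real q powr (- (real d / 2) * a)" .
  have "x / (2 * y) * z \<le> c \<Longrightarrow> x / y * z \<le> 2 * c" for x y z c :: real by simp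
  from this[OF le1]
  have le: "real q powr (real d / 2 - (real d - 1)) * real q powr (- (real d / 2) * b) \<le> 2 * C * real q powr (- (real d / 2) * a)"
    by (simp only: powr_diff mult.assoc)
  have "real q powr (real d / 2 * (a - b) - (real d - 2) / 2) =
      real q powr (real d / 2 - (real d - 1)) * real q powr (- (real d / 2) * b) * real q powr (real d / 2 * a)"
  proof -
    have "real d / 2 * (a - b) - (real d - 2) / 2 = real d / 2 - (real d - 1) + - (real d / 2) * b + real d / 2 * a"
      by (simp add: field_simps)
    then show ?thesis by (simp only: powr_add)
  qed
  also have "\<dots> \<le> 2 * C * real q powr (- (real d / 2) * a) * real q powr (real d / 2 * a)"
    by (rule mult_right_mono[OF le]) simp
  also have "\<dots> = 2 * C" unfolding mult.assoc powr_add[symmetric] using q by simp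
  finally show ?thesis .
qed

end

text \<open>Coordinates with respect to the basis count H. In \<open>subspace_of_dim\<close>
  coefficient functions are arbitrary outside \<open>{..<k}\<close>, so they are first restricted to
  extensional ones, of which there are finitely many over a finite field.\<close>

lemma card_subspace_of_dim:
  fixes R :: "'a ring" (structure) and M :: "('a, 'c) module" (structure)
  assumes "module R M" and "subspace_of_dim R M k H"
  shows "card H = card (carrier R) ^ k"
    and "\<And>x y. x \<in> H \<Longrightarrow> y \<in> H \<Longrightarrow> y \<ominus>\<^bsub>M\<^esub> x \<in> H"
proof -
  interpret module R M by (rule assms(1))
  obtain b where H: "submodule H R M" and b: "b \<in> {..<k} \<rightarrow> H"
    and indep: "\<And>c. c \<in> {..<k} \<rightarrow> carrier R \<Longrightarrow> (\<Oplus>\<^bsub>M\<^esub>i\<in>{..<k}. c i \<odot>\<^bsub>M\<^esub> b i) = \<zero>\<^bsub>M\<^esub> \<Longrightarrow> \<forall>i<k. c i = \<zero>"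
    and span: "\<And>h. h \<in> H \<Longrightarrow> \<exists>c \<in> {..<k} \<rightarrow> carrier R. h = (\<Oplus>\<^bsub>M\<^esub>i\<in>{..<k}. c i \<odot>\<^bsub>M\<^esub> b i)"
    using assms(2) unfolding subspace_of_dim_def by blast
  note sub = submoduleE[OF H]
  show minus: "y \<ominus>\<^bsub>M\<^esub> x \<in> H" if "x \<in> H" "y \<in> H" for x y
    unfolding M.minus_eq using sub(5)[OF that(2) sub(3)[OF that(1)]] .
  have H0: "\<zero>\<^bsub>M\<^esub> \<in> H"
  proof -
    obtain x where x: "x \<in> H" using sub(2) by blast
    then have "x \<ominus>\<^bsub>M\<^esub> x = \<zero>\<^bsub>M\<^esub>" using sub(1) by (auto simp: M.minus_eq M.r_neg)
    then show ?thesis using minus[OF x x] by simp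
  qed
  have bM: "b i \<in> carrier M" if "i < k" for i using b sub(1) that by auto
  let ?L = "\<lambda>c. \<Oplus>\<^bsub>M\<^esub>i\<in>{..<k}. c i \<odot>\<^bsub>M\<^esub> b i"
  have L_mem: "?L c \<in> H" if c: "c \<in> {..<k} \<rightarrow> carrier R" for c
  proof -
    have "(\<Oplus>\<^bsub>M\<^esub>i\<in>{..<n}. c i \<odot>\<^bsub>M\<^esub> b i) \<in> H" if "n \<le> k" for n
      using that
    proof (induction n)
      case 0
      then show ?case by (simp add: H0)
    next
      case (Suc n)
      have t: "c i \<odot>\<^bsub>M\<^esub> b i \<in> H" if "i \<le> n" for i
        using c b that Suc.prems by (intro sub(4)) (auto simp: Pi_iff)
      have "(\<Oplus>\<^bsub>M\<^esub>i\<in>{..<Suc n}. c i \<odot>\<^bsub>M\<^esub> b i) = c n \<odot>\<^bsub>M\<^esub> b n \<oplus>\<^bsub>M\<^esub> (\<Oplus>\<^bsub>M\<^esub>i\<in>{..<n}. c i \<odot>\<^bsub>M\<^esub> b i)"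
        unfolding lessThan_Suc using t sub(1) by (intro M.finsum_insert) auto
      then show ?case using sub(5)[OF t[of n]] Suc by simp
    qed
    then show ?thesis by simp
  qed
  have "bij_betw ?L ({..<k} \<rightarrow>\<^sub>E carrier R) H"
  proof (rule bij_betw_imageI)
    show "inj_on ?L ({..<k} \<rightarrow>\<^sub>E carrier R)"
    proof (rule inj_onI)
      fix c c' assume c: "c \<in> {..<k} \<rightarrow>\<^sub>E carrier R" "c' \<in> {..<k} \<rightarrow>\<^sub>E carrier R" and eq: "?L c = ?L c'"
      have cR: "c i \<in> carrier R" "c' i \<in> carrier R" if "i < k" for i using c that by auto
      have "?L c = ?L (\<lambda>i. (c i \<ominus> c' i)) \<oplus>\<^bsub>M\<^esub> ?L c'"
      proof -
        have "?L (\<lambda>i. (c i \<ominus> c' i)) \<oplus>\<^bsub>M\<^esub> ?L c' = (\<Oplus>\<^bsub>M\<^esub>i\<in>{..<k}. (c i \<ominus> c' i) \<odot>\<^bsub>M\<^esub> b i \<oplus>\<^bsub>M\<^esub> c' i \<odot>\<^bsub>M\<^esub> b i)"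
          using cR bM by (intro M.finsum_addf[symmetric]) auto
        also have "\<dots> = ?L c"
        proof (rule M.finsum_cong')
          show "(c i \<ominus> c' i) \<odot>\<^bsub>M\<^esub> b i \<oplus>\<^bsub>M\<^esub> c' i \<odot>\<^bsub>M\<^esub> b i = c i \<odot>\<^bsub>M\<^esub> b i" if "i \<in> {..<k}" for i
          proof -
            have i: "i < k" using that by simp
            have "(c i \<ominus> c' i) \<oplus> c' i = c i" using cR[OF i] by (simp add: R.minus_eq R.a_assoc R.l_neg)
            then show ?thesis using smult_l_distr[of "c i \<ominus> c' i" "c' i" "b i"] cR[OF i] bM[OF i] by simp
          qed
        qed (use cR bM in auto)
        finally show ?thesis by simp
      qed
      moreover have "?L c' \<in> carrier M" "?L (\<lambda>i. (c i \<ominus> c' i)) \<in> carrier M"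
        using cR bM by (auto intro!: M.finsum_closed)
      ultimately have "?L (\<lambda>i. (c i \<ominus> c' i)) = \<zero>\<^bsub>M\<^esub>" using eq by simp
      then have "\<forall>i<k. c i \<ominus> c' i = \<zero>" using cR by (intro indep) auto
      then have "c i = c' i" if "i < k" for i using R.minus_eq_zero_iff[OF cR[OF that]] that by blast
      then show "c = c'" using c by (intro extensionalityI[of _ "{..<k}"]) (auto simp: PiE_iff)
    qed
    show "?L ` ({..<k} \<rightarrow>\<^sub>E carrier R) = H"
    proof
      show "?L ` ({..<k} \<rightarrow>\<^sub>E carrier R) \<subseteq> H"
      proof
        fix h assume "h \<in> ?L ` ({..<k} \<rightarrow>\<^sub>E carrier R)"
        then obtain c where c: "h = ?L c" "c \<in> {..<k} \<rightarrow>\<^sub>E carrier R" by (rule imageE)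
        have "c \<in> {..<k} \<rightarrow> carrier R" using c(2) by auto
        then show "h \<in> H" unfolding c(1) by (rule L_mem)
      qed
      show "H \<subseteq> ?L ` ({..<k} \<rightarrow>\<^sub>E carrier R)"
      proof
        fix h assume "h \<in> H"
        then obtain c where c: "c \<in> {..<k} \<rightarrow> carrier R" "h = ?L c" using span by blast
        have "?L (restrict c {..<k}) = ?L c"
          using c(1) bM by (intro M.finsum_cong') auto
        then have "h = ?L (restrict c {..<k})" using c(2) by (simp only:)
        moreover have "restrict c {..<k} \<in> {..<k} \<rightarrow>\<^sub>E carrier R" using c(1) by auto
        ultimately show "h \<in> ?L ` ({..<k} \<rightarrow>\<^sub>E carrier R)" by (rule image_eqI)
      qed
    qed
  qed
  then have "card H = card ({..<k} \<rightarrow>\<^sub>E carrier R)" by (rule bij_betw_same_card[symmetric])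
  then show "card H = card (carrier R) ^ k" by (simp add: card_PiE)
qed

context quadric_family
begin

lemma infinite_I: "infinite I" using family by (simp add: form_family_def)

lemma strong_imp_ineqs:
  assumes s: "strong a b" and ab: "0 \<le> a" "a \<le> 1" "0 \<le> b" "b \<le> 1"
  shows "real d * a \<le> real d - 1 + b" "a \<le> real d * b"
proof -
  obtain C where C: "0 \<le> C" "\<And>V w f. (V, w) \<in> W \<Longrightarrow> \<forall>x\<in>V. 0 \<le> f x \<Longrightarrow>
    pnorm V b (kop V w f) \<le> C * pnorm V a f" by (rule strongE[OF s]) (rule that)
  have tests: "real q powr (real d * a - (real d - 1) - b) \<le> 6 * C" "real q powr (a - real d * b) \<le> 2 * C" if q: "q \<in> I" for q
  proof -
    obtain \<psi> where qs: "quadratic_space_dim (K q) \<psi> (coord_space (K q) d) (Q q) (polar_form (K q) d (Q q)) d"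
      and ker: "quadratic_space_dim.avg_kernel (K q) (coord_space (K q) d) (Q q) = ker q" using quad_space[OF q] .
    interpret quadratic_space_dim "K q" \<psi> "coord_space (K q) d" "Q q" "polar_form (K q) d (Q q)" d by (rule qs)
    show "real q powr (real d * a - (real d - 1) - b) \<le> 6 * C"
      by (rule point_test[OF ab(1,3,4), unfolded ker card_K[OF q]], rule C(2)[OF W_I[OF q]]) simp
    show "real q powr (a - real d * b) \<le> 2 * C"
      by (rule cone_test[OF ab(1,2,3) C(1), unfolded ker card_K[OF q]], rule C(2)[OF W_I[OF q]]) simp
  qed
  show "real d * a \<le> real d - 1 + b" using exponent_nonpos[OF infinite_I tests(1)] by simp
  show "a \<le> real d * b" using exponent_nonpos[OF infinite_I tests(2)] by simp
qed

lemma strong_imp_ineq_subspace: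
  assumes s: "strong a b" and ab: "0 \<le> a" "0 \<le> b" and "even d"
    and H: "\<forall>q\<in>I. \<exists>H \<subseteq> quadric (K q) d (Q q). subspace_of_dim (K q) (coord_space (K q) d) (d div 2) H"
  shows "a - b \<le> (real d - 2) / real d"
proof -
  obtain C where C: "0 \<le> C" "\<And>V w f. (V, w) \<in> W \<Longrightarrow> \<forall>x\<in>V. 0 \<le> f x \<Longrightarrow>
    pnorm V b (kop V w f) \<le> C * pnorm V a f" by (rule strongE[OF s]) (rule that)
  have test: "real q powr (real d / 2 * (a - b) - (real d - 2) / 2) \<le> 2 * C" if q: "q \<in> I" for q
  proof -
    obtain \<psi> where qs: "quadratic_space_dim (K q) \<psi> (coord_space (K q) d) (Q q) (polar_form (K q) d (Q q)) d"
      and ker: "quadratic_space_dim.avg_kernel (K q) (coord_space (K q) d) (Q q) = ker q"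
      and S: "quadratic_space.S (K q) (coord_space (K q) d) (Q q) = quadric (K q) d (Q q)" using quad_space[OF q] .
    interpret quadratic_space_dim "K q" \<psi> "coord_space (K q) d" "Q q" "polar_form (K q) d (Q q)" d by (rule qs)
    obtain H where H: "H \<subseteq> quadric (K q) d (Q q)" "subspace_of_dim (K q) (coord_space (K q) d) (d div 2) H"
      using H q by blast
    note c = card_subspace_of_dim[OF module_axioms H(2)]
    show ?thesis
      by (rule subspace_test[OF ab \<open>even d\<close> H(1)[folded S] c, unfolded ker card_K[OF q]], assumption+,
        rule C(2)[OF W_I[OF q]]) simp
  qed
  have "real d / 2 * (a - b) - (real d - 2) / 2 \<le> 0" using exponent_nonpos[OF infinite_I test] .
  then have "(a - b) * real d \<le> real d - 2" by (simp add: mult.commute)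
  moreover have "0 < real d" using d_ge_3 by simp
  ultimately show ?thesis by (simp only: pos_le_divide_eq)
qed

end

section \<open>Lorentz norms\<close>

definition decr_rearr :: "'v set \<Rightarrow> ('v \<Rightarrow> real) \<Rightarrow> real \<Rightarrow> ennreal" where
  "decr_rearr V g t = Inf {s. ennreal (dens V {x \<in> V. s < ennreal (g x)}) \<le> ennreal t}"

lemma dens_mono: "finite V \<Longrightarrow> F \<subseteq> V \<Longrightarrow> E \<subseteq> F \<Longrightarrow> dens V E \<le> dens V F"
  unfolding dens_def by (intro divide_right_mono) (auto intro!: card_mono dest: finite_subset)

text \<open>For t below the density of the support A, an admissible level s of g is at least m,
  since otherwise A would lie in the superlevel set; and s - m is admissible for the remainder g'.
  Thus peeling off the layer m on A costs the rearrangement at least m on the initial interval of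
  length \<open>dens V A\<close>.\<close>

lemma decr_rearr_split:
  assumes V: "finite V" and A: "A = {x \<in> V. 0 < g x}" "A \<noteq> {}" and m: "0 \<le> m" "\<And>x. x \<in> A \<Longrightarrow> m \<le> g x"
    and g': "\<And>x. g' x = g x - m * indicator A x" and g: "\<And>x. x \<in> V \<Longrightarrow> 0 \<le> g x"
  shows "ennreal m * indicator {..<dens V A} t + decr_rearr V g' t \<le> decr_rearr V g t"
  unfolding decr_rearr_def[of V g]
proof (rule Inf_greatest)
  fix s assume "s \<in> {s. ennreal (dens V {x \<in> V. s < ennreal (g x)}) \<le> ennreal t}"
  then have s: "ennreal (dens V {x \<in> V. s < ennreal (g x)}) \<le> ennreal t" by simp
  have lower: "decr_rearr V g' t \<le> s'" if "{x \<in> V. s' < ennreal (g' x)} \<subseteq> {x \<in> V. s < ennreal (g x)}" for s'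
  proof -
    have "dens V {x \<in> V. s' < ennreal (g' x)} \<le> dens V {x \<in> V. s < ennreal (g x)}"
      using that V by (intro dens_mono) auto
    then have "ennreal (dens V {x \<in> V. s' < ennreal (g' x)}) \<le> ennreal t"
      using s by (meson ennreal_leI order_trans)
    then show ?thesis unfolding decr_rearr_def by (intro Inf_lower) simp
  qed
  show "ennreal m * indicator {..<dens V A} t + decr_rearr V g' t \<le> s"
  proof (cases "t < dens V A")
    case False
    have "g' x \<le> g x" for x using m by (simp add: g' indicator_def)
    then have "{x \<in> V. s < ennreal (g' x)} \<subseteq> {x \<in> V. s < ennreal (g x)}"
      by (auto intro: less_le_trans ennreal_leI)
    then show ?thesis using lower False by simp
  next
    case True
    have "ennreal m \<le> s"
    proof (rule ccontr)
      assume "\<not> ennreal m \<le> s"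
      then have "s < ennreal m" by simp
      then have "A \<subseteq> {x \<in> V. s < ennreal (g x)}" using m A(1) by (auto intro: less_le_trans ennreal_leI)
      then have "dens V A \<le> dens V {x \<in> V. s < ennreal (g x)}" using V by (intro dens_mono) auto
      then have "ennreal (dens V A) \<le> ennreal t" using s by (meson ennreal_leI order_trans)
      moreover have "0 < dens V A" using A V by (intro dens_pos) auto
      ultimately show False using True by (simp add: ennreal_le_iff2)
    qed
    then have ms: "ennreal m + (s - ennreal m) = s" by (rule add_diff_inverse_ennreal)
    have "{x \<in> V. s - ennreal m < ennreal (g' x)} \<subseteq> {x \<in> V. s < ennreal (g x)}"
    proof clarify
      fix x assume x: "x \<in> V" "s - ennreal m < ennreal (g' x)"
      have "x \<in> A"
      proof (rule ccontr)
        assume "x \<notin> A"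
        then have "g' x = 0" using x(1) g[OF x(1)] A(1) by (auto simp: g')
        then show False using x(2) by simp
      qed
      then have "ennreal m + ennreal (g' x) = ennreal (g x)"
        using m by (subst ennreal_plus[symmetric]) (auto simp: g')
      moreover have "ennreal m + (s - ennreal m) < ennreal m + ennreal (g' x)"
        using x(2) by (simp add: ennreal_add_left_cancel_less)
      ultimately show "s < ennreal (g x)" by (simp add: ms)
    qed
    from add_left_mono[OF lower[OF this], of "ennreal m"] show ?thesis using True by (simp add: ms)
  qed
qed

text \<open>Induction on the size of the support. Unlike dyadic levels, these layers reproduce g
  exactly, and their rearrangements add up below that of g; hence an estimate for indicators sums to
  one in L^{p,1} without loss.\<close>

lemma layer_decomposition:
  assumes V: "finite V" and g: "\<forall>x\<in>V. 0 \<le> g x"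
  shows "\<exists>(n::nat) m A. (\<forall>i<n. 0 \<le> m i \<and> A i \<subseteq> V) \<and> (\<forall>x\<in>V. g x = (\<Sum>i<n. m i * indicator (A i) x)) \<and>
    (\<forall>t. (\<Sum>i<n. ennreal (m i) * indicator {..<dens V (A i)} t) \<le> decr_rearr V g t)"
  using g
proof (induction "card {x \<in> V. 0 < g x}" arbitrary: g rule: less_induct)
  case less
  define A where "A = {x \<in> V. 0 < g x}"
  have fA: "finite A" using V by (simp add: A_def)
  show ?case
  proof (cases "A = {}")
    case True
    then have "\<forall>x\<in>V. g x = 0" using less.prems by (auto simp: A_def order.order_iff_strict)
    then show ?thesis by (intro exI[of _ 0]) simp
  next
    case False
    \<comment> \<open>The least positive value: subtracting it on the support keeps g nonnegative
      and removes at least one point from the support.\<close>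
    define m where "m = Min (g ` A)"
    have m: "0 < m" "m \<le> g x" if "x \<in> A" for x
      using fA False that by (auto simp: m_def A_def Min_gr_iff)
    have m0: "0 < m" using m False by blast
    have "m \<in> g ` A" unfolding m_def using fA False by (intro Min_in) auto
    then obtain z where z: "z \<in> A" "g z = m" by auto
    define g' where "g' = (\<lambda>x. g x - m * indicator A x)"
    have sub: "{x \<in> V. 0 < g' x} \<subset> A"
    proof
      show "{x \<in> V. 0 < g' x} \<subseteq> A" using less.prems by (auto simp: g'_def A_def indicator_def split: if_splits)
      have "z \<notin> {x \<in> V. 0 < g' x}" using z by (simp add: g'_def)
      then show "{x \<in> V. 0 < g' x} \<noteq> A" using z(1) by blast
    qed
    have g'0: "\<forall>x\<in>V. 0 \<le> g' x" using less.prems m by (auto simp: g'_def indicator_def)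
    have "card {x \<in> V. 0 < g' x} < card {x \<in> V. 0 < g x}"
      using psubset_card_mono[OF fA sub] by (simp add: A_def)
    from less.hyps[OF this g'0] obtain n :: nat and mm AA where
      IH1: "\<forall>i<n. 0 \<le> mm i \<and> AA i \<subseteq> V" and IH2: "\<forall>x\<in>V. g' x = (\<Sum>i<n. mm i * indicator (AA i) x)"
      and IH3: "\<forall>t. (\<Sum>i<n. ennreal (mm i) * indicator {..<dens V (AA i)} t) \<le> decr_rearr V g' t" by blast
    let ?m = "mm(n := m)" and ?A = "AA(n := A)"
    have "\<forall>i<Suc n. 0 \<le> ?m i \<and> ?A i \<subseteq> V" using IH1 m0 by (auto simp: A_def less_Suc_eq)
    moreover have "\<forall>x\<in>V. g x = (\<Sum>i<Suc n. ?m i * indicator (?A i) x)"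
    proof
      fix x assume "x \<in> V"
      then have "g x - m * indicator A x = (\<Sum>i<n. mm i * indicator (AA i) x)" using IH2 by (simp add: g'_def)
      then show "g x = (\<Sum>i<Suc n. ?m i * indicator (?A i) x)" by simp
    qed
    moreover have "(\<Sum>i<Suc n. ennreal (?m i) * indicator {..<dens V (?A i)} t) \<le> decr_rearr V g t" for t
    proof -
      have "(\<Sum>i<Suc n. ennreal (?m i) * indicator {..<dens V (?A i)} t) =
          ennreal m * indicator {..<dens V A} t + (\<Sum>i<n. ennreal (mm i) * indicator {..<dens V (AA i)} t)"
        by (simp add: add.commute)
      also have "\<dots> \<le> ennreal m * indicator {..<dens V A} t + decr_rearr V g' t"
        using IH3 by (intro add_left_mono) auto
      also have "\<dots> \<le> decr_rearr V g t"
        using m m0 False less.prems by (intro decr_rearr_split[OF V A_def]) (auto simp: g'_def)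
      finally show ?thesis .
    qed
    ultimately show ?thesis by blast
  qed
qed

text \<open>The Lorentz functional of an indicator of density c, namely the integral of
  t^(\<alpha>-1) over [0, c]; the integrands may differ at 0 and c only.\<close>

lemma nn_integral_powr_initial:
  assumes "0 < \<alpha>" "0 \<le> c"
  shows "(\<integral>\<^sup>+t\<in>{0<..}. ennreal (t powr \<alpha>) * indicator {..<c} t * ennreal (1 / t) \<partial>lborel) = ennreal (c powr \<alpha> / \<alpha>)"
proof -
  let ?f = "\<lambda>t. indicator {0..c} t * t powr (\<alpha> - 1)"
  have "((\<lambda>t. t powr (\<alpha> - 1)) has_integral c powr \<alpha> / \<alpha>) {0..c}"
    using has_integral_powr_from_0[of "\<alpha> - 1" c] assms by simp
  then have "((\<lambda>t. if t \<in> {0..c} then t powr (\<alpha> - 1) else 0) has_integral c powr \<alpha> / \<alpha>) UNIV"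
    by (subst has_integral_restrict_UNIV)
  moreover have "(\<lambda>t. if t \<in> {0..c} then t powr (\<alpha> - 1) else 0) = ?f"
    by (rule ext) (simp add: indicator_def)
  ultimately have I: "(?f has_integral c powr \<alpha> / \<alpha>) UNIV" by simp
  have "(\<integral>\<^sup>+t. ennreal (?f t) \<partial>lborel) = ennreal (c powr \<alpha> / \<alpha>)"
    by (rule nn_integral_has_integral_lborel[OF _ _ I]) simp_all
  then have "(\<integral>\<^sup>+t. indicator {0..c} t * ennreal (t powr (\<alpha> - 1)) \<partial>lborel) = ennreal (c powr \<alpha> / \<alpha>)"
    by (simp add: ennreal_mult' ennreal_indicator)
  moreover have "(\<integral>\<^sup>+t\<in>{0<..}. ennreal (t powr \<alpha>) * indicator {..<c} t * ennreal (1 / t) \<partial>lborel) =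
      (\<integral>\<^sup>+t. indicator {0..c} t * ennreal (t powr (\<alpha> - 1)) \<partial>lborel)"
  proof (rule nn_integral_cong_AE)
    have "AE t in lborel. t \<noteq> (0::real)" "AE t in lborel. t \<noteq> c" by (rule AE_lborel_singleton)+
    then show "AE t in lborel. ennreal (t powr \<alpha>) * indicator {..<c} t * ennreal (1 / t) * indicator {0<..} t =
        indicator {0..c} t * ennreal (t powr (\<alpha> - 1))"
    proof eventually_elim
      case (elim t)
      have "ennreal (t powr \<alpha>) * ennreal (1 / t) = ennreal (t powr (\<alpha> - 1))" if "0 < t"
        using that by (subst ennreal_mult[symmetric]) (auto simp: powr_diff)
      then show ?case using elim by (auto simp: indicator_def)
    qed
  qed
  ultimately show ?thesis by simp
qed

context quadric_family
begin

lemma rearrangement_eq: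
  assumes "q \<in> I"
  shows "rearrangement (dx (K q) d) f t = decr_rearr (sp q) (\<lambda>x. cmod (f x)) t"
proof -
  have "emeasure (dx (K q) d) {x \<in> sp q. P x} = ennreal (dens (sp q) {x \<in> sp q. P x})" for P
    unfolding dx_def by (subst emeasure_uniform_count_measure[OF sp_finite[OF assms]]) (auto simp: dens_def)
  then show ?thesis by (simp add: rearrangement_def decr_rearr_def space_dx)
qed

lemma Lorentz_1_ge:
  assumes q: "q \<in> I" and p: "0 < recip p"
  obtains n :: nat and m A where "\<And>i. i < n \<Longrightarrow> 0 \<le> m i" "\<And>i. i < n \<Longrightarrow> A i \<subseteq> sp q"
    "\<And>x. x \<in> sp q \<Longrightarrow> cmod (f x) = (\<Sum>i<n. m i * indicator (A i) x)"
    "ennreal (\<Sum>i<n. m i * (dens (sp q) (A i) powr recip p / recip p)) \<le> Lorentz_1_norm (dx (K q) d) p f"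
proof -
  let ?\<alpha> = "recip p"
  obtain n :: nat and m A where 1: "\<forall>i<n. 0 \<le> m i \<and> A i \<subseteq> sp q"
    and 2: "\<forall>x\<in>sp q. cmod (f x) = (\<Sum>i<n. m i * indicator (A i) x)"
    and 3: "\<forall>t. (\<Sum>i<n. ennreal (m i) * indicator {..<dens (sp q) (A i)} t) \<le> decr_rearr (sp q) (\<lambda>x. cmod (f x)) t"
    using layer_decomposition[OF sp_finite[OF q], of "\<lambda>x. cmod (f x)"] by auto
  have "ennreal (\<Sum>i<n. m i * (dens (sp q) (A i) powr ?\<alpha> / ?\<alpha>)) =
      (\<Sum>i<n. ennreal (m i) * ennreal (dens (sp q) (A i) powr ?\<alpha> / ?\<alpha>))"
    using 1 p by (subst sum_ennreal[symmetric]) (auto intro!: sum.cong simp: ennreal_mult simp del: times_divide_eq_right)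
  also have "\<dots> = (\<Sum>i<n. ennreal (m i) * (\<integral>\<^sup>+t\<in>{0<..}. ennreal (t powr ?\<alpha>) * indicator {..<dens (sp q) (A i)} t * ennreal (1 / t) \<partial>lborel))"
    by (simp add: nn_integral_powr_initial[OF p dens_nonneg])
  also have "\<dots> = (\<Sum>i<n. \<integral>\<^sup>+t. ennreal (m i) * (ennreal (t powr ?\<alpha>) * indicator {..<dens (sp q) (A i)} t * ennreal (1 / t) * indicator {0<..} t) \<partial>lborel)"
    by (intro sum.cong refl nn_integral_cmult[symmetric]) measurable
  also have "\<dots> = (\<integral>\<^sup>+t. (\<Sum>i<n. ennreal (m i) * (ennreal (t powr ?\<alpha>) * indicator {..<dens (sp q) (A i)} t * ennreal (1 / t) * indicator {0<..} t)) \<partial>lborel)"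
    by (intro nn_integral_sum[symmetric]) measurable
  also have "\<dots> \<le> (\<integral>\<^sup>+t\<in>{0<..}. ennreal (t powr ?\<alpha>) * rearrangement (dx (K q) d) f t * ennreal (1 / t) \<partial>lborel)"
  proof (rule nn_integral_mono)
    fix t :: real
    have "(\<Sum>i<n. ennreal (m i) * (ennreal (t powr ?\<alpha>) * indicator {..<dens (sp q) (A i)} t * ennreal (1 / t) * indicator {0<..} t)) =
        ennreal (t powr ?\<alpha>) * (\<Sum>i<n. ennreal (m i) * indicator {..<dens (sp q) (A i)} t) * ennreal (1 / t) * indicator {0<..} t"
      unfolding sum_distrib_left sum_distrib_right by (intro sum.cong refl) (simp only: mult_ac)
    also have "\<dots> \<le> ennreal (t powr ?\<alpha>) * rearrangement (dx (K q) d) f t * ennreal (1 / t) * indicator {0<..} t"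
      unfolding rearrangement_eq[OF q] using 3 by (intro mult_right_mono mult_left_mono) auto
    finally show "(\<Sum>i<n. ennreal (m i) * (ennreal (t powr ?\<alpha>) * indicator {..<dens (sp q) (A i)} t * ennreal (1 / t) * indicator {0<..} t)) \<le>
        ennreal (t powr ?\<alpha>) * rearrangement (dx (K q) d) f t * ennreal (1 / t) * indicator {0<..} t" .
  qed
  finally have "ennreal (\<Sum>i<n. m i * (dens (sp q) (A i) powr ?\<alpha> / ?\<alpha>)) \<le> Lorentz_1_norm (dx (K q) d) p f"
    by (simp add: Lorentz_1_norm_def)
  then show thesis using 1 2 by (intro that[of n m A]) auto
qed

lemma pairing_sum_left:
  "pairing V w (\<lambda>x. \<Sum>i<n. m i * f i x) g = (\<Sum>i<(n::nat). m i * pairing V w (f i) g)"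
proof (induction n)
  case 0
  then show ?case by (simp add: pairing_eq)
next
  case (Suc n)
  have "pairing V w (\<lambda>x. (\<Sum>i<n. m i * f i x) + m n * f n x) g =
      pairing V w (\<lambda>x. \<Sum>i<n. m i * f i x) g + m n * pairing V w (f n) g"
    by (simp add: pairing_def kop_add kop_cmult distrib_right mean_add mult.assoc mean_cmult)
  then show ?case using Suc by simp
qed

text \<open>f is cut into layers, the pairing is linear in them, and \<open>even_test_family\<close>
  treats each layer against an arbitrary g. The factor \<open>alpha1 d\<close> in the constant
  undoes the division in the Lorentz functional of an indicator.\<close>

lemma restricted_strong_type:
  assumes "even d" and pr: "1 \<le> p" "1 \<le> r" "P1 d = (recip p, recip r)"
  shows "\<exists>C::real. \<forall>q\<in>I. \<forall>f :: (nat \<Rightarrow> 'a) \<Rightarrow> complex.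
    ennreal (Lp_norm (dx (K q) d) r (averaging (K q) d (Q q) f)) \<le> ennreal C * Lorentz_1_norm (dx (K q) d) p f"
proof -
  have d4: "4 \<le> d" using d_ge_3 assms by (cases "d = 3") auto
  note v = vertex_relations[OF d4]
  have ab: "recip p = alpha1 d" "recip r = beta1 d" using pr(3) by (simp_all add: P1_eq)
  have a0: "0 < alpha1 d" using v(2,4) by simp
  obtain C where C: "0 < C" "\<And>V w E g. (V, w) \<in> W \<Longrightarrow> E \<subseteq> V \<Longrightarrow> \<forall>y\<in>V. 0 \<le> g y \<Longrightarrow>
    pairing V w (indicator E) g \<le> C * (dens V E powr alpha1 d * pnorm V (1 - beta1 d) g)"
    by (rule even_test_family[OF assms(1)]) (rule that)
  show ?thesis
  proof (rule exI[of _ "C * alpha1 d"], intro ballI allI)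
    fix q and f :: "(nat \<Rightarrow> 'a) \<Rightarrow> complex" assume q: "q \<in> I"
    note V = sp_finite[OF q] sp_ne[OF q]
    have "0 < recip p" using a0 by (simp add: ab)
    from Lorentz_1_ge[OF q this, of f] obtain n :: nat and m A where m: "\<And>i. i < n \<Longrightarrow> 0 \<le> m i"
      and A: "\<And>i. i < n \<Longrightarrow> A i \<subseteq> sp q"
      and f: "\<And>x. x \<in> sp q \<Longrightarrow> cmod (f x) = (\<Sum>i<n. m i * indicator (A i) x)"
      and L: "ennreal (\<Sum>i<n. m i * (dens (sp q) (A i) powr recip p / recip p)) \<le> Lorentz_1_norm (dx (K q) d) p f" by blast
    let ?X = "\<Sum>i<n. m i * (dens (sp q) (A i) powr alpha1 d / alpha1 d)"
    have X0: "0 \<le> ?X" using m a0 by (intro sum_nonneg) auto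
    have "pnorm (sp q) (beta1 d) (kop (sp q) (ker q) (\<lambda>x. cmod (f x))) \<le> C * alpha1 d * ?X"
    proof (rule pnorm_dual[OF V v(1,2)])
      show "0 \<le> kop (sp q) (ker q) (\<lambda>x. cmod (f x)) y" if "y \<in> sp q" for y
        by (rule kop_ge_0[OF W_I[OF q] _ that]) simp
      show "0 \<le> C * alpha1 d * ?X" using C(1) a0 X0 by simp
      fix g :: "(nat \<Rightarrow> 'a) \<Rightarrow> real" assume g: "\<And>x. x \<in> sp q \<Longrightarrow> 0 \<le> g x"
      have "mean (sp q) (\<lambda>x. kop (sp q) (ker q) (\<lambda>x. cmod (f x)) x * g x) =
          pairing (sp q) (ker q) (\<lambda>x. \<Sum>i<n. m i * indicator (A i) x) g"
        unfolding pairing_def[symmetric] using f by (intro pairing_cong) auto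
      also have "\<dots> = (\<Sum>i<n. m i * pairing (sp q) (ker q) (indicator (A i)) g)" by (rule pairing_sum_left)
      also have "\<dots> \<le> (\<Sum>i<n. m i * (C * (dens (sp q) (A i) powr alpha1 d * pnorm (sp q) (1 - beta1 d) g)))"
        using m A g by (intro sum_mono mult_left_mono C(2)[OF W_I[OF q]]) auto
      also have "\<dots> = C * alpha1 d * ?X * pnorm (sp q) (1 - beta1 d) g"
        using a0 by (simp add: sum_distrib_left sum_distrib_right mult_ac)
      finally show "mean (sp q) (\<lambda>x. kop (sp q) (ker q) (\<lambda>x. cmod (f x)) x * g x) \<le>
          C * alpha1 d * ?X * pnorm (sp q) (1 - beta1 d) g" .
    qed
    then have "Lp_norm (dx (K q) d) r (averaging (K q) d (Q q) f) \<le> C * alpha1 d * ?X"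
      using Lp_norm_averaging_le[OF q pr(2), of f] by (simp add: ab)
    then have "ennreal (Lp_norm (dx (K q) d) r (averaging (K q) d (Q q) f)) \<le> ennreal (C * alpha1 d) * ennreal ?X"
      using C(1) a0 X0 by (subst ennreal_mult[symmetric]) (auto intro: ennreal_leI)
    also have "\<dots> \<le> ennreal (C * alpha1 d) * Lorentz_1_norm (dx (K q) d) p f"
      using L by (intro mult_left_mono) (simp_all add: ab)
    finally show "ennreal (Lp_norm (dx (K q) d) r (averaging (K q) d (Q q) f)) \<le>
        ennreal (C * alpha1 d) * Lorentz_1_norm (dx (K q) d) p f" .
  qed
qed

text \<open>The transpose of the estimate at \<open>P1\<close>: by symmetry of the kernel the
  average of |f| over a superlevel set F is the pairing of the averaged indicator of F with
  |f|.\<close>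

lemma weak_type:
  assumes "even d" and pr: "1 \<le> r'" "recip p' = 1 - alpha1 d" "recip r' = 1 - beta1 d"
  shows "\<exists>C::real. \<forall>q\<in>I. \<forall>f :: (nat \<Rightarrow> 'a) \<Rightarrow> complex.
    Lorentz_inf_norm (dx (K q) d) p' (averaging (K q) d (Q q) f) \<le> ennreal C * ennreal (Lp_norm (dx (K q) d) r' f)"
proof -
  have d4: "4 \<le> d" using d_ge_3 assms by (cases "d = 3") auto
  note v = vertex_relations[OF d4]
  define e where "e = 1 - alpha1 d"
  have e: "0 < e" using v(3) by (simp add: e_def)
  obtain C where C: "0 < C" "\<And>V w E g. (V, w) \<in> W \<Longrightarrow> E \<subseteq> V \<Longrightarrow> \<forall>y\<in>V. 0 \<le> g y \<Longrightarrow>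
    pairing V w (indicator E) g \<le> C * (dens V E powr alpha1 d * pnorm V (1 - beta1 d) g)"
    by (rule even_test_family[OF assms(1)]) (rule that)
  show ?thesis
  proof (rule exI[of _ C], intro ballI allI)
    fix q and f :: "(nat \<Rightarrow> 'a) \<Rightarrow> complex" assume q: "q \<in> I"
    note V = sp_finite[OF q] sp_ne[OF q]
    define P where "P = pnorm (sp q) (1 - beta1 d) (\<lambda>x. cmod (f x))"
    have P: "Lp_norm (dx (K q) d) r' f = P" by (simp add: Lp_norm_eq[OF q pr(1)] P_def pr(3))
    have P0: "0 \<le> P" unfolding P_def by (rule pnorm_nonneg[OF V])
    let ?T = "\<lambda>x. cmod (averaging (K q) d (Q q) f x)"
    have "ennreal (t powr e) * decr_rearr (sp q) ?T t \<le> ennreal (C * P)" if t: "0 < t" for t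
    proof -
      \<comment> \<open>The level at which the claimed weak bound becomes an equality. If its
        superlevel set F had density above t, the pairing with the indicator of F would exceed s
        times that density, against the estimate at \<open>P1\<close>.\<close>
      define s where "s = C * P * t powr (- e)"
      have s0: "0 \<le> s" using C(1) P0 by (simp add: s_def)
      define F where "F = {x \<in> sp q. s < ?T x}"
      have FV: "F \<subseteq> sp q" by (auto simp: F_def)
      have le: "dens (sp q) F \<le> t"
      proof (rule ccontr)
        assume "\<not> dens (sp q) F \<le> t"
        then have tF: "t < dens (sp q) F" by simp
        then have Fne: "F \<noteq> {}" using t by (auto simp: dens_def)
        have F0: "0 < dens (sp q) F" using tF t by simp
        have "s * card F < (\<Sum>x\<in>F. ?T x)"
          using sum_strict_mono[OF finite_subset[OF FV V(1)] Fne, of "\<lambda>_. s" ?T] by (simp add: F_def mult.commute)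
        then have "s * dens (sp q) F < (\<Sum>x\<in>F. ?T x) / card (sp q)"
          using V unfolding dens_def times_divide_eq_right by (intro divide_strict_right_mono) (auto simp: card_gt_0_iff)
        also have "\<dots> = mean (sp q) (\<lambda>x. ?T x * indicator F x)"
          using sum_over_subset[OF V(1) FV, of ?T] by (simp add: mean_def mult.commute)
        also have "\<dots> \<le> pairing (sp q) (ker q) (\<lambda>x. cmod (f x)) (indicator F)"
          unfolding pairing_def using averaging_kop(1)[OF q] by (intro mean_mono mult_right_mono) auto
        also have "\<dots> = pairing (sp q) (ker q) (indicator F) (\<lambda>x. cmod (f x))"
          by (rule pairing_commute[OF sym[OF W_I[OF q]]])
        also have "\<dots> \<le> C * (dens (sp q) F powr alpha1 d * P)"
          unfolding P_def by (rule C(2)[OF W_I[OF q] FV]) simp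
        also have "dens (sp q) F powr alpha1 d = dens (sp q) F * dens (sp q) F powr (- e)"
          using F0 powr_mult_base[of "dens (sp q) F" "- e"] by (simp add: e_def)
        also have "C * (dens (sp q) F * dens (sp q) F powr (- e) * P) = C * P * dens (sp q) F powr (- e) * dens (sp q) F"
          by (simp only: mult_ac)
        finally have "s < C * P * dens (sp q) F powr (- e)" using F0 by (simp only: mult_less_cancel_right_pos)
        also have "\<dots> \<le> C * P * t powr (- e)"
          using tF t e C(1) P0 by (intro mult_left_mono powr_mono2') simp_all
        finally show False by (simp add: s_def)
      qed
      have "{x \<in> sp q. ennreal s < ennreal (?T x)} = F" using s0 by (auto simp: F_def ennreal_less_iff)
      then have "decr_rearr (sp q) ?T t \<le> ennreal s"
        unfolding decr_rearr_def using le by (intro Inf_lower) (simp add: ennreal_leI)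
      then have "ennreal (t powr e) * decr_rearr (sp q) ?T t \<le> ennreal (t powr e) * ennreal s"
        by (rule mult_left_mono) simp
      also have "\<dots> = ennreal (t powr e * s)" using s0 by (simp add: ennreal_mult)
      also have "t powr e * s = C * P * (t powr e * t powr (- e))" by (simp only: s_def mult_ac)
      also have "t powr e * t powr (- e) = 1" unfolding powr_add[symmetric] using t by simp
      finally show ?thesis by simp
    qed
    then show "Lorentz_inf_norm (dx (K q) d) p' (averaging (K q) d (Q q) f) \<le> ennreal C * ennreal (Lp_norm (dx (K q) d) r' f)"
      unfolding Lorentz_inf_norm_def P rearrangement_eq[OF q] pr(2) e_def[symmetric]
      using C(1) P0 by (intro SUP_least) (auto simp: ennreal_mult[symmetric])
  qed
qed

end

theorem theorem2p3:
  fixes d :: nat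
    and I :: "nat set"
    and K :: "nat \<Rightarrow> 'a ring"
    and Q :: "nat \<Rightarrow> (nat \<Rightarrow> 'a) \<Rightarrow> 'a"
  assumes "form_family d I K Q"
  shows
    "(d \<ge> 3 \<and> odd d \<longrightarrow>
        (\<forall>p r :: ennreal. 1 \<le> p \<and> 1 \<le> r \<longrightarrow>
           (avg_bounded d I K Q p r \<longleftrightarrow> (recip p, recip r) \<in> T_region d))) \<and>
     (d \<ge> 4 \<and> even d \<longrightarrow>
        (\<forall>p r :: ennreal. 1 \<le> p \<and> 1 \<le> r \<and>
           (recip p, recip r) \<in> Omega_region d - {P1 d, P2 d} \<longrightarrow>
           avg_bounded d I K Q p r)) \<and>
     (d \<ge> 4 \<and> even d \<longrightarrow>
        (\<forall>p r p' r' :: ennreal. 1 \<le> p \<and> 1 \<le> r \<and> 1 \<le> p' \<and> 1 \<le> r' \<and>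
           P1 d = (recip p, recip r) \<and> recip p + recip p' = 1 \<and> recip r + recip r' = 1 \<longrightarrow>
           (\<exists>C::real. \<forall>q\<in>I. \<forall>f :: (nat \<Rightarrow> 'a) \<Rightarrow> complex.
              ennreal (Lp_norm (dx (K q) d) r (averaging (K q) d (Q q) f))
                \<le> ennreal C * Lorentz_1_norm (dx (K q) d) p f) \<and>
           P2 d = (recip r', recip p') \<and>
           (\<exists>C::real. \<forall>q\<in>I. \<forall>f :: (nat \<Rightarrow> 'a) \<Rightarrow> complex.
              Lorentz_inf_norm (dx (K q) d) p' (averaging (K q) d (Q q) f)
                \<le> ennreal C * ennreal (Lp_norm (dx (K q) d) r' f)))) \<and>
     (d \<ge> 4 \<and> even d \<and>
        (\<forall>q\<in>I. \<exists>H \<subseteq> quadric (K q) d (Q q).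
           subspace_of_dim (K q) (coord_space (K q) d) (d div 2) H) \<longrightarrow>
        (\<forall>p r :: ennreal. 1 \<le> p \<and> 1 \<le> r \<and> (recip p, recip r) \<notin> Omega_region d \<longrightarrow>
           \<not> avg_bounded d I K Q p r))"
proof (intro conjI impI allI)
  fix p r :: ennreal
  assume d: "d \<ge> 3 \<and> odd d" and pr: "1 \<le> p \<and> 1 \<le> r"
  interpret quadric_family d I K Q using assms d by unfold_locales auto
  have p: "1 \<le> p" and r: "1 \<le> r" and d3: "3 \<le> d" and odd: "odd d" using pr d by auto
  note b = recip_bounds[OF p] recip_bounds[OF r]
  show "avg_bounded d I K Q p r \<longleftrightarrow> (recip p, recip r) \<in> T_region d"
    unfolding avg_bounded_iff_strong[OF p r] T_region_iff[OF d3]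
    using strong_imp_ineqs[OF _ b] strong_if_ineqs_odd[OF odd] b by blast
next
  fix p r :: ennreal
  assume d: "d \<ge> 4 \<and> even d" and pr: "1 \<le> p \<and> 1 \<le> r \<and> (recip p, recip r) \<in> Omega_region d - {P1 d, P2 d}"
  interpret quadric_family d I K Q using assms d by unfold_locales auto
  have p: "1 \<le> p" and r: "1 \<le> r" and d4: "4 \<le> d" and even: "even d"
    and ne: "(recip p, recip r) \<noteq> P1 d" "(recip p, recip r) \<noteq> P2 d" using pr d by auto
  have "(recip p, recip r) \<in> Omega_region d" using pr by blast
  then show "avg_bounded d I K Q p r"
    unfolding avg_bounded_iff_strong[OF p r] Omega_region_iff[OF d4]
    using strong_if_ineqs_even[OF even _ _ _ _ _ _ ne] by blast
next
  fix p r p' r' :: ennreal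
  assume d: "d \<ge> 4 \<and> even d" and pr: "1 \<le> p \<and> 1 \<le> r \<and> 1 \<le> p' \<and> 1 \<le> r' \<and>
    P1 d = (recip p, recip r) \<and> recip p + recip p' = 1 \<and> recip r + recip r' = 1"
  interpret quadric_family d I K Q using assms d by unfold_locales auto
  have d4: "4 \<le> d" and even: "even d" using d by auto
  have dual: "recip p' = 1 - alpha1 d" "recip r' = 1 - beta1 d" using pr by (auto simp: P1_eq)
  show "\<exists>C::real. \<forall>q\<in>I. \<forall>f :: (nat \<Rightarrow> 'a) \<Rightarrow> complex.
      ennreal (Lp_norm (dx (K q) d) r (averaging (K q) d (Q q) f)) \<le> ennreal C * Lorentz_1_norm (dx (K q) d) p f"
    using pr by (intro restricted_strong_type[OF even]) auto
  show "P2 d = (recip r', recip p')" by (simp add: P2_eq[OF d4] dual)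
  show "\<exists>C::real. \<forall>q\<in>I. \<forall>f :: (nat \<Rightarrow> 'a) \<Rightarrow> complex.
      Lorentz_inf_norm (dx (K q) d) p' (averaging (K q) d (Q q) f) \<le> ennreal C * ennreal (Lp_norm (dx (K q) d) r' f)"
    using pr by (intro weak_type[OF even _ dual]) auto
next
  fix p r :: ennreal
  assume d: "d \<ge> 4 \<and> even d \<and> (\<forall>q\<in>I. \<exists>H \<subseteq> quadric (K q) d (Q q).
      subspace_of_dim (K q) (coord_space (K q) d) (d div 2) H)"
    and pr: "1 \<le> p \<and> 1 \<le> r \<and> (recip p, recip r) \<notin> Omega_region d"
  interpret quadric_family d I K Q using assms d by unfold_locales auto
  have p: "1 \<le> p" and r: "1 \<le> r" and d4: "4 \<le> d" and even: "even d"
    and H: "\<forall>q\<in>I. \<exists>H \<subseteq> quadric (K q) d (Q q). subspace_of_dim (K q) (coord_space (K q) d) (d div 2) H"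
    and out: "(recip p, recip r) \<notin> Omega_region d" using pr d by auto
  note b = recip_bounds[OF p] recip_bounds[OF r]
  show "\<not> avg_bounded d I K Q p r"
    unfolding avg_bounded_iff_strong[OF p r]
  proof
    assume s: "strong (recip p) (recip r)"
    have "(recip p, recip r) \<in> Omega_region d"
      unfolding Omega_region_iff[OF d4]
      using strong_imp_ineqs[OF s b] strong_imp_ineq_subspace[OF s b(1,3) even H] b by blast
    with out show False by contradiction
  qed
qed

end
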